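(* Let $\{\beta_t,\mathfrak{e}^t\}_{t\in\mathcal{I}}$ be a left-invariant parallel spinor flow on a simply connected three-dimensional Lie group $\mathrm{G}$. Denote by $\{h_{\mathfrak{e}^t}\}_{t\in\mathcal{I}}$, $h_{\mathfrak{e}^t}=e^t_u\otimes e^t_u+e^t_l\otimes e^t_l+e^t_n\otimes e^t_n$, the associated family of Riemannian metrics and by $(\mathfrak{e},\Theta)$, $\mathfrak{e}=(e_u,e_l,e_n)$, its initial parallel Cauchy pair. Then: (1) If $\Theta_{ul}^2+\Theta_{un}^2=0$ and $\Theta_{uu}\neq0$, then $$h_{\mathfrak{e}^t}=(1-\Theta_{uu}\mathcal{B}_t)^2\,e_u\otimes e_u+(e_l,e_n)\,Q\begin{pmatrix}(1-\Theta_{uu}\mathcal{B}_t)^{2\rho_+}&0\\0&(1-\Theta_{uu}\mathcal{B}_t)^{2\rho_-}\end{pmatrix}Q^{*}\begin{pmatrix} e_l \\ e_n \end{pmatrix},$$ where $\rho_\pm=\frac{T\pm\sqrt{T^2-4\Delta}}{2\Theta_{uu}}$ are the eigenvalues of $\theta/\Theta_{uu}$ and $Q$ is its orthogonal diagonalization matrix, that is, $\theta/\Theta_{uu}=Q\,\mathrm{diag}(\rho_+,\rho_-)\,Q^*$ with $Q$ orthogonal and $Q^*$ its transpose. In particular, $\mathrm{G}=\mathbb{R}^3$ if $\theta=0$; $\mathrm{G}=\mathrm{E}(1,1)$ if $T=0$ and $\theta\neq0$; $\mathrm{G}=\tau_2\oplus\mathbb{R}$ if $T\neq0$ and $\Delta=0$;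 and $\mathrm{G}=\tau_{3,\mu}$ if $T\neq0$ and $\Delta\neq0$. The case $\Theta_{uu}=0$ (still with $\Theta_{ul}^2+\Theta_{un}^2=0$) is obtained by taking the formal limit $\Theta_{uu}\to0$ in the previous expressions. (2) If $\Theta_{ul}=0$ but $\Theta_{un}\neq0$, then $$\begin{aligned}h_{\mathfrak{e}^t}={}&\Big((1-\Theta_{uu}\mathcal{B}_t)^2\sec^2 y_t+\tfrac{\Theta_{uu}^2}{\lambda^2}-\tfrac{2\Theta_{uu}}{\lambda}(1-\Theta_{uu}\mathcal{B}_t)\tan y_t\Big)e_u\otimes e_u\\&+\Big(\tfrac{\Theta_{uu}}{\Theta_{un}}-\Theta_{un}\mathcal{B}_t\sec^2 y_t\,(1-\Theta_{uu}\mathcal{B}_t)-\tfrac{\lambda}{\Theta_{un}}\tan y_t\,(1-2\Theta_{uu}\mathcal{B}_t)\Big)e_u\odot e_n\\&+e_l\otimes e_l+\Big(1+\lambda^2\mathcal{B}_t^2\sec^2 y_t+2\lambda\mathcal{B}_t\tan y_t\Big)e_n\otimes e_n,\end{aligned}$$ where $y_t=\lambda\mathcal{B}_t+\arctan(\Theta_{uu}/\lambda)$. In particular $\mathrm{G}=\tau_2\oplus\mathbb{R}$. The case $\Theta_{ul}\neq0$ but $\Theta_{un}=0$ is obtained by exchanging the subindices $l$ and $n$ in the previous expression. (3) If $\Theta_{ul}\Theta_{un}\neq0$, then $$\begin{aligned}h_{\mathfrak{e}^t}={}&\Big((1+T\mathcal{B}_t)^2+\big(\tan y_t\,(1+T\mathcal{B}_t)+\tfrac{T}{\lambda}\big)^2\Big)e_u\otimes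 e_u\\&-\Big(\tfrac{T}{\lambda^2}+\tfrac{\tan y_t}{\lambda}(1+2T\mathcal{B}_t)+\mathcal{B}_t(1+T\mathcal{B}_t)\sec^2 y_t\Big)(\Theta_{ul}\,e_u\odot e_l+\Theta_{un}\,e_u\odot e_n)\\&+\Big(1+\Theta_{ul}^2\mathcal{B}_t\big(\mathcal{B}_t\sec^2 y_t+\tfrac{2\tan y_t}{\lambda}\big)\Big)e_l\otimes e_l+\Theta_{ul}\Theta_{un}\mathcal{B}_t\sec^2 y_t\Big(\mathcal{B}_t+\tfrac{\sin(2y_t)}{\lambda}\Big)e_l\odot e_n\\&+\Big(1+\Theta_{un}^2\mathcal{B}_t\big(\mathcal{B}_t\sec^2 y_t+\tfrac{2\tan y_t}{\lambda}\big)\Big)e_n\otimes e_n.\end{aligned}$$ In particular, $\mathrm{G}=\tau_2\oplus\mathbb{R}$. Furthermore, if $\lambda=0$ the flow is globally defined (namely $\mathcal{I}=\mathbb{R}$) if and only if $\int_0^\infty\beta_\tau\,\mathrm{d}\tau<|\Theta_{uu}^{-1}|$, whereas if $\lambda\neq0$ the flow is globally defined if and only if $|y_t|<\frac{\pi}{2}$ for all $t\in\mathbb{R}$.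
   Context: $\mathcal{I}$ is an interval containing $0$; indices $a,b$ run over $u,l,n$; $\alpha\odot\beta:=\alpha\otimes\beta+\beta\otimes\alpha$. For a Riemannian metric $h$, a symmetric two-tensor $\Theta$ and a one-form $\alpha$, $\Theta(\alpha):=\Theta(\alpha^{\sharp_h},\cdot)$, where $\alpha^{\sharp_h}$ is the metric dual of $\alpha$. A left-invariant parallel spinor flow on $\mathrm{G}$ is a smooth family $\{\beta_t,\mathfrak{e}^t\}_{t\in\mathcal{I}}$ of positive constants $\beta_t$ and left-invariant coframes $\mathfrak{e}^t=(e^t_u,e^t_l,e^t_n)$ on $\mathrm{G}$ such that, with $h_{\mathfrak{e}^t}=\sum_a e^t_a\otimes e^t_a$ and $\Theta_t=-\frac{1}{2\beta_t}\partial_th_{\mathfrak{e}^t}$, $$\partial_te^t_a+\beta_t\Theta_t(e^t_a)=0,\quad \mathrm{d}e^t_a=\Theta_t(e^t_a)\wedge e^t_u,\quad \partial_t(\Theta_t(e^t_u))=0,\quad \mathrm{d}(\Theta_t(e^t_u))=0,\qquad a=u,l,n.$$ Its initial parallel Cauchy pair is $(\mathfrak{e},\Theta)=(\mathfrak{e}^0,\Theta_0)$. Write $\Theta=\sum_{a,b}\Theta_{ab}\,e_a\otimes e_b$ and $$\lambda=\sqrt{\Theta_{ul}^2+\Theta_{un}^2},\quad \theta=\begin{pmatrix}\Theta_{ll}&\Theta_{ln}\\\Theta_{ln}&\Theta_{nn}\end{pmatrix},\quad T=\mathrm{Tr}(\theta),\quad\Delta=\det(\theta),$$ $$\mathcal{B}_t=\int_0^t\beta_\tau\,\mathrm{d}\tau,\qquad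 y_t=\lambda\mathcal{B}_t+\arctan\left(\frac{\Theta_{uu}}{\lambda}\right)\ (\text{for }\lambda\neq0).$$ Lie groups (all connected and simply connected; equalities of groups are understood up to isomorphism, and $\tau_{3,\mu}$ means for some value of $\mu$): $\tau_2\oplus\mathbb{R}$ has Lie algebra with basis $X_1,X_2,X_3$ and only nonzero bracket $[X_1,X_2]=X_2$; $\mathrm{E}(1,1)$ has $[X_1,X_2]=X_2$, $[X_1,X_3]=-X_3$; $\tau_{3,\mu}$, with $0<|\mu|\le1$, has $[X_1,X_2]=X_2$, $[X_1,X_3]=\mu X_3$.
   Formalization: The criterion for λ=0 is false as printed (Θ_uu=1, β_t=e^{-t} is global with integral 1); it is replaced by: the integral of β over {τ: Θ_uu τ ≥ 0} is ≤ 1/|Θ_uu| (with 1/0=∞), and the printed form is kept for Θ_uu>0 when the integral differs from 1/Θ_uu. *)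

theory Defs
  imports "HOL-Analysis.Analysis" "HOL-Algebra.Group"
begin

section \<open>Smooth manifolds and Lie groups\<close>

text \<open>\<open>Ck_on k S f\<close> is meant for open \<open>S\<close>: \<open>f\<close> has continuous derivatives up to order \<open>k\<close> on \<open>S\<close>.\<close>

primrec Ck_on :: "nat \<Rightarrow> 'a::euclidean_space set \<Rightarrow> ('a \<Rightarrow> 'b::real_normed_vector) \<Rightarrow> bool" where
  "Ck_on 0 S f = continuous_on S f"
| "Ck_on (Suc k) S f =
     (f differentiable_on S \<and> (\<forall>v. Ck_on k S (\<lambda>x. frechet_derivative f (at x) v)))"

definition smooth_on :: "'a::euclidean_space set \<Rightarrow> ('a \<Rightarrow> 'b::real_normed_vector) \<Rightarrow> bool" where
  "smooth_on S f \<longleftrightarrow> (\<forall>k. Ck_on k S f)"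

type_synonym ('m, 'e) chart = "'m set \<times> ('m \<Rightarrow> 'e)"

definition chart :: "('m::topological_space, 'e::euclidean_space) chart \<Rightarrow> bool" where
  "chart c \<longleftrightarrow> (case c of (U, \<phi>) \<Rightarrow>
     open U \<and> open (\<phi> ` U) \<and> homeomorphism U (\<phi> ` U) \<phi> (inv_into U \<phi>))"

definition smooth_atlas :: "('m::topological_space, 'e::euclidean_space) chart set \<Rightarrow> bool" where
  "smooth_atlas A \<longleftrightarrow>
     (\<forall>c\<in>A. chart c) \<and> (\<Union>c\<in>A. fst c) = UNIV \<and>
     (\<forall>(U, \<phi>)\<in>A. \<forall>(V, \<psi>)\<in>A. smooth_on (\<phi> ` (U \<inter> V)) (\<psi> \<circ> inv_into U \<phi>))"

definition prod_atlas ::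
  "('m, 'e) chart set \<Rightarrow> ('n, 'f) chart set \<Rightarrow> ('m \<times> 'n, 'e \<times> 'f) chart set" where
  "prod_atlas A B = {(U \<times> V, map_prod \<phi> \<psi>) | U \<phi> V \<psi>. (U, \<phi>) \<in> A \<and> (V, \<psi>) \<in> B}"

definition smooth_map ::
  "('m::topological_space, 'e::euclidean_space) chart set \<Rightarrow>
   ('n::topological_space, 'f::euclidean_space) chart set \<Rightarrow> ('m \<Rightarrow> 'n) \<Rightarrow> bool" where
  "smooth_map A B f \<longleftrightarrow> continuous_on UNIV f \<and>
     (\<forall>(U, \<phi>)\<in>A. \<forall>(V, \<psi>)\<in>B. smooth_on (\<phi> ` (U \<inter> f -` V)) (\<psi> \<circ> f \<circ> inv_into U \<phi>))"

text \<open>A Lie group lives on a whole (Hausdorff, second countable) type; its dimension is that of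
  the model space \<open>'e\<close>.\<close>

definition lie_group ::
  "'g::{t2_space, second_countable_topology} monoid \<Rightarrow> ('g, 'e::euclidean_space) chart set \<Rightarrow> bool" where
  "lie_group G A \<longleftrightarrow> group G \<and> carrier G = UNIV \<and> smooth_atlas A \<and>
     smooth_map (prod_atlas A A) A (\<lambda>(x, y). x \<otimes>\<^bsub>G\<^esub> y) \<and>
     smooth_map A A (\<lambda>x. inv\<^bsub>G\<^esub> x)"

text \<open>The library predicate \<open>simply_connected\<close> (any two loops are freely homotopic) includes path
  connectedness.\<close>

definition simply_connected_lie_group ::
  "'g::{t2_space, second_countable_topology} monoid \<Rightarrow> ('g, 'e::euclidean_space) chart set \<Rightarrow> bool" where
  "simply_connected_lie_group G A \<longleftrightarrow> lie_group G A \<and> simply_connected (UNIV :: 'g set)"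


section \<open>The Lie algebra of left-invariant vector fields\<close>

definition smooth_functions ::
  "('m::topological_space, 'e::euclidean_space) chart set \<Rightarrow> ('m \<Rightarrow> real) set" where
  "smooth_functions A = {f. \<forall>(U, \<phi>)\<in>A. smooth_on (\<phi> ` U) (f \<circ> inv_into U \<phi>)}"

text \<open>A vector field is a derivation of the algebra of smooth functions. As HOL functions are total,
  it is set to zero on non-smooth arguments, so that equal vector fields are equal HOL functions.\<close>

type_synonym 'm vfield = "('m \<Rightarrow> real) \<Rightarrow> 'm \<Rightarrow> real"

definition vector_fields ::
  "('m::topological_space, 'e::euclidean_space) chart set \<Rightarrow> 'm vfield set" where
  "vector_fields A = {X.
     (\<forall>f\<in>smooth_functions A. X f \<in> smooth_functions A) \<and>
     (\<forall>f\<in>smooth_functions A. \<forall>g\<in>smooth_functions A. \<forall>a b.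
        X (\<lambda>p. a * f p + b * g p) = (\<lambda>p. a * X f p + b * X g p)) \<and>
     (\<forall>f\<in>smooth_functions A. \<forall>g\<in>smooth_functions A.
        X (\<lambda>p. f p * g p) = (\<lambda>p. X f p * g p + f p * X g p)) \<and>
     (\<forall>f. f \<notin> smooth_functions A \<longrightarrow> X f = (\<lambda>p. 0))}"

definition lie_algebra ::
  "'g::topological_space monoid \<Rightarrow> ('g, 'e::euclidean_space) chart set \<Rightarrow> 'g vfield set" where
  "lie_algebra G A = {X \<in> vector_fields A. \<forall>f\<in>smooth_functions A. \<forall>g p.
     X (\<lambda>q. f (g \<otimes>\<^bsub>G\<^esub> q)) p = X f (g \<otimes>\<^bsub>G\<^esub> p)}"

definition bracket :: "'m vfield \<Rightarrow> 'm vfield \<Rightarrow> 'm vfield" where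
  "bracket X Y = (\<lambda>f p. X (Y f) p - Y (X f) p)"

definition zero_field :: "'m vfield" where
  "zero_field = (\<lambda>f p. 0)"

definition scale_field :: "real \<Rightarrow> 'm vfield \<Rightarrow> 'm vfield" where
  "scale_field a X = (\<lambda>f p. a * X f p)"

definition add_field :: "'m vfield \<Rightarrow> 'm vfield \<Rightarrow> 'm vfield" where
  "add_field X Y = (\<lambda>f p. X f p + Y f p)"

definition lie_algebra_basis ::
  "'g::topological_space monoid \<Rightarrow> ('g, 'e::euclidean_space) chart set \<Rightarrow>
   'g vfield \<Rightarrow> 'g vfield \<Rightarrow> 'g vfield \<Rightarrow> bool" where
  "lie_algebra_basis G A X1 X2 X3 \<longleftrightarrow>
     bij_betw (\<lambda>(a, b, c). add_field (scale_field a X1) (add_field (scale_field b X2) (scale_field c X3)))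
       UNIV (lie_algebra G A)"


section \<open>The simply connected groups of the classification\<close>

text \<open>A simply connected Lie group is determined up to isomorphism by its Lie algebra. Accordingly
  each group below is the simply connected Lie group whose Lie algebra has a basis with the listed
  brackets, and being equal (isomorphic) to it means having these properties.\<close>

definition is_R3 ::
  "'g::{t2_space, second_countable_topology} monoid \<Rightarrow> ('g, 'e::euclidean_space) chart set \<Rightarrow> bool" where
  "is_R3 G A \<longleftrightarrow> simply_connected_lie_group G A \<and>
     (\<exists>X1 X2 X3. lie_algebra_basis G A X1 X2 X3 \<and>
        bracket X1 X2 = zero_field \<and> bracket X1 X3 = zero_field \<and> bracket X2 X3 = zero_field)"

definition is_tau2_R ::
  "'g::{t2_space, second_countable_topology} monoid \<Rightarrow> ('g, 'e::euclidean_space) chart set \<Rightarrow> bool" where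
  "is_tau2_R G A \<longleftrightarrow> simply_connected_lie_group G A \<and>
     (\<exists>X1 X2 X3. lie_algebra_basis G A X1 X2 X3 \<and>
        bracket X1 X2 = X2 \<and> bracket X1 X3 = zero_field \<and> bracket X2 X3 = zero_field)"

definition is_E11 ::
  "'g::{t2_space, second_countable_topology} monoid \<Rightarrow> ('g, 'e::euclidean_space) chart set \<Rightarrow> bool" where
  "is_E11 G A \<longleftrightarrow> simply_connected_lie_group G A \<and>
     (\<exists>X1 X2 X3. lie_algebra_basis G A X1 X2 X3 \<and>
        bracket X1 X2 = X2 \<and> bracket X1 X3 = scale_field (-1) X3 \<and> bracket X2 X3 = zero_field)"

definition is_tau3 ::
  "real \<Rightarrow> 'g::{t2_space, second_countable_topology} monoid \<Rightarrow> ('g, 'e::euclidean_space) chart set \<Rightarrow> bool" where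
  "is_tau3 \<mu> G A \<longleftrightarrow> 0 < \<bar>\<mu>\<bar> \<and> \<bar>\<mu>\<bar> \<le> 1 \<and> simply_connected_lie_group G A \<and>
     (\<exists>X1 X2 X3. lie_algebra_basis G A X1 X2 X3 \<and>
        bracket X1 X2 = X2 \<and> bracket X1 X3 = scale_field \<mu> X3 \<and> bracket X2 X3 = zero_field)"


section \<open>Left-invariant forms and tensors\<close>

text \<open>Left-invariant tensors on \<open>G\<close> are identified with (multi)linear forms on the Lie algebra
  \<open>V = lie_algebra G A\<close>; only their values on \<open>V\<close> are meaningful. On a left-invariant one-form
  \<open>\<alpha>\<close> the exterior derivative \<open>X(\<alpha>(Y)) - Y(\<alpha>(X)) - \<alpha>([X,Y])\<close> reduces to its
  last term, because \<open>\<alpha>(X)\<close> and \<open>\<alpha>(Y)\<close> are constant functions.\<close>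

type_synonym 'v form1 = "'v \<Rightarrow> real"
type_synonym 'v tensor2 = "'v \<Rightarrow> 'v \<Rightarrow> real"

definition tensor :: "'v form1 \<Rightarrow> 'v form1 \<Rightarrow> 'v tensor2" where
  "tensor \<alpha> \<beta> = (\<lambda>X Y. \<alpha> X * \<beta> Y)"

definition odot :: "'v form1 \<Rightarrow> 'v form1 \<Rightarrow> 'v tensor2" where
  "odot \<alpha> \<beta> = (\<lambda>X Y. tensor \<alpha> \<beta> X Y + tensor \<beta> \<alpha> X Y)"

definition wedge :: "'v form1 \<Rightarrow> 'v form1 \<Rightarrow> 'v tensor2" where
  "wedge \<alpha> \<beta> = (\<lambda>X Y. tensor \<alpha> \<beta> X Y - tensor \<beta> \<alpha> X Y)"

definition ext_d :: "'m vfield form1 \<Rightarrow> 'm vfield tensor2" where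
  "ext_d \<alpha> = (\<lambda>X Y. - \<alpha> (bracket X Y))"

definition linear_form :: "'m vfield set \<Rightarrow> 'm vfield form1 \<Rightarrow> bool" where
  "linear_form V \<alpha> \<longleftrightarrow> (\<forall>X\<in>V. \<forall>Y\<in>V. \<forall>a b.
     \<alpha> (add_field (scale_field a X) (scale_field b Y)) = a * \<alpha> X + b * \<alpha> Y)"

datatype frame_index = Iu | Il | In

instance frame_index :: finite
proof
  have "(UNIV :: frame_index set) = {Iu, Il, In}"
    using frame_index.exhaust by auto
  then show "finite (UNIV :: frame_index set)"
    by (metis finite.emptyI finite.insertI)
qed

type_synonym 'v frame = "frame_index \<Rightarrow> 'v form1"

text \<open>A coframe identifies the tangent space (here the Lie algebra) linearly with three-space.\<close>

definition left_invariant_coframe :: "'m vfield set \<Rightarrow> 'm vfield frame \<Rightarrow> bool" where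
  "left_invariant_coframe V e \<longleftrightarrow> (\<forall>a. linear_form V (e a)) \<and>
     bij_betw (\<lambda>X. (e Iu X, e Il X, e In X)) V UNIV"

definition frame_metric :: "'v frame \<Rightarrow> 'v tensor2" where
  "frame_metric e = (\<lambda>X Y. \<Sum>a\<in>UNIV. tensor (e a) (e a) X Y)"

definition sharp :: "'v set \<Rightarrow> 'v tensor2 \<Rightarrow> 'v form1 \<Rightarrow> 'v" where
  "sharp V h \<alpha> = (THE Z. Z \<in> V \<and> (\<forall>Y\<in>V. h Z Y = \<alpha> Y))"

definition contract :: "'v set \<Rightarrow> 'v tensor2 \<Rightarrow> 'v tensor2 \<Rightarrow> 'v form1 \<Rightarrow> 'v form1" where
  "contract V h \<Theta> \<alpha> = (\<lambda>Y. \<Theta> (sharp V h \<alpha>) Y)"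


section \<open>Left-invariant parallel spinor flows\<close>

text \<open>Smoothness on an interval, with one-sided derivatives at end points that belong to it.\<close>

definition smooth_on_interval :: "real set \<Rightarrow> (real \<Rightarrow> real) \<Rightarrow> bool" where
  "smooth_on_interval I f \<longleftrightarrow> (\<exists>D :: nat \<Rightarrow> real \<Rightarrow> real. (\<forall>t\<in>I. D 0 t = f t) \<and>
     (\<forall>k. \<forall>t\<in>I. (D k has_real_derivative D (Suc k) t) (at t within I)))"

text \<open>The tensor \<open>\<Theta>\<^sub>t = - (\<partial>\<^sub>t h) / (2 \<beta>\<^sub>t)\<close> of a family of coframes.\<close>

definition Theta ::
  "real set \<Rightarrow> (real \<Rightarrow> real) \<Rightarrow> (real \<Rightarrow> 'v frame) \<Rightarrow> real \<Rightarrow> 'v tensor2" where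
  "Theta I \<beta> e t = (\<lambda>X Y.
     - (1 / (2 * \<beta> t)) * vector_derivative (\<lambda>s. frame_metric (e s) X Y) (at t within I))"

definition parallel_spinor_flow ::
  "'g::topological_space monoid \<Rightarrow> ('g, 'e::euclidean_space) chart set \<Rightarrow>
   real set \<Rightarrow> (real \<Rightarrow> real) \<Rightarrow> (real \<Rightarrow> 'g vfield frame) \<Rightarrow> bool" where
  "parallel_spinor_flow G A I \<beta> e \<longleftrightarrow>
   (let V = lie_algebra G A;
        \<Theta> = (\<lambda>t a. contract V (frame_metric (e t)) (Theta I \<beta> e t) (e t a))
    in is_interval I \<and> 0 \<in> I \<and> I \<noteq> {0} \<and>
       smooth_on_interval I \<beta> \<and> (\<forall>t\<in>I. 0 < \<beta> t) \<and>
       (\<forall>t\<in>I. left_invariant_coframe V (e t)) \<and>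
       (\<forall>a. \<forall>X\<in>V. smooth_on_interval I (\<lambda>t. e t a X)) \<and>
       (\<forall>t\<in>I. \<forall>a. \<forall>X\<in>V.
          vector_derivative (\<lambda>s. e s a X) (at t within I) + \<beta> t * \<Theta> t a X = 0) \<and>
       (\<forall>t\<in>I. \<forall>a. \<forall>X\<in>V. \<forall>Y\<in>V.
          ext_d (e t a) X Y = wedge (\<Theta> t a) (e t Iu) X Y) \<and>
       (\<forall>t\<in>I. \<forall>X\<in>V. ((\<lambda>s. \<Theta> s Iu X) has_real_derivative 0) (at t within I)) \<and>
       (\<forall>t\<in>I. \<forall>X\<in>V. \<forall>Y\<in>V. ext_d (\<Theta> t Iu) X Y = 0))"

text \<open>The flow \<open>(\<beta>, e)\<close> on \<open>I\<close> extends to a flow on all of \<open>\<real>\<close> with lapse \<open>b\<close>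
  (used for \<open>b\<close> extending \<open>\<beta>\<close>). When \<open>\<Theta>\<^sub>u\<^sub>l = \<Theta>\<^sub>u\<^sub>n = 0\<close> one has
  \<open>e\<^sub>u\<^sup>t = (1 - \<Theta>\<^sub>u\<^sub>u \<B>\<^sub>t) e\<^sub>u\<close>, which can only degenerate in the time direction where
  \<open>\<Theta>\<^sub>u\<^sub>u t > 0\<close> and never does if \<open>1 / \<bar>\<Theta>\<^sub>u\<^sub>u\<bar>\<close> is only the limit of \<open>\<bar>\<B>\<^sub>t\<bar>\<close>; hence the
  half line and the non-strict inequality in the criterion for that case.\<close>

definition globally_defined ::
  "'g::topological_space monoid \<Rightarrow> ('g, 'e::euclidean_space) chart set \<Rightarrow>
   real set \<Rightarrow> (real \<Rightarrow> 'g vfield frame) \<Rightarrow> (real \<Rightarrow> real) \<Rightarrow> bool" where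
  "globally_defined G A I e b \<longleftrightarrow>
     (\<exists>e'. parallel_spinor_flow G A UNIV b e' \<and>
        (\<forall>t\<in>I. \<forall>a. \<forall>X\<in>lie_algebra G A. e' t a X = e t a X))"

text \<open>The interval integral is oriented, so \<open>t\<close> may be negative.\<close>

definition lapse_integral :: "(real \<Rightarrow> real) \<Rightarrow> real \<Rightarrow> real" where
  "lapse_integral \<beta> t = (LBINT \<tau>=0..t. \<beta> \<tau>)"

definition y_angle :: "real \<Rightarrow> real \<Rightarrow> (real \<Rightarrow> real) \<Rightarrow> real \<Rightarrow> real" where
  "y_angle lam \<Theta>uu \<beta> t = lam * lapse_integral \<beta> t + arctan (\<Theta>uu / lam)"

definition sec :: "real \<Rightarrow> real" where
  "sec y = 1 / cos y"


section \<open>The metrics of the three cases\<close>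

definition diag2 :: "real \<Rightarrow> real \<Rightarrow> real^2^2" where
  "diag2 a b = vector [vector [a, 0], vector [0, b]]"

definition rho_plus :: "real^2^2 \<Rightarrow> real \<Rightarrow> real" where
  "rho_plus \<theta> x = (trace \<theta> + sqrt ((trace \<theta>)^2 - 4 * det \<theta>)) / (2 * x)"

definition rho_minus :: "real^2^2 \<Rightarrow> real \<Rightarrow> real" where
  "rho_minus \<theta> x = (trace \<theta> - sqrt ((trace \<theta>)^2 - 4 * det \<theta>)) / (2 * x)"

text \<open>\<open>\<theta> / x = Q diag(\<rho>\<^sub>+, \<rho>\<^sub>-) Q\<^sup>*\<close>, with \<open>x\<close> in the role of \<open>\<Theta>\<^sub>u\<^sub>u\<close>.\<close>

definition diagonalizes :: "real^2^2 \<Rightarrow> real^2^2 \<Rightarrow> real \<Rightarrow> bool" where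
  "diagonalizes Q \<theta> x \<longleftrightarrow> orthogonal_matrix Q \<and>
     (1 / x) *\<^sub>R \<theta> = Q ** diag2 (rho_plus \<theta> x) (rho_minus \<theta> x) ** transpose Q"

text \<open>Here \<open>x\<close> is \<open>\<Theta>\<^sub>u\<^sub>u\<close> and \<open>B\<close> is \<open>\<B>\<^sub>t\<close>; the real power is applied only to a positive base.\<close>

definition metric1 ::
  "'v frame \<Rightarrow> real^2^2 \<Rightarrow> real^2^2 \<Rightarrow> real \<Rightarrow> real \<Rightarrow> 'v tensor2" where
  "metric1 e \<theta> Q x B = (\<lambda>X Y.
     (1 - x * B)^2 * tensor (e Iu) (e Iu) X Y +
     (vector [e Il X, e In X] :: real^2) \<bullet>
       ((Q ** diag2 ((1 - x * B) powr (2 * rho_plus \<theta> x)) ((1 - x * B) powr (2 * rho_minus \<theta> x))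
         ** transpose Q) *v vector [e Il Y, e In Y]))"

text \<open>The arguments \<open>l\<close> and \<open>n\<close> are the indices in these two roles, and \<open>\<Theta>un\<close> is the component
  \<open>\<Theta>\<^sub>u\<^sub>n\<close> for the index \<open>n\<close>; the second subcase exchanges the two indices.\<close>

definition metric2 ::
  "'v frame \<Rightarrow> frame_index \<Rightarrow> frame_index \<Rightarrow> real \<Rightarrow> real \<Rightarrow> real \<Rightarrow> real \<Rightarrow> real \<Rightarrow> 'v tensor2" where
  "metric2 e l n \<Theta>uu \<Theta>un lam B y = (\<lambda>X Y.
     ((1 - \<Theta>uu * B)^2 * (sec y)^2 + \<Theta>uu^2 / lam^2
        - 2 * \<Theta>uu / lam * (1 - \<Theta>uu * B) * tan y) * tensor (e Iu) (e Iu) X Y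
     + (\<Theta>uu / \<Theta>un - \<Theta>un * B * (sec y)^2 * (1 - \<Theta>uu * B)
        - lam / \<Theta>un * tan y * (1 - 2 * \<Theta>uu * B)) * odot (e Iu) (e n) X Y
     + tensor (e l) (e l) X Y
     + (1 + lam^2 * B^2 * (sec y)^2 + 2 * lam * B * tan y) * tensor (e n) (e n) X Y)"

definition metric3 ::
  "'v frame \<Rightarrow> real \<Rightarrow> real \<Rightarrow> real \<Rightarrow> real \<Rightarrow> real \<Rightarrow> real \<Rightarrow> 'v tensor2" where
  "metric3 e T \<Theta>ul \<Theta>un lam B y = (\<lambda>X Y.
     ((1 + T * B)^2 + (tan y * (1 + T * B) + T / lam)^2) * tensor (e Iu) (e Iu) X Y
     - (T / lam^2 + tan y / lam * (1 + 2 * T * B) + B * (1 + T * B) * (sec y)^2)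
       * (\<Theta>ul * odot (e Iu) (e Il) X Y + \<Theta>un * odot (e Iu) (e In) X Y)
     + (1 + \<Theta>ul^2 * B * (B * (sec y)^2 + 2 * tan y / lam)) * tensor (e Il) (e Il) X Y
     + \<Theta>ul * \<Theta>un * B * (sec y)^2 * (B + sin (2 * y) / lam) * odot (e Il) (e In) X Y
     + (1 + \<Theta>un^2 * B * (B * (sec y)^2 + 2 * tan y / lam)) * tensor (e In) (e In) X Y)"

end

theory Submission
  imports Defs
begin

text \<open>Write the tensor \<open>\<Theta>\<^sub>t\<close> in the frame \<open>e\<^sup>t\<close> as a symmetric matrix \<open>S\<^sub>t\<close> (predicate
  \<open>shape_flow\<close>). The equations of the flow become three kinds of conditions on real functions:
  the evolution \<open>e' = -\<beta> S e\<close>; the structure equations, which say how the fixed Lie bracket is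
  expressed through \<open>S\<^sub>t\<close> and \<open>e\<^sup>t\<close> at every time; and the constancy in time of the one-form
  \<open>\<Theta>\<^sub>t(e\<^sub>u)\<close>. The last one makes \<open>e\<^sub>u\<close> affine in the primitive \<open>B\<close> of \<open>\<beta>\<close>. As the bracket does not
  depend on time, comparing the structure equations at time \<open>t\<close> with those at time \<open>0\<close> determines
  \<open>S\<^sub>t e\<^sup>t\<close> from \<open>e\<^sup>t\<close>, and the evolution becomes an explicitly solvable ordinary differential
  equation.

  Rotating the legs \<open>l\<close> and \<open>n\<close> by a constant orthogonal matrix changes neither the metric nor the
  equations (\<open>shape_flow_rotate\<close>), so two normal forms suffice. Put \<open>\<kappa> = \<Theta>\<^sub>u\<^sub>u\<close>.

  \<^item> Untilted, \<open>\<Theta>\<^sub>u\<^sub>l = \<Theta>\<^sub>u\<^sub>n = 0\<close>: rotate by an eigenbasis of \<open>\<theta>\<close>. Then \<open>e\<^sub>u\<close> is multiplied by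
    \<open>1 - \<kappa> B\<close>, which stays positive on the interval by connectedness, and each eigenleg solves the
    scalar equation \<open>x' = - \<beta> m x / (1 - \<kappa> B)\<close> (\<open>diagonal_flow_explicit\<close>).

  \<^item> Tilted: rotate so that \<open>\<Theta>\<^sub>u\<^sub>l = 0\<close> and \<open>\<Theta>\<^sub>u\<^sub>n = \<lambda>\<close>. The Jacobi identity and the closedness of
    \<open>\<Theta>(e\<^sub>u)\<close> leave \<open>\<kappa>\<close> and \<open>\<lambda>\<close> as the only free entries. The leg \<open>l\<close> is constant, the
    determinant of the \<open>(u, n)\<close> block is \<open>1\<close>, and the entry \<open>S\<^sub>n\<^sub>n\<close> solves the Riccati equation
    \<open>z' = - \<beta> (\<lambda>\<^sup>2 + z\<^sup>2)\<close>, so that \<open>z = - \<lambda> tan y\<close> and \<open>\<bar>y\<bar> < \<pi>/2\<close> on the interval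
    (\<open>tilted_flow_explicit\<close>).

  The group is read off the structure equations at time \<open>0\<close> by exhibiting a coframe whose dual
  basis has the listed brackets. For global existence, an extension to the whole line has the same
  initial matrix \<open>S\<^sub>0\<close> and is therefore subject to the same positivity or angle bound at all times;
  conversely the explicit formulas define a flow wherever the bound holds (\<open>diagonal_shape_flow\<close>,
  \<open>tilted_shape_flow\<close>), and they agree with the given flow on its interval.\<close>


section \<open>Smooth functions and left-invariant vector fields\<close>

lemma Ck_on_differentiable:
  assumes "open S" "Ck_on (Suc k) S f" "x \<in> S"
  shows "(f has_derivative frechet_derivative f (at x)) (at x)"
proof -
  have "f differentiable_on S" using assms(2) by simp
  then have "f differentiable (at x)"
    using differentiable_on_eq_differentiable_at[OF \<open>open S\<close>] assms(3) by blast
  then show ?thesis using frechet_derivative_works by blast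
qed

text \<open>On an open set, derivatives only see the values on that set. This replaces the Frechet derivative
  of a sum or product by the expression that the rules of calculus give for it.\<close>

lemma Ck_on_cong:
  assumes "open S" "\<And>x. x \<in> S \<Longrightarrow> f x = g x" "Ck_on k S f"
  shows "Ck_on k S g"
  using assms(2,3)
proof (induction k arbitrary: f g)
  case 0
  then show ?case by (simp cong: continuous_on_cong)
next
  case (Suc k)
  have der: "(g has_derivative frechet_derivative f (at x)) (at x)" if "x \<in> S" for x
  proof -
    have "(f has_derivative frechet_derivative f (at x)) (at x)"
      by (rule Ck_on_differentiable[OF \<open>open S\<close> Suc.prems(2) that])
    then show ?thesis
      by (rule has_derivative_transform_within_open[OF _ \<open>open S\<close> that]) (use Suc.prems(1) in auto)
  qed
  have eq: "frechet_derivative g (at x) = frechet_derivative f (at x)" if "x \<in> S" for x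
    using frechet_derivative_at[OF der[OF that]] by simp
  have "g differentiable_on S"
    using der by (auto simp: differentiable_on_def differentiable_def intro: has_derivative_at_withinI)
  moreover have "Ck_on k S (\<lambda>x. frechet_derivative g (at x) v)" for v
    by (rule Suc.IH[of "\<lambda>x. frechet_derivative f (at x) v"]) (use Suc.prems eq in auto)
  ultimately show ?case by simp
qed

lemma Ck_on_Suc_D: "Ck_on (Suc k) S f \<Longrightarrow> Ck_on k S f"
proof (induction k arbitrary: f)
  case 0
  then show ?case by (auto intro: differentiable_imp_continuous_on)
next
  case (Suc k)
  then show ?case by (metis Ck_on.simps(2))
qed

lemma Ck_on_linear_combination:
  fixes f g :: "'a::euclidean_space \<Rightarrow> real"
  assumes "open S" "Ck_on k S f" "Ck_on k S g"
  shows "Ck_on k S (\<lambda>x. a * f x + b * g x)"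
  using assms(2,3)
proof (induction k arbitrary: f g)
  case 0
  then show ?case by (auto intro!: continuous_intros)
next
  case (Suc k)
  have der: "((\<lambda>x. a * f x + b * g x) has_derivative
      (\<lambda>v. a * frechet_derivative f (at x) v + b * frechet_derivative g (at x) v)) (at x)"
    if "x \<in> S" for x
    using Ck_on_differentiable[OF \<open>open S\<close> Suc.prems(1) that]
      Ck_on_differentiable[OF \<open>open S\<close> Suc.prems(2) that]
    by (intro derivative_intros) auto
  have "(\<lambda>x. a * f x + b * g x) differentiable_on S"
    using der by (auto simp: differentiable_on_def differentiable_def intro: has_derivative_at_withinI)
  moreover have "Ck_on k S (\<lambda>x. frechet_derivative (\<lambda>x. a * f x + b * g x) (at x) v)" for v
    by (rule Ck_on_cong[OF \<open>open S\<close> _ Suc.IH[of "\<lambda>x. frechet_derivative f (at x) v"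
            "\<lambda>x. frechet_derivative g (at x) v"]])
      (use Suc.prems frechet_derivative_at[OF der] in \<open>auto dest: fun_cong\<close>)
  ultimately show ?case by simp
qed

lemma Ck_on_mult:
  fixes f g :: "'a::euclidean_space \<Rightarrow> real"
  assumes "open S" "Ck_on k S f" "Ck_on k S g"
  shows "Ck_on k S (\<lambda>x. f x * g x)"
  using assms(2,3)
proof (induction k arbitrary: f g)
  case 0
  then show ?case by (auto intro!: continuous_intros)
next
  case (Suc k)
  have der: "((\<lambda>x. f x * g x) has_derivative
      (\<lambda>v. 1 * (f x * frechet_derivative g (at x) v) + 1 * (frechet_derivative f (at x) v * g x))) (at x)"
    if "x \<in> S" for x
    using has_derivative_mult[OF Ck_on_differentiable[OF \<open>open S\<close> Suc.prems(1) that]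
      Ck_on_differentiable[OF \<open>open S\<close> Suc.prems(2) that]] by simp
  have "(\<lambda>x. f x * g x) differentiable_on S"
    using der by (auto simp: differentiable_on_def differentiable_def intro: has_derivative_at_withinI)
  moreover have "Ck_on k S (\<lambda>x. frechet_derivative (\<lambda>x. f x * g x) (at x) v)" for v
  proof -
    have "Ck_on k S (\<lambda>x. f x * frechet_derivative g (at x) v)"
      "Ck_on k S (\<lambda>x. frechet_derivative f (at x) v * g x)"
      using Suc.prems Ck_on_Suc_D[OF Suc.prems(1)] Ck_on_Suc_D[OF Suc.prems(2)]
      by (auto intro: Suc.IH)
    then have "Ck_on k S (\<lambda>x. 1 * (f x * frechet_derivative g (at x) v)
        + 1 * (frechet_derivative f (at x) v * g x))"
      by (rule Ck_on_linear_combination[OF \<open>open S\<close>])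
    then show ?thesis
      by (rule Ck_on_cong[OF \<open>open S\<close>, rotated])
        (use frechet_derivative_at[OF der] in \<open>auto dest: fun_cong\<close>)
  qed
  ultimately show ?case by simp
qed

lemma smooth_functions_linear_combination:
  assumes "smooth_atlas A" "f \<in> smooth_functions A" "g \<in> smooth_functions A"
  shows "(\<lambda>p. a * f p + b * g p) \<in> smooth_functions A"
proof -
  have "Ck_on k (\<phi> ` U) (\<lambda>x. h (inv_into U \<phi> x))" if "(U, \<phi>) \<in> A" "h \<in> smooth_functions A" for U \<phi> h k
    using that by (auto simp: smooth_functions_def smooth_on_def o_def)
  moreover have "open (\<phi> ` U)" if "(U, \<phi>) \<in> A" for U \<phi>
    using assms(1) that by (auto simp: smooth_atlas_def chart_def)
  ultimately show ?thesis
    using assms(2,3) by (auto simp: smooth_functions_def smooth_on_def o_def intro!: Ck_on_linear_combination)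
qed

lemma smooth_functions_mult:
  assumes "smooth_atlas A" "f \<in> smooth_functions A" "g \<in> smooth_functions A"
  shows "(\<lambda>p. f p * g p) \<in> smooth_functions A"
proof -
  have "Ck_on k (\<phi> ` U) (\<lambda>x. h (inv_into U \<phi> x))" if "(U, \<phi>) \<in> A" "h \<in> smooth_functions A" for U \<phi> h k
    using that by (auto simp: smooth_functions_def smooth_on_def o_def)
  moreover have "open (\<phi> ` U)" if "(U, \<phi>) \<in> A" for U \<phi>
    using assms(1) that by (auto simp: smooth_atlas_def chart_def)
  ultimately show ?thesis
    using assms(2,3) by (auto simp: smooth_functions_def smooth_on_def o_def intro!: Ck_on_mult)
qed

lemma vector_fieldsD:
  assumes "X \<in> vector_fields A"
  shows "f \<in> smooth_functions A \<Longrightarrow> X f \<in> smooth_functions A"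
    and "f \<in> smooth_functions A \<Longrightarrow> g \<in> smooth_functions A \<Longrightarrow>
      X (\<lambda>p. a * f p + b * g p) = (\<lambda>p. a * X f p + b * X g p)"
    and "f \<in> smooth_functions A \<Longrightarrow> g \<in> smooth_functions A \<Longrightarrow>
      X (\<lambda>p. f p * g p) = (\<lambda>p. X f p * g p + f p * X g p)"
    and "f \<notin> smooth_functions A \<Longrightarrow> X f = (\<lambda>p. 0)"
  using assms unfolding vector_fields_def by blast+

lemma vector_field_zero:
  assumes "smooth_atlas A" "X \<in> vector_fields A"
  shows "X (\<lambda>p. 0) = (\<lambda>p. 0)"
proof (cases "(\<lambda>p. 0) \<in> smooth_functions A")
  case True
  then show ?thesis using vector_fieldsD(2)[OF assms(2) True True, of 0 0] by simp
next
  case False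
  then show ?thesis using vector_fieldsD(4)[OF assms(2)] by blast
qed

lemma vector_field_diff:
  assumes "X \<in> vector_fields A" "f \<in> smooth_functions A" "g \<in> smooth_functions A"
  shows "X (\<lambda>p. f p - g p) = (\<lambda>p. X f p - X g p)"
  using vector_fieldsD(2)[OF assms, of 1 "-1"] by simp

lemma smooth_functions_diff:
  assumes "smooth_atlas A" "f \<in> smooth_functions A" "g \<in> smooth_functions A"
  shows "(\<lambda>p. f p - g p) \<in> smooth_functions A"
  using smooth_functions_linear_combination[OF assms, of 1 "-1"] by simp

lemma lie_algebra_linear_combination:
  assumes A: "smooth_atlas A" and X: "X \<in> lie_algebra G A" and Y: "Y \<in> lie_algebra G A"
  shows "add_field (scale_field a X) (scale_field b Y) \<in> lie_algebra G A"
proof -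
  have XV: "X \<in> vector_fields A" and YV: "Y \<in> vector_fields A"
    using X Y by (auto simp: lie_algebra_def)
  note x = vector_fieldsD[OF XV] and y = vector_fieldsD[OF YV]
  have "add_field (scale_field a X) (scale_field b Y) \<in> vector_fields A"
    unfolding vector_fields_def add_field_def scale_field_def
    using smooth_functions_linear_combination[OF A] x y
    by (auto simp: algebra_simps)
  then show ?thesis
    using X Y by (auto simp: lie_algebra_def add_field_def scale_field_def)
qed

text \<open>The mixed second-order terms of the two compositions cancel, so the commutator of derivations is a
  derivation. Products of smooth functions enter because one derivation is applied to the Leibniz
  expansion of the other.\<close>

lemma lie_algebra_bracket:
  assumes A: "smooth_atlas A" and X: "X \<in> lie_algebra G A" and Y: "Y \<in> lie_algebra G A"
  shows "bracket X Y \<in> lie_algebra G A"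
proof -
  have XV: "X \<in> vector_fields A" and YV: "Y \<in> vector_fields A"
    using X Y by (auto simp: lie_algebra_def)
  note x = vector_fieldsD[OF XV] and y = vector_fieldsD[OF YV]
  note zero = vector_field_zero[OF A XV] vector_field_zero[OF A YV]
  have prod: "U (\<lambda>p. f p * g p + h p * k p) = (\<lambda>p. U f p * g p + f p * U g p + (U h p * k p + h p * U k p))"
    if "U \<in> vector_fields A" "f \<in> smooth_functions A" "g \<in> smooth_functions A"
      "h \<in> smooth_functions A" "k \<in> smooth_functions A" for U f g h k
    using vector_fieldsD(2)[OF that(1) smooth_functions_mult[OF A that(2,3)]
        smooth_functions_mult[OF A that(4,5)], of 1 1]
      vector_fieldsD(3)[OF that(1)] that by simp
  have "bracket X Y \<in> vector_fields A"
    unfolding vector_fields_def bracket_def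
  proof (intro CollectI conjI ballI allI impI)
    fix f assume f: "f \<in> smooth_functions A"
    show "(\<lambda>p. X (Y f) p - Y (X f) p) \<in> smooth_functions A"
      using smooth_functions_diff[OF A] x(1) y(1) f by blast
    fix g assume g: "g \<in> smooth_functions A"
    show "(\<lambda>p. X (Y (\<lambda>p. f p * g p)) p - Y (X (\<lambda>p. f p * g p)) p) =
       (\<lambda>p. (X (Y f) p - Y (X f) p) * g p + f p * (X (Y g) p - Y (X g) p))"
      using f g x(1) y(1) by (auto simp: x(3) y(3) prod XV YV algebra_simps)
    fix a b
    show "(\<lambda>p. X (Y (\<lambda>p. a * f p + b * g p)) p - Y (X (\<lambda>p. a * f p + b * g p)) p) =
       (\<lambda>p. a * (X (Y f) p - Y (X f) p) + b * (X (Y g) p - Y (X g) p))"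
      using f g x(1,2) y(1,2) by (simp add: algebra_simps)
  next
    fix f assume f: "f \<notin> smooth_functions A"
    show "(\<lambda>p. X (Y f) p - Y (X f) p) = (\<lambda>p. 0)"
      using x(4)[OF f] y(4)[OF f] zero by simp
  qed
  moreover have "bracket X Y (\<lambda>q. f (g \<otimes>\<^bsub>G\<^esub> q)) p = bracket X Y f (g \<otimes>\<^bsub>G\<^esub> p)"
    if f: "f \<in> smooth_functions A" for f g p
  proof -
    have "U (W (\<lambda>q. f (g \<otimes>\<^bsub>G\<^esub> q))) p = U (W f) (g \<otimes>\<^bsub>G\<^esub> p)"
      if "U \<in> lie_algebra G A" "W \<in> lie_algebra G A" for U W
    proof -
      have "W (\<lambda>q. f (g \<otimes>\<^bsub>G\<^esub> q)) = (\<lambda>q. W f (g \<otimes>\<^bsub>G\<^esub> q))"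
        using that(2) f by (auto simp: lie_algebra_def)
      moreover have "W f \<in> smooth_functions A"
        using that(2) f vector_fieldsD(1) by (auto simp: lie_algebra_def)
      ultimately show ?thesis using that(1) by (auto simp: lie_algebra_def)
    qed
    from this[OF X Y] this[OF Y X] show ?thesis by (simp only: bracket_def)
  qed
  ultimately show ?thesis by (simp add: lie_algebra_def)
qed

text \<open>The brackets are commutators of operators. Linearity is available on smooth arguments only, and on
  the remaining arguments all three terms vanish by convention.\<close>

lemma bracket_jacobi:
  assumes A: "smooth_atlas A" and X: "X \<in> vector_fields A" and Y: "Y \<in> vector_fields A"
    and Z: "Z \<in> vector_fields A"
  shows "add_field (bracket X (bracket Y Z))
    (add_field (bracket Y (bracket Z X)) (bracket Z (bracket X Y))) = zero_field"
proof (intro ext)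
  fix f p
  show "add_field (bracket X (bracket Y Z))
    (add_field (bracket Y (bracket Z X)) (bracket Z (bracket X Y))) f p = zero_field f p"
  proof (cases "f \<in> smooth_functions A")
    case True
    then show ?thesis
      using X Y Z by (simp add: add_field_def zero_field_def bracket_def vector_field_diff[where A=A]
          vector_fieldsD(1)[where A=A])
  next
    case False
    then show ?thesis
      using X Y Z by (simp add: add_field_def zero_field_def bracket_def
          vector_field_zero[OF A] vector_fieldsD(4)[where A=A])
  qed
qed

section \<open>Coframes and their dual bases\<close>

lemma sum_frame_index: "(\<Sum>a\<in>UNIV. f a) = f Iu + f Il + f In"
proof -
  have UNIV_eq: "(UNIV :: frame_index set) = {Iu, Il, In}"
    using frame_index.exhaust by auto
  show ?thesis unfolding UNIV_eq by (simp add: add.assoc)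
qed

text \<open>The properties of the Lie algebra of \<open>G\<close> on which the analysis of flows rests. The values of a bracket
  are supplied by the structure equations of a coframe.\<close>

locale vfield_lie_algebra =
  fixes V :: "'m vfield set"
  assumes linear_combination:
      "X \<in> V \<Longrightarrow> Y \<in> V \<Longrightarrow> add_field (scale_field a X) (scale_field b Y) \<in> V"
    and bracket_closed: "X \<in> V \<Longrightarrow> Y \<in> V \<Longrightarrow> bracket X Y \<in> V"
    and jacobi: "X \<in> V \<Longrightarrow> Y \<in> V \<Longrightarrow> Z \<in> V \<Longrightarrow>
      add_field (bracket X (bracket Y Z))
        (add_field (bracket Y (bracket Z X)) (bracket Z (bracket X Y))) = zero_field"

lemma lie_group_vfield_lie_algebra:
  assumes "lie_group G A"
  shows "vfield_lie_algebra (lie_algebra G A)"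
proof -
  have A: "smooth_atlas A" using assms by (simp add: lie_group_def)
  show ?thesis
  proof
    fix X Y Z assume "X \<in> lie_algebra G A" "Y \<in> lie_algebra G A" "Z \<in> lie_algebra G A"
    then show "add_field (bracket X (bracket Y Z))
        (add_field (bracket Y (bracket Z X)) (bracket Z (bracket X Y))) = zero_field"
      by (intro bracket_jacobi[OF A]) (auto simp: lie_algebra_def)
  qed (use lie_algebra_linear_combination[OF A] lie_algebra_bracket[OF A] in blast)+
qed

abbreviation combination3 ::
  "real \<Rightarrow> real \<Rightarrow> real \<Rightarrow> 'm vfield \<Rightarrow> 'm vfield \<Rightarrow> 'm vfield \<Rightarrow> 'm vfield" where
  "combination3 a b c X Y Z \<equiv>
     add_field (scale_field a X) (add_field (scale_field b Y) (scale_field c Z))"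

lemma scale_field_one [simp]: "scale_field 1 X = X"
  by (simp add: scale_field_def)

context vfield_lie_algebra
begin

lemma scale_closed: "X \<in> V \<Longrightarrow> scale_field a X \<in> V"
  using linear_combination[of X X a 0] by (simp add: add_field_def scale_field_def)

lemma add_closed: "X \<in> V \<Longrightarrow> Y \<in> V \<Longrightarrow> add_field X Y \<in> V"
  using linear_combination[of X Y 1 1] by simp

lemma zero_closed: "X \<in> V \<Longrightarrow> zero_field \<in> V"
  using scale_closed[of X 0] by (simp add: scale_field_def zero_field_def)

lemma linear_form_add:
  assumes "linear_form V \<alpha>" "X \<in> V" "Y \<in> V"
  shows "\<alpha> (add_field X Y) = \<alpha> X + \<alpha> Y"
  using assms unfolding linear_form_def by (metis mult_1 scale_field_one)

lemma linear_form_scale: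
  assumes "linear_form V \<alpha>" "X \<in> V"
  shows "\<alpha> (scale_field a X) = a * \<alpha> X"
proof -
  have "\<alpha> (add_field (scale_field a X) (scale_field 0 X)) = a * \<alpha> X + 0 * \<alpha> X"
    using assms unfolding linear_form_def by blast
  then show ?thesis by (simp add: add_field_def scale_field_def)
qed

lemma linear_form_zero:
  assumes "linear_form V \<alpha>" "X \<in> V"
  shows "\<alpha> zero_field = 0"
  using linear_form_scale[OF assms, of 0] by (simp add: scale_field_def zero_field_def)

lemma coframe_linear: "left_invariant_coframe V e \<Longrightarrow> linear_form V (e a)"
  by (simp add: left_invariant_coframe_def)

lemma coframe_eqI:
  assumes "left_invariant_coframe V e" "X \<in> V" "Y \<in> V" "\<And>a. e a X = e a Y"
  shows "X = Y"
proof -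
  have "inj_on (\<lambda>X. (e Iu X, e Il X, e In X)) V"
    using assms(1) by (simp add: left_invariant_coframe_def bij_betw_def)
  then show ?thesis by (rule inj_onD) (use assms in auto)
qed

text \<open>Surjectivity of the coordinate map provides the vectors dual to the coframe.\<close>

lemma coframe_dual_basis:
  assumes "left_invariant_coframe V e"
  obtains E where "\<And>a. E a \<in> V" "\<And>a b. e b (E a) = (if a = b then 1 else 0)"
proof -
  have "\<exists>X\<in>V. \<forall>b. e b X = (if a = b then 1 else 0)" for a
  proof -
    let ?v = "(if a = Iu then 1 else 0, if a = Il then 1 else 0, if a = In then 1 else 0) :: real \<times> real \<times> real"
    have "?v \<in> (\<lambda>X. (e Iu X, e Il X, e In X)) ` V"
      using assms by (simp add: left_invariant_coframe_def bij_betw_def)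
    then obtain X where X: "X \<in> V" and eq: "(e Iu X, e Il X, e In X) = ?v" by force
    have "e b X = (if a = b then 1 else 0)" for b using eq by (cases b) auto
    with X show ?thesis by blast
  qed
  then have "\<exists>E. \<forall>a. E a \<in> V \<and> (\<forall>b. e b (E a) = (if a = b then 1 else 0))" by metis
  then show thesis using that by blast
qed

lemma coframe_expansion:
  assumes e: "left_invariant_coframe V e" and E: "\<And>a. E a \<in> V"
    "\<And>a b. e b (E a) = (if a = b then 1 else 0)"
    and \<alpha>: "linear_form V \<alpha>" and X: "X \<in> V"
  shows "\<alpha> X = (\<Sum>a\<in>UNIV. e a X * \<alpha> (E a))"
proof -
  let ?Y = "combination3 (e Iu X) (e Il X) (e In X) (E Iu) (E Il) (E In)"
  have comb: "\<gamma> ?Y = e Iu X * \<gamma> (E Iu) + (e Il X * \<gamma> (E Il) + e In X * \<gamma> (E In))"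
    if "linear_form V \<gamma>" for \<gamma>
    using that E(1) by (simp add: linear_form_add linear_form_scale add_closed scale_closed)
  have "X = ?Y"
  proof (rule coframe_eqI[OF e X])
    show "?Y \<in> V" using E(1) by (simp add: add_closed scale_closed)
    show "e a X = e a ?Y" for a
      using comb[OF coframe_linear[OF e, of a]] by (cases a) (simp_all add: E(2))
  qed
  then have "\<alpha> X = \<alpha> ?Y" by simp
  with comb[OF \<alpha>] show ?thesis by (simp add: sum_frame_index)
qed

text \<open>The coframe is orthonormal for its own metric, so musical duality sends it to the dual basis.\<close>

lemma sharp_coframe:
  assumes e: "left_invariant_coframe V e" and E: "\<And>a. E a \<in> V"
    "\<And>a b. e b (E a) = (if a = b then 1 else 0)"
  shows "sharp V (frame_metric e) (e a) = E a"
  unfolding sharp_def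
proof (rule the_equality)
  have metric: "frame_metric e (E b) Y = e b Y" "frame_metric e Y (E b) = e b Y" for b Y
    by (cases b; simp add: frame_metric_def tensor_def sum_frame_index E(2))+
  show "E a \<in> V \<and> (\<forall>Y\<in>V. frame_metric e (E a) Y = e a Y)"
    using E(1) metric by simp
  fix Z assume Z: "Z \<in> V \<and> (\<forall>Y\<in>V. frame_metric e Z Y = e a Y)"
  show "Z = E a"
  proof (rule coframe_eqI[OF e])
    show "e b Z = e b (E a)" for b
    proof -
      have "e b Z = frame_metric e Z (E b)" by (rule metric(2)[symmetric])
      also have "\<dots> = e a (E b)" using Z E(1) by blast
      finally show ?thesis by (auto simp: E(2))
    qed
  qed (use Z E in auto)
qed

text \<open>An invertible change of basis with constant coefficients; \<open>Q\<close> is the inverse matrix of \<open>P\<close>.\<close>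

lemma coframe_transform:
  assumes e: "left_invariant_coframe V e"
    and e': "\<And>a X. X \<in> V \<Longrightarrow> e' a X = (\<Sum>b\<in>UNIV. P a b * e b X)"
    and QP: "\<And>a c. (\<Sum>b\<in>UNIV. Q a b * P b c) = (if a = c then 1 else 0)"
    and PQ: "\<And>a c. (\<Sum>b\<in>UNIV. P a b * Q b c) = (if a = c then 1 else 0)"
  shows "left_invariant_coframe V e'"
  unfolding left_invariant_coframe_def
proof (intro conjI allI)
  fix a
  show "linear_form V (e' a)"
    unfolding linear_form_def
  proof (intro ballI allI)
    fix X Y c d assume XY: "X \<in> V" "Y \<in> V"
    have "e b (add_field (scale_field c X) (scale_field d Y)) = c * e b X + d * e b Y" for b
      using e XY by (simp add: left_invariant_coframe_def linear_form_def)
    then show "e' a (add_field (scale_field c X) (scale_field d Y)) = c * e' a X + d * e' a Y"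
      using XY by (simp add: e' linear_combination sum_frame_index algebra_simps)
  qed
next
  let ?m = "\<lambda>(P :: frame_index \<Rightarrow> frame_index \<Rightarrow> real) (x :: real \<times> real \<times> real).
    (P Iu Iu * fst x + P Iu Il * fst (snd x) + P Iu In * snd (snd x),
     P Il Iu * fst x + P Il Il * fst (snd x) + P Il In * snd (snd x),
     P In Iu * fst x + P In Il * fst (snd x) + P In In * snd (snd x))"
  have inv: "?m Q (?m P x) = x"
    if "\<And>a c. (\<Sum>b\<in>UNIV. Q a b * P b c) = (if a = c then 1 else 0)" for P Q x
  proof -
    have "Q a Iu * (P Iu Iu * x1 + P Iu Il * x2 + P Iu In * x3) + Q a Il * (P Il Iu * x1 + P Il Il * x2 + P Il In * x3)
      + Q a In * (P In Iu * x1 + P In Il * x2 + P In In * x3)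
      = (\<Sum>b\<in>UNIV. Q a b * P b Iu) * x1 + (\<Sum>b\<in>UNIV. Q a b * P b Il) * x2 + (\<Sum>b\<in>UNIV. Q a b * P b In) * x3" for a x1 x2 x3
      by (simp add: sum_frame_index algebra_simps)
    then show ?thesis by (cases x) (simp add: that)
  qed
  have "bij (?m P)"
    by (rule o_bij[of "?m Q"]) (use inv[OF QP] inv[OF PQ] in \<open>auto simp: fun_eq_iff simp del: split_paired_All\<close>)
  moreover have "bij_betw (\<lambda>X. (e Iu X, e Il X, e In X)) V UNIV"
    using e by (simp add: left_invariant_coframe_def)
  ultimately have "bij_betw (?m P \<circ> (\<lambda>X. (e Iu X, e Il X, e In X))) V UNIV"
    using bij_betw_trans by blast
  then show "bij_betw (\<lambda>X. (e' Iu X, e' Il X, e' In X)) V UNIV"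
    by (rule bij_betw_cong[THEN iffD1, rotated]) (simp add: e' sum_frame_index)
qed

end

section \<open>Flows in terms of the matrix of the shape tensor\<close>

text \<open>Makes one-sided derivatives at the end points of the interval unique.\<close>

lemma interval_within_nontrivial:
  fixes I :: "real set"
  assumes "is_interval I" "0 \<in> I" "I \<noteq> {0}" "t \<in> I"
  shows "at t within I \<noteq> bot"
proof -
  have "\<nexists>x. I = {x}" using assms(2,3) by auto
  then have "t islimpt I"
    using connected_imp_perfect assms(1,4) is_interval_connected by blast
  then show ?thesis by (simp add: trivial_limit_within)
qed

lemma smooth_on_interval_differentiable:
  assumes "smooth_on_interval I f" "t \<in> I"
  obtains f' where "(f has_real_derivative f') (at t within I)"
proof -
  obtain D where D: "\<forall>t\<in>I. D 0 t = f t"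
    "\<forall>k. \<forall>t\<in>I. (D k has_real_derivative D (Suc k) t) (at t within I)"
    using assms(1) by (auto simp: smooth_on_interval_def)
  have "(f has_real_derivative D (Suc 0) t) (at t within I)"
    by (rule has_field_derivative_transform_within[where f = "D 0" and d = 1])
      (use D assms(2) in auto)
  then show thesis using that by blast
qed

lemma smooth_on_interval_continuous:
  assumes "smooth_on_interval I f"
  shows "continuous_on I f"
  unfolding continuous_on_eq_continuous_within
proof
  fix t assume "t \<in> I"
  then obtain f' where "(f has_real_derivative f') (at t within I)"
    by (rule smooth_on_interval_differentiable[OF assms])
  then show "continuous (at t within I) f" by (rule DERIV_continuous)
qed

text \<open>The flow equations in components: \<open>S t a b\<close> are the coefficients of \<open>\<Theta>\<^sub>t\<close> in the frame \<open>e t\<close>,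
  and \<open>\<Theta>\<^sub>t(e\<^sub>a) = \<Sum>\<^sub>b S\<^sub>a\<^sub>b e\<^sub>b\<close>. Here \<open>\<Theta>\<^sub>t\<close> is no longer defined through the metric; the symmetry of
  \<open>S\<close> together with the evolution equation recovers it.\<close>

definition shape_flow ::
  "'m vfield set \<Rightarrow> real set \<Rightarrow> (real \<Rightarrow> real) \<Rightarrow> (real \<Rightarrow> 'm vfield frame) \<Rightarrow>
   (real \<Rightarrow> frame_index \<Rightarrow> frame_index \<Rightarrow> real) \<Rightarrow> bool" where
  "shape_flow V I \<beta> e S \<longleftrightarrow> (\<forall>t\<in>I.
     left_invariant_coframe V (e t) \<and> (\<forall>a b. S t a b = S t b a) \<and>
     (\<forall>X\<in>V. \<forall>a. ((\<lambda>s. e s a X) has_real_derivative - (\<beta> t * (\<Sum>b\<in>UNIV. S t a b * e t b X))) (at t within I)) \<and>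
     (\<forall>X\<in>V. \<forall>Y\<in>V. \<forall>a. e t a (bracket X Y) =
        (\<Sum>b\<in>UNIV. S t a b * (e t Iu X * e t b Y - e t Iu Y * e t b X))) \<and>
     (\<forall>X\<in>V. (\<Sum>b\<in>UNIV. S t Iu b * e t b X) = (\<Sum>b\<in>UNIV. S 0 Iu b * e 0 b X)) \<and>
     (\<forall>X\<in>V. \<forall>Y\<in>V. (\<Sum>b\<in>UNIV. S t Iu b * e t b (bracket X Y)) = 0))"

lemma shape_flowD:
  assumes "shape_flow V I \<beta> e S" "t \<in> I"
  shows "left_invariant_coframe V (e t)" "S t a b = S t b a"
    "X \<in> V \<Longrightarrow> ((\<lambda>s. e s a X) has_real_derivative - (\<beta> t * (\<Sum>b\<in>UNIV. S t a b * e t b X))) (at t within I)"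
    "X \<in> V \<Longrightarrow> Y \<in> V \<Longrightarrow> e t a (bracket X Y) =
        (\<Sum>b\<in>UNIV. S t a b * (e t Iu X * e t b Y - e t Iu Y * e t b X))"
    "X \<in> V \<Longrightarrow> (\<Sum>b\<in>UNIV. S t Iu b * e t b X) = (\<Sum>b\<in>UNIV. S 0 Iu b * e 0 b X)"
    "X \<in> V \<Longrightarrow> Y \<in> V \<Longrightarrow> (\<Sum>b\<in>UNIV. S t Iu b * e t b (bracket X Y)) = 0"
  using assms unfolding shape_flow_def by blast+

lemma interval_constant:
  fixes f :: "real \<Rightarrow> real"
  assumes "is_interval I" "0 \<in> I" "\<And>t. t \<in> I \<Longrightarrow> (f has_real_derivative 0) (at t within I)" "t \<in> I"
  shows "f t = f 0"
  using has_field_derivative_zero_constant[of I f] assms is_interval_convex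
  by (metis)

text \<open>Differentiating \<open>\<Sum>\<^sub>a e\<^sub>a \<otimes> e\<^sub>a\<close> along \<open>e' = -\<beta> S e\<close> gives \<open>-\<beta> (S + S\<^sup>T)\<close> in the frame, which is
  \<open>-2 \<beta> S\<close> by symmetry.\<close>

lemma (in vfield_lie_algebra) Theta_of_shape_flow:
  assumes I: "is_interval I" "0 \<in> I" "I \<noteq> {0}" and pos: "\<And>t. t \<in> I \<Longrightarrow> 0 < \<beta> t"
    and flow: "shape_flow V I \<beta> e S" and t: "t \<in> I" and XY: "X \<in> V" "Y \<in> V"
  shows "Theta I \<beta> e t X Y = (\<Sum>a\<in>UNIV. \<Sum>b\<in>UNIV. S t a b * tensor (e t a) (e t b) X Y)"
proof -
  note D = shape_flowD(3)[OF flow t]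
  have "((\<lambda>s. frame_metric (e s) X Y) has_real_derivative
     (\<Sum>a\<in>UNIV. (- (\<beta> t * (\<Sum>b\<in>UNIV. S t a b * e t b X))) * e t a Y +
       (- (\<beta> t * (\<Sum>b\<in>UNIV. S t a b * e t b Y))) * e t a X)) (at t within I)"
    unfolding frame_metric_def tensor_def
    by (intro DERIV_sum DERIV_mult D XY)
  also have "(\<Sum>a\<in>UNIV. (- (\<beta> t * (\<Sum>b\<in>UNIV. S t a b * e t b X))) * e t a Y +
       (- (\<beta> t * (\<Sum>b\<in>UNIV. S t a b * e t b Y))) * e t a X)
     = - 2 * \<beta> t * (\<Sum>a\<in>UNIV. \<Sum>b\<in>UNIV. S t a b * tensor (e t a) (e t b) X Y)"
    using shape_flowD(2)[OF flow t, of Il Iu] shape_flowD(2)[OF flow t, of In Iu]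
      shape_flowD(2)[OF flow t, of In Il]
    by (simp add: sum_frame_index tensor_def algebra_simps)
  finally have "vector_derivative (\<lambda>s. frame_metric (e s) X Y) (at t within I) =
    - 2 * \<beta> t * (\<Sum>a\<in>UNIV. \<Sum>b\<in>UNIV. S t a b * tensor (e t a) (e t b) X Y)"
    by (intro vector_derivative_within[OF interval_within_nontrivial[OF I t]])
      (simp add: has_real_derivative_iff_has_vector_derivative)
  then show ?thesis using pos[OF t] by (simp add: Theta_def)
qed

lemma (in vfield_lie_algebra) contract_of_shape_flow:
  assumes I: "is_interval I" "0 \<in> I" "I \<noteq> {0}" and pos: "\<And>t. t \<in> I \<Longrightarrow> 0 < \<beta> t"
    and flow: "shape_flow V I \<beta> e S" and t: "t \<in> I" and X: "X \<in> V"
  shows "contract V (frame_metric (e t)) (Theta I \<beta> e t) (e t a) X = (\<Sum>b\<in>UNIV. S t a b * e t b X)"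
proof -
  note e = shape_flowD(1)[OF flow t]
  obtain E where E: "\<And>a. E a \<in> V" "\<And>a b. e t b (E a) = (if a = b then 1 else 0)"
    using coframe_dual_basis[OF e] by blast
  have "contract V (frame_metric (e t)) (Theta I \<beta> e t) (e t a) X = Theta I \<beta> e t (E a) X"
    unfolding contract_def using sharp_coframe[of "e t" E a, OF e E] by simp
  also have "\<dots> = (\<Sum>c\<in>UNIV. \<Sum>b\<in>UNIV. S t c b * tensor (e t c) (e t b) (E a) X)"
    by (rule Theta_of_shape_flow[OF I pos flow t E(1) X])
  also have "\<dots> = (\<Sum>b\<in>UNIV. S t a b * e t b X)"
    by (cases a; simp add: sum_frame_index tensor_def E(2))
  finally show ?thesis .
qed

lemma parallel_spinor_flow_of_shape_flow:
  assumes "vfield_lie_algebra (lie_algebra G A)"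
    and I: "is_interval I" "0 \<in> I" "I \<noteq> {0}"
    and \<beta>: "smooth_on_interval I \<beta>" "\<And>t. t \<in> I \<Longrightarrow> 0 < \<beta> t"
    and smooth: "\<And>a X. X \<in> lie_algebra G A \<Longrightarrow> smooth_on_interval I (\<lambda>t. e t a X)"
    and flow: "shape_flow (lie_algebra G A) I \<beta> e S"
  shows "parallel_spinor_flow G A I \<beta> e"
proof -
  interpret vfield_lie_algebra "lie_algebra G A" by fact
  let ?V = "lie_algebra G A"
  note contr = contract_of_shape_flow[OF I \<beta>(2) flow]
  note D = shape_flowD[OF flow]
  have vd: "vector_derivative (\<lambda>s. e s a X) (at t within I) + \<beta> t * (\<Sum>b\<in>UNIV. S t a b * e t b X) = 0"
    if "t \<in> I" "X \<in> ?V" for t a X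
    using vector_derivative_within[OF interval_within_nontrivial[OF I that(1)]
        D(3)[OF that(1,2), of a, unfolded has_real_derivative_iff_has_vector_derivative]] by simp
  have str: "ext_d (e t a) X Y = wedge (contract ?V (frame_metric (e t)) (Theta I \<beta> e t) (e t a)) (e t Iu) X Y"
    if "t \<in> I" "X \<in> ?V" "Y \<in> ?V" for t a X Y
    using that D(4)[of t X Y a]
    by (simp add: ext_d_def wedge_def tensor_def contr sum_frame_index algebra_simps)
  have con: "((\<lambda>s. contract ?V (frame_metric (e s)) (Theta I \<beta> e s) (e s Iu) X)
      has_real_derivative 0) (at t within I)" if "t \<in> I" "X \<in> ?V" for t X
    by (rule has_field_derivative_transform_within[where f = "\<lambda>_. \<Sum>b\<in>UNIV. S 0 Iu b * e 0 b X" and d = 1])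
      (use that D(5) contr in auto)
  show ?thesis
    unfolding parallel_spinor_flow_def Let_def
    using I \<beta> smooth D(1) vd str con D(6) by (auto simp: contr ext_d_def bracket_closed)
qed

text \<open>The components are \<open>\<Theta>\<^sub>t(E\<^sub>a, E\<^sub>b)\<close> for the dual basis \<open>E\<close>. They determine \<open>\<Theta>\<^sub>t(e\<^sub>a)\<close> once that form
  is known to be linear on the Lie algebra, which holds because it is a multiple of the time derivative of
  the linear form \<open>e\<^sub>a\<close>.\<close>

lemma shape_flow_of_parallel_spinor_flow:
  assumes "vfield_lie_algebra (lie_algebra G A)" and flow: "parallel_spinor_flow G A I \<beta> e"
  obtains S where "shape_flow (lie_algebra G A) I \<beta> e S"
proof -
  interpret vfield_lie_algebra "lie_algebra G A" by fact
  let ?V = "lie_algebra G A"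
  define f where "f = (\<lambda>t a. contract ?V (frame_metric (e t)) (Theta I \<beta> e t) (e t a))"
  have I: "is_interval I" "0 \<in> I" "I \<noteq> {0}"
    and pos: "\<And>t. t \<in> I \<Longrightarrow> 0 < \<beta> t" and cof: "\<And>t. t \<in> I \<Longrightarrow> left_invariant_coframe ?V (e t)"
    and sm: "\<And>a X. X \<in> ?V \<Longrightarrow> smooth_on_interval I (\<lambda>t. e t a X)"
    and vd: "\<And>t a X. t \<in> I \<Longrightarrow> X \<in> ?V \<Longrightarrow>
        vector_derivative (\<lambda>s. e s a X) (at t within I) + \<beta> t * f t a X = 0"
    and str: "\<And>t a X Y. t \<in> I \<Longrightarrow> X \<in> ?V \<Longrightarrow> Y \<in> ?V \<Longrightarrow> ext_d (e t a) X Y = wedge (f t a) (e t Iu) X Y"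
    and con: "\<And>t X. t \<in> I \<Longrightarrow> X \<in> ?V \<Longrightarrow> ((\<lambda>s. f s Iu X) has_real_derivative 0) (at t within I)"
    and clo: "\<And>t X Y. t \<in> I \<Longrightarrow> X \<in> ?V \<Longrightarrow> Y \<in> ?V \<Longrightarrow> ext_d (f t Iu) X Y = 0"
    using flow unfolding parallel_spinor_flow_def Let_def f_def by blast+
  note nontriv = interval_within_nontrivial[OF I]
  have der: "((\<lambda>s. e s a X) has_real_derivative - (\<beta> t * f t a X)) (at t within I)"
    if t: "t \<in> I" and X: "X \<in> ?V" for t a X
  proof -
    obtain d where d: "((\<lambda>s. e s a X) has_real_derivative d) (at t within I)"
      using smooth_on_interval_differentiable[OF sm[OF X] t] by blast
    then have "d = vector_derivative (\<lambda>s. e s a X) (at t within I)"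
      by (intro vector_derivative_within[OF nontriv[OF t], symmetric])
        (simp add: has_real_derivative_iff_has_vector_derivative)
    with vd[OF t X, of a] have "d = - (\<beta> t * f t a X)" by linarith
    with d show ?thesis by simp
  qed
  have lin: "linear_form ?V (f t a)" if t: "t \<in> I" for t a
    unfolding linear_form_def
  proof (intro ballI allI)
    fix X Y c d assume XY: "X \<in> ?V" "Y \<in> ?V"
    let ?Z = "add_field (scale_field c X) (scale_field d Y)"
    have "((\<lambda>s. c * e s a X + d * e s a Y) has_real_derivative
        c * - (\<beta> t * f t a X) + d * - (\<beta> t * f t a Y)) (at t within I)"
      by (intro DERIV_add DERIV_cmult der t XY)
    then have "((\<lambda>s. e s a ?Z) has_real_derivative
        c * - (\<beta> t * f t a X) + d * - (\<beta> t * f t a Y)) (at t within I)"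
      by (rule has_field_derivative_transform_within[where d = 1])
        (use t XY cof in \<open>auto simp: left_invariant_coframe_def linear_form_def\<close>)
    with der[OF t linear_combination[OF XY], of a c d]
    have "- (\<beta> t * f t a ?Z) = c * - (\<beta> t * f t a X) + d * - (\<beta> t * f t a Y)"
      using vector_derivative_unique_within[OF nontriv[OF t]]
      by (simp add: has_real_derivative_iff_has_vector_derivative)
    then have "\<beta> t * f t a ?Z = \<beta> t * (c * f t a X + d * f t a Y)" by (simp add: algebra_simps)
    with pos[OF t] show "f t a ?Z = c * f t a X + d * f t a Y" by simp
  qed
  have "\<exists>E. (\<forall>a. E a \<in> ?V) \<and> (\<forall>a b. e t b (E a) = (if a = b then 1 else 0))" if "t \<in> I" for t
    by (rule coframe_dual_basis[OF cof[OF that]]) blast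
  then have "\<forall>t\<in>I. \<exists>E. (\<forall>a. E a \<in> ?V) \<and> (\<forall>a b. e t b (E a) = (if a = b then 1 else 0))" by blast
  from bchoice[OF this] obtain E where E: "\<And>t a. t \<in> I \<Longrightarrow> E t a \<in> ?V"
    "\<And>t a b. t \<in> I \<Longrightarrow> e t b (E t a) = (if a = b then 1 else 0)" by blast
  define S where "S = (\<lambda>t a b. Theta I \<beta> e t (E t a) (E t b))"
  have fE: "f t a X = Theta I \<beta> e t (E t a) X" if "t \<in> I" for t a X
    unfolding f_def contract_def using sharp_coframe[of "e t" "E t" a, OF cof[OF that] E(1)[OF that] E(2)[OF that]] by simp
  have fS: "f t a X = (\<Sum>b\<in>UNIV. S t a b * e t b X)" if "t \<in> I" "X \<in> ?V" for t a X
    using coframe_expansion[of "e t" "E t" "f t a" X, OF cof[OF that(1)] E(1)[OF that(1)] E(2)[OF that(1)]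
        lin[OF that(1)] that(2)] that(1)
    by (simp add: fE S_def mult.commute)
  have sym: "S t a b = S t b a" for t a b
    unfolding S_def Theta_def frame_metric_def tensor_def by (simp add: mult.commute)
  have const: "f t Iu X = f 0 Iu X" if "t \<in> I" "X \<in> ?V" for t X
    by (rule interval_constant[OF I(1,2) con]) (use that in auto)
  have "shape_flow ?V I \<beta> e S"
    unfolding shape_flow_def
  proof (intro ballI conjI allI)
    fix t X Y a assume *: "t \<in> I" "X \<in> ?V" "Y \<in> ?V"
    show "e t a (bracket X Y) = (\<Sum>b\<in>UNIV. S t a b * (e t Iu X * e t b Y - e t Iu Y * e t b X))"
      using str[OF *, of a] * by (simp add: ext_d_def wedge_def tensor_def fS sum_frame_index algebra_simps)
    show "(\<Sum>b\<in>UNIV. S t Iu b * e t b (bracket X Y)) = 0"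
      using clo[OF *] * by (simp add: ext_d_def fS bracket_closed)
  next
    fix t X a assume *: "t \<in> I" "X \<in> ?V"
    show "((\<lambda>s. e s a X) has_real_derivative - (\<beta> t * (\<Sum>b\<in>UNIV. S t a b * e t b X))) (at t within I)"
      using der[OF *, of a] fS[OF *] by simp
    show "(\<Sum>b\<in>UNIV. S t Iu b * e t b X) = (\<Sum>b\<in>UNIV. S 0 Iu b * e 0 b X)"
      using const[OF *] fS[OF *] fS[OF I(2) *(2)] by simp
  qed (use cof sym in auto)
  then show thesis by (rule that)
qed

section \<open>Rotations of a frame about its first leg\<close>

text \<open>Both orthogonality relations are recorded, so that the transpose is a rotation by definition.\<close>

definition frame_rotation :: "(frame_index \<Rightarrow> frame_index \<Rightarrow> real) \<Rightarrow> bool" where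
  "frame_rotation R \<longleftrightarrow>
     (\<forall>a. R Iu a = (if a = Iu then 1 else 0) \<and> R a Iu = (if a = Iu then 1 else 0)) \<and>
     (\<forall>a c. (\<Sum>b\<in>UNIV. R a b * R c b) = (if a = c then 1 else 0)) \<and>
     (\<forall>a c. (\<Sum>b\<in>UNIV. R b a * R b c) = (if a = c then 1 else 0))"

definition rotate_frame :: "(frame_index \<Rightarrow> frame_index \<Rightarrow> real) \<Rightarrow> 'v frame \<Rightarrow> 'v frame" where
  "rotate_frame R e = (\<lambda>a X. \<Sum>b\<in>UNIV. R a b * e b X)"

definition rotate_shape ::
  "(frame_index \<Rightarrow> frame_index \<Rightarrow> real) \<Rightarrow> (frame_index \<Rightarrow> frame_index \<Rightarrow> real) \<Rightarrow>
   frame_index \<Rightarrow> frame_index \<Rightarrow> real" where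
  "rotate_shape R S = (\<lambda>a b. \<Sum>c\<in>UNIV. \<Sum>d\<in>UNIV. R a c * S c d * R b d)"

lemma frame_rotation_transpose: "frame_rotation R \<Longrightarrow> frame_rotation (\<lambda>a b. R b a)"
  unfolding frame_rotation_def by blast

lemma rotate_vector_inverse:
  assumes "frame_rotation R"
  shows "(\<Sum>b\<in>UNIV. R b a * (\<Sum>c\<in>UNIV. R b c * x c)) = x a"
proof -
  have "(\<Sum>b\<in>UNIV. R b a * (\<Sum>c\<in>UNIV. R b c * x c)) = (\<Sum>c\<in>UNIV. (\<Sum>b\<in>UNIV. R b a * R b c) * x c)"
    by (simp add: sum_frame_index algebra_simps)
  also have "\<dots> = x a"
  proof -
    have "(\<Sum>b\<in>UNIV. R b a * R b c) = (if a = c then 1 else 0)" for c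
      using assms by (simp add: frame_rotation_def)
    then show ?thesis by (cases a) (simp_all add: sum_frame_index[of "\<lambda>c. _ c * x c"])
  qed
  finally show ?thesis .
qed

lemma rotate_frame_inverse:
  "frame_rotation R \<Longrightarrow> rotate_frame (\<lambda>a b. R b a) (rotate_frame R e) = e"
  unfolding rotate_frame_def by (intro ext) (rule rotate_vector_inverse)

lemma rotate_frame_u: "frame_rotation R \<Longrightarrow> rotate_frame R e Iu X = e Iu X"
  by (simp add: rotate_frame_def frame_rotation_def sum_frame_index)

lemma frame_metric_rotate:
  assumes "frame_rotation R"
  shows "frame_metric (rotate_frame R e) = frame_metric e"
proof (intro ext)
  fix X Y
  have "frame_metric (rotate_frame R e) X Y
      = (\<Sum>a\<in>UNIV. (\<Sum>b\<in>UNIV. R a b * e b X) * (\<Sum>c\<in>UNIV. R a c * e c Y))"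
    by (simp add: frame_metric_def tensor_def rotate_frame_def)
  also have "\<dots> = (\<Sum>b\<in>UNIV. e b X * (\<Sum>a\<in>UNIV. R a b * (\<Sum>c\<in>UNIV. R a c * e c Y)))"
    by (simp add: sum_frame_index algebra_simps)
  finally show "frame_metric (rotate_frame R e) X Y = frame_metric e X Y"
    by (simp add: rotate_vector_inverse[OF assms] frame_metric_def tensor_def)
qed

text \<open>The rotated matrix applied to a rotated vector is the rotation of the matrix applied to the vector.
  Every flow equation is linear in such expressions, which yields invariance under rotations.\<close>

lemma rotate_shape_apply:
  assumes "frame_rotation R"
  shows "(\<Sum>b\<in>UNIV. rotate_shape R S a b * (\<Sum>k\<in>UNIV. R b k * x k))
    = (\<Sum>c\<in>UNIV. R a c * (\<Sum>d\<in>UNIV. S c d * x d))"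
proof -
  have "(\<Sum>b\<in>UNIV. rotate_shape R S a b * y b)
    = (\<Sum>c\<in>UNIV. R a c * (\<Sum>d\<in>UNIV. S c d * (\<Sum>b\<in>UNIV. R b d * y b)))" for y
    by (simp add: rotate_shape_def sum_frame_index algebra_simps)
  then show ?thesis by (simp add: rotate_vector_inverse[OF assms])
qed

lemma (in vfield_lie_algebra) shape_flow_rotate:
  assumes flow: "shape_flow V I \<beta> e S" and R: "frame_rotation R"
  shows "shape_flow V I \<beta> (\<lambda>t. rotate_frame R (e t)) (\<lambda>t. rotate_shape R (S t))"
  unfolding shape_flow_def
proof (intro ballI conjI allI)
  fix t assume t: "t \<in> I"
  note D = shape_flowD[OF flow t]
  have shape: "(\<Sum>b\<in>UNIV. rotate_shape R (S s) a b * rotate_frame R (e s) b X)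
      = (\<Sum>c\<in>UNIV. R a c * (\<Sum>d\<in>UNIV. S s c d * e s d X))" for s a X
    using rotate_shape_apply[OF R, of "S s" a "\<lambda>k. e s k X"] by (simp add: rotate_frame_def)
  have Ru: "(\<Sum>c\<in>UNIV. R Iu c * x c) = x Iu" for x
    using R by (simp add: frame_rotation_def sum_frame_index)
  show "left_invariant_coframe V (rotate_frame R (e t))"
    by (rule coframe_transform[OF D(1), of _ R "\<lambda>a b. R b a"])
      (use R in \<open>simp_all add: rotate_frame_def frame_rotation_def\<close>)
  show "rotate_shape R (S t) a b = rotate_shape R (S t) b a" for a b
    unfolding rotate_shape_def
    by (subst sum.swap) (simp add: D(2)[of _ a] mult_ac D(2)[where a = c and b = d for c d] cong: sum.cong)
  fix X assume X: "X \<in> V"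
  show "((\<lambda>s. rotate_frame R (e s) a X) has_real_derivative
      - (\<beta> t * (\<Sum>b\<in>UNIV. rotate_shape R (S t) a b * rotate_frame R (e t) b X))) (at t within I)" for a
  proof -
    have "((\<lambda>s. \<Sum>c\<in>UNIV. R a c * e s c X) has_real_derivative
      (\<Sum>c\<in>UNIV. R a c * - (\<beta> t * (\<Sum>d\<in>UNIV. S t c d * e t d X)))) (at t within I)"
      by (intro DERIV_sum DERIV_cmult D(3) X)
    moreover have "(\<Sum>c\<in>UNIV. R a c * - (\<beta> t * (\<Sum>d\<in>UNIV. S t c d * e t d X)))
      = - (\<beta> t * (\<Sum>c\<in>UNIV. R a c * (\<Sum>d\<in>UNIV. S t c d * e t d X)))"
      by (simp add: sum_distrib_left sum_negf mult_ac)
    ultimately show ?thesis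
      unfolding shape by (simp add: rotate_frame_def)
  qed
  show "(\<Sum>b\<in>UNIV. rotate_shape R (S t) Iu b * rotate_frame R (e t) b X) =
      (\<Sum>b\<in>UNIV. rotate_shape R (S 0) Iu b * rotate_frame R (e 0) b X)"
    by (simp add: shape Ru D(5)[OF X])
  fix Y assume Y: "Y \<in> V"
  show "(\<Sum>b\<in>UNIV. rotate_shape R (S t) Iu b * rotate_frame R (e t) b (bracket X Y)) = 0"
    by (simp add: shape Ru D(6)[OF X Y])
  fix a
  have "(\<Sum>b\<in>UNIV. rotate_shape R (S t) a b * (e t Iu X * rotate_frame R (e t) b Y - e t Iu Y * rotate_frame R (e t) b X))
    = e t Iu X * (\<Sum>b\<in>UNIV. rotate_shape R (S t) a b * rotate_frame R (e t) b Y)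
      - e t Iu Y * (\<Sum>b\<in>UNIV. rotate_shape R (S t) a b * rotate_frame R (e t) b X)"
    by (simp add: sum_frame_index algebra_simps)
  also have "\<dots> = (\<Sum>c\<in>UNIV. R a c * (\<Sum>b\<in>UNIV. S t c b * (e t Iu X * e t b Y - e t Iu Y * e t b X)))"
    unfolding shape by (simp add: sum_frame_index algebra_simps)
  also have "\<dots> = rotate_frame R (e t) a (bracket X Y)"
    by (simp add: D(4)[OF X Y] rotate_frame_def)
  finally show "rotate_frame R (e t) a (bracket X Y) = (\<Sum>b\<in>UNIV. rotate_shape R (S t) a b *
      (rotate_frame R (e t) Iu X * rotate_frame R (e t) b Y - rotate_frame R (e t) Iu Y * rotate_frame R (e t) b X))"
    by (simp add: rotate_frame_u[OF R])
qed

section \<open>Untilted flows with diagonal shape\<close>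

text \<open>The quotient of two solutions has derivative zero. With \<open>x 0 = 0\<close> this is uniqueness of the zero
  solution.\<close>

lemma scalar_linear_ode_unique:
  fixes x g k :: "real \<Rightarrow> real"
  assumes I: "is_interval I" "0 \<in> I"
    and x: "\<And>t. t \<in> I \<Longrightarrow> (x has_real_derivative k t * x t) (at t within I)"
    and g: "\<And>t. t \<in> I \<Longrightarrow> (g has_real_derivative k t * g t) (at t within I)"
    and g0: "g 0 = 1" "\<And>t. t \<in> I \<Longrightarrow> g t \<noteq> 0" and t: "t \<in> I"
  shows "x t = x 0 * g t"
proof -
  have "((\<lambda>s. x s / g s) has_real_derivative 0) (at s within I)" if "s \<in> I" for s
    using DERIV_divide[OF x[OF that] g[OF that] g0(2)[OF that]] by (simp add: algebra_simps)
  then have "x t / g t = x 0 / g 0" by (rule interval_constant[OF I _ t])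
  then show ?thesis using g0(1) g0(2)[OF t] by (simp add: field_simps)
qed

lemma interval_affine_unique:
  fixes x B \<beta> :: "real \<Rightarrow> real"
  assumes I: "is_interval I" "0 \<in> I"
    and x: "\<And>t. t \<in> I \<Longrightarrow> (x has_real_derivative \<beta> t * c) (at t within I)"
    and B: "\<And>t. t \<in> I \<Longrightarrow> (B has_real_derivative \<beta> t) (at t within I)" "B 0 = 0" and t: "t \<in> I"
  shows "x t = x 0 + B t * c"
proof -
  have "((\<lambda>s. x s - B s * c) has_real_derivative 0) (at s within I)" if "s \<in> I" for s
    using DERIV_diff[OF x[OF that] DERIV_cmult_right[OF B(1)[OF that], of c]] by simp
  then have "x t - B t * c = x 0 - B 0 * c" by (rule interval_constant[OF I _ t])
  then show ?thesis using B(2) by simp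
qed

text \<open>The function \<open>B\<close> is kept abstract because it will be the integral of \<open>\<beta>\<close> as well as the integral of
  an extension of \<open>\<beta>\<close> to the real line.\<close>

locale spinor_flow_on = vfield_lie_algebra V for V :: "'m vfield set" +
  fixes I :: "real set" and \<beta> B :: "real \<Rightarrow> real" and e :: "real \<Rightarrow> 'm vfield frame"
    and S :: "real \<Rightarrow> frame_index \<Rightarrow> frame_index \<Rightarrow> real"
  assumes interval: "is_interval I" "0 \<in> I"
    and flow: "shape_flow V I \<beta> e S"
    and B_deriv: "\<And>t. t \<in> I \<Longrightarrow> (B has_real_derivative \<beta> t) (at t within I)"
    and B_zero: "B 0 = 0"
begin

lemma dual_basis:
  obtains E where "\<And>a. E a \<in> V" "\<And>a b. e 0 b (E a) = (if a = b then 1 else 0)"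
    "\<And>t a X. t \<in> I \<Longrightarrow> X \<in> V \<Longrightarrow> e t a X = (\<Sum>c\<in>UNIV. e 0 c X * e t a (E c))"
proof -
  note e0 = shape_flowD(1)[OF flow interval(2)]
  obtain E where E: "\<And>a. E a \<in> V" "\<And>a b. e 0 b (E a) = (if a = b then 1 else 0)"
    by (rule coframe_dual_basis[OF e0]) blast
  show thesis
  proof (rule that[OF E])
    fix t a X assume "t \<in> I" "X \<in> V"
    then show "e t a X = (\<Sum>c\<in>UNIV. e 0 c X * e t a (E c))"
      using coframe_expansion[of "e 0" E "e t a" X, OF e0 E coframe_linear[OF shape_flowD(1)[OF flow]]]
      by blast
  qed
qed

text \<open>The one-form \<open>\<Theta>(e\<^sub>u)\<close> is constant in time, hence the evolution equation of \<open>e\<^sub>u\<close> integrates at once.\<close>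

lemma eu_explicit:
  assumes "t \<in> I" "X \<in> V"
  shows "e t Iu X = e 0 Iu X - B t * (\<Sum>b\<in>UNIV. S 0 Iu b * e 0 b X)"
proof -
  have "((\<lambda>s. e s Iu X) has_real_derivative \<beta> s * - (\<Sum>b\<in>UNIV. S 0 Iu b * e 0 b X)) (at s within I)"
    if "s \<in> I" for s
    using shape_flowD(3)[OF flow that assms(2), of Iu] shape_flowD(5)[OF flow that assms(2)] by simp
  from interval_affine_unique[OF interval this B_deriv B_zero assms(1)] show ?thesis by simp
qed

text \<open>The Jacobi identity for the dual basis vectors. It is the part of the integrability of the structure equations
  that is not automatic: \<open>\<Theta>(e\<^sub>a) \<and> \<Theta>(e\<^sub>u) \<and> e\<^sub>u = 0\<close>.\<close>

lemma shape_jacobi: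
  assumes t: "t \<in> I"
  shows "S t a Il * S t Iu In = S t a In * S t Iu Il"
proof -
  note D = shape_flowD[OF flow t]
  obtain E where E: "\<And>a. E a \<in> V" "\<And>a b. e t b (E a) = (if a = b then 1 else 0)"
    by (rule coframe_dual_basis[OF D(1)]) blast
  have "0 = e t a zero_field"
    using linear_form_zero[OF coframe_linear[OF D(1)] E(1)[of Iu]] by simp
  also have "\<dots> = e t a (bracket (E Iu) (bracket (E Il) (E In)))
    + (e t a (bracket (E Il) (bracket (E In) (E Iu))) + e t a (bracket (E In) (bracket (E Iu) (E Il))))"
    unfolding jacobi[of "E Iu" "E Il" "E In", OF E(1) E(1) E(1), symmetric]
    by (simp add: linear_form_add coframe_linear[OF D(1)] E(1) bracket_closed add_closed)
  also have "\<dots> = S t a Il * S t Iu In - S t a In * S t Iu Il"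
    by (simp add: D(4) E bracket_closed sum_frame_index)
  finally show ?thesis by simp
qed

text \<open>Closedness of \<open>\<Theta>(e\<^sub>u)\<close>, evaluated on \<open>[E\<^sub>u, E\<^sub>c]\<close>.\<close>

lemma shape_closed:
  assumes t: "t \<in> I" and "c \<noteq> Iu"
  shows "(\<Sum>b\<in>UNIV. S t Iu b * S t b c) = 0"
proof -
  note D = shape_flowD[OF flow t]
  obtain E where E: "\<And>a. E a \<in> V" "\<And>a b. e t b (E a) = (if a = b then 1 else 0)"
    by (rule coframe_dual_basis[OF D(1)]) blast
  have "e t b (bracket (E Iu) (E c)) = S t b c" for b
    using \<open>c \<noteq> Iu\<close> by (cases c) (simp_all add: D(4) E sum_frame_index)
  then show ?thesis using D(6)[OF E(1) E(1), of Iu c] by simp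
qed

text \<open>The factor cannot vanish, since \<open>e\<^sub>u\<close> is part of a coframe; being continuous on an interval and
  equal to \<open>1\<close> at time \<open>0\<close>, it stays positive.\<close>

lemma eu_factor_pos:
  assumes "S 0 Iu Il = 0" "S 0 Iu In = 0" "t \<in> I"
  shows "0 < 1 - S 0 Iu Iu * B t"
proof -
  have nz: "1 - S 0 Iu Iu * B s \<noteq> 0" if "s \<in> I" for s
  proof
    assume "1 - S 0 Iu Iu * B s = 0"
    moreover have "e s Iu X = (1 - S 0 Iu Iu * B s) * e 0 Iu X" if "X \<in> V" for X
      using eu_explicit[OF \<open>s \<in> I\<close> that] assms(1,2) by (simp add: sum_frame_index algebra_simps)
    ultimately have zero: "e s Iu X = 0" if "X \<in> V" for X using that by simp
    obtain E where E: "\<And>a. E a \<in> V" "\<And>a b. e s b (E a) = (if a = b then 1 else 0)"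
      by (rule coframe_dual_basis[OF shape_flowD(1)[OF flow \<open>s \<in> I\<close>]]) blast
    show False using zero[OF E(1)[of Iu]] E(2)[of Iu Iu] by simp
  qed
  have cont: "continuous_on I (\<lambda>s. 1 - S 0 Iu Iu * B s)"
    using B_deriv by (intro continuous_intros) (auto simp: continuous_on_eq_continuous_within
        intro: DERIV_continuous)
  have conn: "connected ((\<lambda>s. 1 - S 0 Iu Iu * B s) ` I)"
    by (rule connected_continuous_image[OF cont]) (use interval(1) is_interval_connected in blast)
  show ?thesis
  proof (rule ccontr)
    assume "\<not> ?thesis"
    moreover have "1 \<in> (\<lambda>s. 1 - S 0 Iu Iu * B s) ` I"
      using interval(2) B_zero by (auto simp: image_iff intro!: bexI[of _ 0])
    ultimately have "0 \<in> (\<lambda>s. 1 - S 0 Iu Iu * B s) ` I"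
      using connectedD_interval[OF conn, of "1 - S 0 Iu Iu * B t" 1 0] assms(3) by auto
    then show False using nz by force
  qed
qed

text \<open>At time \<open>0\<close> one has \<open>[E\<^sub>u, E\<^sub>c] = S\<^sub>c\<^sub>c E\<^sub>c\<close>. The structure equation at time \<open>t\<close> on this bracket gives
  \<open>\<Theta>\<^sub>t(e\<^sub>a)(E\<^sub>c) = S\<^sub>c\<^sub>c e\<^sub>a(E\<^sub>c) / (1 - \<kappa> B)\<close>, a scalar linear equation for \<open>e\<^sub>a(E\<^sub>c)\<close>. Knowing these values,
  \<open>S\<^sub>t\<close> is diagonal, and then \<open>e\<^sub>a(E\<^sub>u)\<close> solves the same equation with initial value zero. The functions \<open>g\<close>
  stand for the solutions with initial value \<open>1\<close>.\<close>

lemma diagonal_flow_explicit: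
  assumes S0: "S 0 Iu Il = 0" "S 0 Iu In = 0" "S 0 Il In = 0"
    and g: "\<And>a t. t \<in> I \<Longrightarrow>
        (g a has_real_derivative - (\<beta> t * (S 0 a a / (1 - S 0 Iu Iu * B t))) * g a t) (at t within I)"
      "\<And>a. g a 0 = 1" "\<And>a t. t \<in> I \<Longrightarrow> g a t \<noteq> 0"
    and a: "a \<noteq> Iu" and t: "t \<in> I" and X: "X \<in> V"
  shows "e t a X = g a t * e 0 a X"
proof -
  obtain E where E: "\<And>a. E a \<in> V" "\<And>a b. e 0 b (E a) = (if a = b then 1 else 0)"
    "\<And>t a X. t \<in> I \<Longrightarrow> X \<in> V \<Longrightarrow> e t a X = (\<Sum>c\<in>UNIV. e 0 c X * e t a (E c))"
    by (rule dual_basis) blast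
  note D = shape_flowD[OF flow] and D0 = shape_flowD[OF flow interval(2)]
  have S0': "S 0 Il Iu = 0" "S 0 In Iu = 0" "S 0 In Il = 0" using S0 D0(2) by metis+
  let ?u = "\<lambda>s. 1 - S 0 Iu Iu * B s"
  have u: "?u s \<noteq> 0" if "s \<in> I" for s using eu_factor_pos[OF S0(1,2) that] by simp
  have eu: "e s Iu (E c) = (if c = Iu then ?u s else 0)" if "s \<in> I" for s c
    using eu_explicit[OF that E(1)] S0 by (cases c) (simp_all add: E(2) sum_frame_index mult.commute)
  have br: "e s b (bracket (E Iu) (E c)) = S 0 c c * e s b (E c)" if "s \<in> I" "c \<noteq> Iu" for s b c
    using that(2) E(3)[OF that(1) bracket_closed[OF E(1) E(1)], of b Iu c] S0 S0'
    by (cases c) (simp_all add: D0(4)[OF E(1) E(1)] E(2) sum_frame_index)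
  have F: "(\<Sum>d\<in>UNIV. S s b d * e s d (E c)) = S 0 c c / ?u s * e s b (E c)"
    if "s \<in> I" "c \<noteq> Iu" for s b c
  proof -
    have "S 0 c c * e s b (E c) = (\<Sum>d\<in>UNIV. S s b d * e s d (E c)) * ?u s"
    proof -
      have "S 0 c c * e s b (E c) = (\<Sum>d\<in>UNIV. S s b d * e s d (E c)) * e s Iu (E Iu)"
        using br[OF that, of b] D(4)[OF that(1) E(1) E(1), of b Iu c] that(2)
        by (simp add: eu[OF that(1), of c] sum_frame_index algebra_simps)
      then show ?thesis by (simp add: eu[OF that(1)])
    qed
    then show ?thesis using u[OF that(1)] by (simp add: field_simps)
  qed
  have M: "e s b (E c) = (if b = c then g c s else 0)" if "s \<in> I" "c \<noteq> Iu" for s b c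
  proof -
    have "e s b (E c) = e 0 b (E c) * g c s"
    proof (rule scalar_linear_ode_unique[OF interval _ g(1) g(2,3) that(1)])
      fix r assume r: "r \<in> I"
      have "- (\<beta> r * (\<Sum>d\<in>UNIV. S r b d * e r d (E c))) = - (\<beta> r * (S 0 c c / ?u r)) * e r b (E c)"
        by (simp add: F[OF r that(2)])
      then show "((\<lambda>s. e s b (E c)) has_real_derivative - (\<beta> r * (S 0 c c / ?u r)) * e r b (E c)) (at r within I)"
        using D(3)[OF r E(1), of b c] by simp
    qed
    then show ?thesis by (simp add: E(2))
  qed
  \<comment> \<open>the frame is now known on \<open>E\<^sub>l\<close> and \<open>E\<^sub>n\<close>, so its equation of motion can be solved for \<open>S\<^sub>t\<close>\<close>
  have Sdiag: "S s b c = (if b = c then S 0 c c / ?u s else 0)" if "s \<in> I" "c \<noteq> Iu" "b \<noteq> Iu" for s b c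
  proof -
    have "S s b c * g c s = (if b = c then S 0 c c / ?u s else 0) * g c s"
      using F[OF that(1,2), of b] M[OF that(1,2)] that(2) by (cases c) (simp_all add: sum_frame_index)
    then show ?thesis using g(3)[OF that(1), of c] mult_right_cancel by blast
  qed
  have Su: "S s c Iu = 0" if "s \<in> I" "c \<noteq> Iu" for s c
  proof -
    have "(\<Sum>b\<in>UNIV. S s Iu b * e s b (E c)) = 0"
      using D(5)[OF that(1) E(1)[of c]] S0 that(2) by (cases c) (simp_all add: E(2) sum_frame_index)
    then have "S s Iu c * g c s = 0"
      using M[OF that] that(2) by (cases c) (simp_all add: sum_frame_index)
    then show ?thesis using g(3)[OF that(1), of c] D(2)[OF that(1), of c Iu] by simp
  qed
  have Fu: "(\<Sum>d\<in>UNIV. S s a d * e s d (E Iu)) = S 0 a a / ?u s * e s a (E Iu)" if "s \<in> I" for s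
    using a Su[OF that a] Sdiag[OF that] by (cases a) (simp_all add: sum_frame_index)
  have "e t a (E Iu) = e 0 a (E Iu) * g a t"
  proof (rule scalar_linear_ode_unique[OF interval _ g(1) g(2,3) t])
    fix r assume r: "r \<in> I"
    have "- (\<beta> r * (\<Sum>d\<in>UNIV. S r a d * e r d (E Iu))) = - (\<beta> r * (S 0 a a / ?u r)) * e r a (E Iu)"
      by (simp add: Fu[OF r])
    then show "((\<lambda>s. e s a (E Iu)) has_real_derivative - (\<beta> r * (S 0 a a / ?u r)) * e r a (E Iu)) (at r within I)"
      using D(3)[OF r E(1), of a Iu] by simp
  qed
  then show ?thesis
    using E(3)[OF t X, of a] M[OF t] a by (cases a) (simp_all add: sum_frame_index E(2))
qed

end

section \<open>Tilted flows\<close>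

context spinor_flow_on
begin

lemma tilted_shape_initial:
  assumes "S 0 Iu Il = 0" "S 0 Iu In \<noteq> 0"
  shows "S 0 a Il = 0" "S 0 Il a = 0" "S 0 In In = - S 0 Iu Iu"
proof -
  have *: "S 0 a Il = 0" for a
    using shape_jacobi[OF interval(2), of a] assms by simp
  then show "S 0 a Il = 0" "S 0 Il a = 0"
    using shape_flowD(2)[OF flow interval(2)] by metis+
  have "S 0 Iu In * (S 0 Iu Iu + S 0 In In) = 0"
    using shape_closed[OF interval(2), of In] assms(1) by (simp add: sum_frame_index algebra_simps)
  then show "S 0 In In = - S 0 Iu Iu" using assms(2) by simp
qed

text \<open>Write \<open>l\<close> for the number \<open>\<Theta>\<^sub>u\<^sub>n\<close>. The brackets at time \<open>0\<close> are \<open>[E\<^sub>u, E\<^sub>l] = [E\<^sub>l, E\<^sub>n] = 0\<close> and \<open>[E\<^sub>u, E\<^sub>n] = l E\<^sub>u - \<kappa> E\<^sub>n\<close>. The vanishing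
  ones force \<open>\<Theta>\<^sub>t(e\<^sub>a)(E\<^sub>l) = 0\<close> and decouple \<open>e\<^sub>l\<close>; the remaining one, together with the
  conserved form \<open>\<Theta>\<^sub>t(e\<^sub>u)\<close>, makes the \<open>(u, n)\<close> block of \<open>S\<^sub>t\<close> trace free with off-diagonal entry
  \<open>l\<close>. The diagonal entry is \<open>z = - l tan y\<close>, and \<open>det = 1\<close> gives the frame from \<open>z\<close>.\<close>

lemma tilted_flow_explicit:
  fixes t :: real
  defines "\<kappa> \<equiv> S 0 Iu Iu" and "l \<equiv> S 0 Iu In"
  defines "y \<equiv> l * B t + arctan (\<kappa> / l)"
  assumes S0: "S 0 Iu Il = 0" "l \<noteq> 0" and t: "t \<in> I"
  shows "\<bar>y\<bar> < pi / 2"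
    and "X \<in> V \<Longrightarrow> e t Iu X = (1 - \<kappa> * B t) * e 0 Iu X - l * B t * e 0 In X"
    and "X \<in> V \<Longrightarrow> e t Il X = e 0 Il X"
    and "X \<in> V \<Longrightarrow> e t In X = (\<kappa> / l - tan y * (1 - \<kappa> * B t)) * e 0 Iu X + (1 + l * B t * tan y) * e 0 In X"
proof -
  obtain E where E: "\<And>a. E a \<in> V" "\<And>a b. e 0 b (E a) = (if a = b then 1 else 0)"
    "\<And>t a X. t \<in> I \<Longrightarrow> X \<in> V \<Longrightarrow> e t a X = (\<Sum>c\<in>UNIV. e 0 c X * e t a (E c))"
    by (rule dual_basis) blast
  note D = shape_flowD[OF flow] and D0 = shape_flowD[OF flow interval(2)]
  note init = tilted_shape_initial[OF S0(1) S0(2)[unfolded l_def]]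
  have S0': "S 0 Iu Iu = \<kappa>" "S 0 Iu In = l" "S 0 In Iu = l" "S 0 In In = - \<kappa>"
    using init(3) D0(2) by (auto simp: \<kappa>_def l_def)
  define M where "M = (\<lambda>s a c. e s a (E c))"
  define F where "F = (\<lambda>s a c. \<Sum>d\<in>UNIV. S s a d * e s d (E c))"
  have M': "((\<lambda>s. M s a c) has_real_derivative - (\<beta> s * F s a c)) (at s within I)" if "s \<in> I" for s a c
    unfolding M_def F_def by (rule D(3)[OF that E(1)])
  have M0: "M 0 a c = (if a = c then 1 else 0)" for a c by (simp add: M_def E(2))
  have Mu: "M s Iu Iu = 1 - \<kappa> * B s" "M s Iu Il = 0" "M s Iu In = - l * B s" if "s \<in> I" for s
    using eu_explicit[OF that E(1)] S0(1) S0' by (simp_all add: M_def E(2) sum_frame_index)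
  have Fu: "F s Iu Iu = \<kappa>" "F s Iu Il = 0" "F s Iu In = l" if "s \<in> I" for s
    using D(5)[OF that E(1)] S0(1) S0' by (simp_all add: F_def E(2) sum_frame_index)
  have F_eq: "F s a c = S s a Iu * M s Iu c + S s a Il * M s Il c + S s a In * M s In c" for s a c
    by (simp add: F_def M_def sum_frame_index)
  have sym: "S s a b = S s b a" if "s \<in> I" for s a b by (rule D(2)[OF that])
  have struct: "(\<Sum>d\<in>UNIV. e 0 d (bracket (E b) (E c)) * M s a d)
      = M s Iu b * F s a c - M s Iu c * F s a b" if "s \<in> I" for s a b c
    using E(3)[OF that bracket_closed[OF E(1) E(1)], of a b c] D(4)[OF that E(1) E(1), of a b c]
    by (simp add: M_def F_def sum_frame_index algebra_simps)
  \<comment> \<open>the coefficients \<open>1 - \<kappa> B\<close> and \<open>- l B\<close> of \<open>e\<^sub>u\<close> do not vanish simultaneously\<close>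
  have Fl: "F s a Il = 0" if s: "s \<in> I" for s a
  proof -
    have "M s Iu Iu * F s a Il = 0" "M s Iu In * F s a Il = 0"
      using struct[OF s, of Iu Il a] struct[OF s, of In Il a] init Mu[OF s]
      by (simp_all add: D0(4)[OF E(1) E(1)] E(2) sum_frame_index)
    moreover have "M s Iu Iu \<noteq> 0 \<or> M s Iu In \<noteq> 0"
      using Mu[OF s] S0(2) by (cases "B s = 0") auto
    ultimately show ?thesis by auto
  qed
  have Ml: "M s a Il = (if a = Il then 1 else 0)" if s: "s \<in> I" for s a
  proof -
    have "M s a Il = M 0 a Il"
      by (rule interval_constant[OF interval _ s]) (use M'[of _ a Il] Fl in simp)
    then show ?thesis by (simp add: M0)
  qed
  have Sl: "S s a Il = 0" "S s Il a = 0" if s: "s \<in> I" for s a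
    using Fl[OF s, of a] F_eq[of s a Il] Ml[OF s] sym[OF s, of a Il] by simp_all
  have Mla: "M s Il c = (if c = Il then 1 else 0)" if s: "s \<in> I" for s c
  proof -
    have "M s Il c = M 0 Il c"
      by (rule interval_constant[OF interval _ s]) (use M'[of _ Il c] F_eq Sl in simp)
    then show ?thesis by (auto simp: M0)
  qed
  have un: "l * M s a Iu - \<kappa> * M s a In = M s Iu Iu * F s a In - M s Iu In * F s a Iu" if s: "s \<in> I" for s a
    using struct[OF s, of Iu In a] init S0' Mu[OF s]
    by (simp add: D0(4)[OF E(1) E(1)] E(2) sum_frame_index)
  define d where "d = (\<lambda>s. M s Iu Iu * M s In In - M s Iu In * M s In Iu)"
  define z where "z = (\<lambda>s. l * M s In Iu - \<kappa> * M s In In)"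
  have F2: "F s a Iu = S s a Iu * M s Iu Iu + S s a In * M s In Iu"
    "F s a In = S s a Iu * M s Iu In + S s a In * M s In In" if "s \<in> I" for s a
    using F_eq Sl[OF that] by simp_all
  have z_d: "z s = S s In In * d s" "- z s = S s Iu Iu * d s" if s: "s \<in> I" for s
  proof -
    show "z s = S s In In * d s"
      using un[OF s, of In] by (simp add: z_def F2[OF s] d_def algebra_simps)
    have "S s Iu Iu * d s = F s Iu Iu * M s In In - F s Iu In * M s In Iu"
      by (simp add: F2[OF s] d_def algebra_simps)
    then show "- z s = S s Iu Iu * d s" by (simp add: Fu[OF s] z_def)
  qed
  \<comment> \<open>Liouville's formula: \<open>d' = - \<beta> (S\<^sub>u\<^sub>u + S\<^sub>n\<^sub>n) d\<close>, and the trace vanishes\<close>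
  have d: "d s = 1" if s: "s \<in> I" for s
  proof -
    have "(d has_real_derivative 0) (at r within I)" if r: "r \<in> I" for r
    proof -
      have "(d has_real_derivative
          - (\<beta> r * F r Iu Iu) * M r In In + - (\<beta> r * F r In In) * M r Iu Iu
          - (- (\<beta> r * F r Iu In) * M r In Iu + - (\<beta> r * F r In Iu) * M r Iu In)) (at r within I)"
        unfolding d_def by (intro DERIV_diff DERIV_mult M' r)
      also have "- (\<beta> r * F r Iu Iu) * M r In In + - (\<beta> r * F r In In) * M r Iu Iu
          - (- (\<beta> r * F r Iu In) * M r In Iu + - (\<beta> r * F r In Iu) * M r Iu In)
        = - \<beta> r * (S r Iu Iu * d r + S r In In * d r)"
        by (simp add: F2[OF r] d_def algebra_simps)
      also have "\<dots> = 0" using z_d[OF r] by simp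
      finally show ?thesis .
    qed
    then have "d s = d 0" by (rule interval_constant[OF interval _ s])
    then show ?thesis by (simp add: d_def M0)
  qed
  have z: "z s = S s In In" if "s \<in> I" for s using z_d(1)[OF that] d[OF that] by simp
  \<comment> \<open>Cramer's rule for the conserved row \<open>(\<kappa>, l)\<close> of \<open>S\<^sub>t\<close> times the frame matrix\<close>
  have Sun: "S s In Iu = l" if s: "s \<in> I" for s
  proof -
    have "S s Iu In * d s = M s Iu Iu * F s Iu In - M s Iu In * F s Iu Iu"
      by (simp add: F2[OF s] d_def algebra_simps)
    also have "\<dots> = l" by (simp add: Fu[OF s] Mu[OF s] algebra_simps)
    finally show ?thesis using d[OF s] sym[OF s, of In Iu] by simp
  qed
  \<comment> \<open>the Riccati equation whose solutions are tangents\<close>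
  have z': "(z has_real_derivative - (\<beta> s * (l\<^sup>2 + (z s)\<^sup>2))) (at s within I)" if s: "s \<in> I" for s
  proof -
    have "(z has_real_derivative l * - (\<beta> s * F s In Iu) - \<kappa> * - (\<beta> s * F s In In)) (at s within I)"
      unfolding z_def by (intro DERIV_diff DERIV_cmult M' s)
    also have "l * - (\<beta> s * F s In Iu) - \<kappa> * - (\<beta> s * F s In In)
      = - (\<beta> s * (l * (l * M s Iu Iu - \<kappa> * M s Iu In) + z s * z s))"
      by (simp add: F2[OF s] Sun[OF s] z[OF s, symmetric]) (simp add: z_def algebra_simps)
    also have "l * M s Iu Iu - \<kappa> * M s Iu In = l"
      by (simp add: Mu[OF s] algebra_simps)
    finally show ?thesis by (simp add: power2_eq_square)
  qed
  have "arctan (z t / l) = arctan (z 0 / l) + B t * - l"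
  proof (rule interval_affine_unique[OF interval _ B_deriv B_zero t])
    fix s assume s: "s \<in> I"
    have "((\<lambda>s. arctan (z s / l)) has_real_derivative
        - (\<beta> s * (l\<^sup>2 + (z s)\<^sup>2)) / l * inverse (1 + (z s / l)\<^sup>2)) (at s within I)"
      using DERIV_chain2[OF DERIV_arctan DERIV_cdivide[OF z'[OF s], of l]] by (simp add: mult.commute)
    also have "- (\<beta> s * (l\<^sup>2 + (z s)\<^sup>2)) / l * inverse (1 + (z s / l)\<^sup>2) = \<beta> s * - l"
    proof -
      have "1 + (z s / l)\<^sup>2 = (l\<^sup>2 + (z s)\<^sup>2) / l\<^sup>2"
        using S0(2) by (simp add: power_divide add_divide_distrib)
      moreover have "l\<^sup>2 + (z s)\<^sup>2 \<noteq> 0" using S0(2) by (simp add: sum_power2_eq_zero_iff)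
      ultimately show ?thesis using S0(2) by (simp add: power2_eq_square)
    qed
    finally show "((\<lambda>s. arctan (z s / l)) has_real_derivative \<beta> s * - l) (at s within I)" .
  qed
  then have y: "y = - arctan (z t / l)"
    by (simp add: y_def z_def M0 arctan_minus)
  then show "\<bar>y\<bar> < pi / 2"
    using arctan_bounded[of "z t / l"] by (simp add: abs_if)
  have "tan y = - z t / l" by (simp add: y tan_arctan)
  then have zt: "z t = - l * tan y" using S0(2) by (simp add: field_simps)
  have nn: "M t In In = 1 + l * B t * tan y"
  proof -
    have "1 = M t In In + B t * z t"
      using d[OF t] by (simp add: d_def Mu[OF t] z_def algebra_simps)
    then show ?thesis by (simp add: zt algebra_simps)
  qed
  have nu: "M t In Iu = \<kappa> / l - tan y * (1 - \<kappa> * B t)"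
  proof -
    have "l * M t In Iu = \<kappa> * M t In In - l * tan y"
      using zt by (simp add: z_def)
    then have "l * M t In Iu = l * (\<kappa> / l - tan y * (1 - \<kappa> * B t))"
      using S0(2) by (simp add: nn algebra_simps)
    then show ?thesis using S0(2) by simp
  qed
  assume X: "X \<in> V"
  have ex: "e t a X = e 0 Iu X * M t a Iu + e 0 Il X * M t a Il + e 0 In X * M t a In" for a
    using E(3)[OF t X, of a] by (simp add: M_def sum_frame_index)
  show "e t Iu X = (1 - \<kappa> * B t) * e 0 Iu X - l * B t * e 0 In X"
    "e t Il X = e 0 Il X"
    "e t In X = (\<kappa> / l - tan y * (1 - \<kappa> * B t)) * e 0 Iu X + (1 + l * B t * tan y) * e 0 In X"
    by (simp_all add: ex Mu[OF t] Ml[OF t] Mla[OF t] nn nu mult.commute)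
qed

end

section \<open>Flows with prescribed initial data\<close>

context vfield_lie_algebra
begin

text \<open>Converse of the explicit untilted solution. The convention \<open>m Iu = \<kappa>\<close> treats \<open>e\<^sub>u\<close> on the same footing as
  the other legs: its factor \<open>1 - \<kappa> B\<close> solves the same equation.\<close>

lemma diagonal_shape_flow:
  assumes e0: "left_invariant_coframe V e0"
    and str: "\<And>a X Y. X \<in> V \<Longrightarrow> Y \<in> V \<Longrightarrow>
      e0 a (bracket X Y) = m a * (e0 Iu X * e0 a Y - e0 Iu Y * e0 a X)"
    and g: "\<And>a t. t \<in> I \<Longrightarrow> (g a has_real_derivative - (\<beta> t * (m a / g Iu t)) * g a t) (at t within I)"
      "\<And>a t. t \<in> I \<Longrightarrow> g a t \<noteq> 0" "g Iu 0 = 1"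
  shows "shape_flow V I \<beta> (\<lambda>t a X. g a t * e0 a X) (\<lambda>t a b. if a = b then m a / g Iu t else 0)"
  unfolding shape_flow_def
proof (intro ballI conjI allI)
  fix t assume t: "t \<in> I"
  have sum: "(\<Sum>b\<in>UNIV. (if a = b then k else 0) * x b) = k * x a" for a k and x :: "frame_index \<Rightarrow> real"
    by (cases a) (simp_all add: sum_frame_index)
  show "left_invariant_coframe V (\<lambda>a X. g a t * e0 a X)"
    by (rule coframe_transform[OF e0, of _ "\<lambda>a b. if a = b then g a t else 0" "\<lambda>a b. if a = b then 1 / g a t else 0"])
      (use g(2)[OF t] in \<open>auto simp: sum\<close>)
  show "(if a = b then m a / g Iu t else 0) = (if b = a then m b / g Iu t else 0)" for a b
    by simp
  fix X assume X: "X \<in> V"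
  show "((\<lambda>s. g a s * e0 a X) has_real_derivative
      - (\<beta> t * (\<Sum>b\<in>UNIV. (if a = b then m a / g Iu t else 0) * (g b t * e0 b X)))) (at t within I)" for a
    using DERIV_cmult_right[OF g(1)[OF t, of a], of "e0 a X"] by (simp add: sum mult.assoc)
  show "(\<Sum>b\<in>UNIV. (if Iu = b then m Iu / g Iu t else 0) * (g b t * e0 b X)) =
      (\<Sum>b\<in>UNIV. (if Iu = b then m Iu / g Iu 0 else 0) * (g b 0 * e0 b X))"
    using g(2)[OF t, of Iu] g(3) by (simp add: sum_frame_index)
  fix Y assume Y: "Y \<in> V"
  show "g a t * e0 a (bracket X Y) = (\<Sum>b\<in>UNIV. (if a = b then m a / g Iu t else 0) *
      (g Iu t * e0 Iu X * (g b t * e0 b Y) - g Iu t * e0 Iu Y * (g b t * e0 b X)))" for a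
    unfolding sum str[OF X Y] using g(2)[OF t, of Iu] by (simp add: field_simps)
  show "(\<Sum>b\<in>UNIV. (if Iu = b then m Iu / g Iu t else 0) * (g b t * e0 b (bracket X Y))) = 0"
    by (simp add: sum_frame_index str[OF X Y])
qed

text \<open>Converse of the explicit tilted solution, for any solution \<open>\<tau>\<close> of the equation of \<open>tan y\<close>. The frame matrix has
  determinant \<open>1\<close>, so \<open>e\<^sub>u \<and> e\<^sub>n\<close> does not depend on time and the structure equations reduce to those
  at time \<open>0\<close>.\<close>

lemma tilted_shape_flow:
  fixes e0 :: "'m vfield frame"
  defines "e \<equiv> \<lambda>\<kappa> l B \<tau>. (\<lambda>a X. case a of
      Iu \<Rightarrow> (1 - \<kappa> * B) * e0 Iu X - l * B * e0 In X
    | Il \<Rightarrow> e0 Il X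
    | In \<Rightarrow> (\<kappa> / l - \<tau> * (1 - \<kappa> * B)) * e0 Iu X + (1 + l * B * \<tau>) * e0 In X)"
  defines "S \<equiv> \<lambda>l \<tau>. (\<lambda>a b. if a = Iu \<and> b = Iu then l * \<tau> else if a = In \<and> b = In then - l * \<tau>
     else if a = Iu \<and> b = In \<or> a = In \<and> b = Iu then l else 0)"
  assumes e0: "left_invariant_coframe V e0" and nz: "l \<noteq> 0"
    and str: "\<And>X Y. X \<in> V \<Longrightarrow> Y \<in> V \<Longrightarrow> e0 Iu (bracket X Y) = l * (e0 Iu X * e0 In Y - e0 Iu Y * e0 In X)"
      "\<And>X Y. X \<in> V \<Longrightarrow> Y \<in> V \<Longrightarrow> e0 Il (bracket X Y) = 0"
      "\<And>X Y. X \<in> V \<Longrightarrow> Y \<in> V \<Longrightarrow> e0 In (bracket X Y) = - \<kappa> * (e0 Iu X * e0 In Y - e0 Iu Y * e0 In X)"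
    and B: "\<And>t. t \<in> I \<Longrightarrow> (B has_real_derivative \<beta> t) (at t within I)" "B 0 = 0"
    and \<tau>: "\<And>t. t \<in> I \<Longrightarrow> (\<tau> has_real_derivative l * \<beta> t * (1 + (\<tau> t)\<^sup>2)) (at t within I)" "\<tau> 0 = \<kappa> / l"
  shows "shape_flow V I \<beta> (\<lambda>t. e \<kappa> l (B t) (\<tau> t)) (\<lambda>t. S l (\<tau> t))"
  unfolding shape_flow_def
proof (intro ballI conjI allI)
  fix t assume t: "t \<in> I"
  let ?e = "e \<kappa> l (B t) (\<tau> t)"
  have fu: "(\<Sum>b\<in>UNIV. S l (\<tau> s) Iu b * e \<kappa> l (B s) (\<tau> s) b X) = \<kappa> * e0 Iu X + l * e0 In X" for s X
    using nz by (simp add: sum_frame_index S_def e_def algebra_simps)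
  define P where "P = (\<lambda>a b. case a of Iu \<Rightarrow> (case b of Iu \<Rightarrow> 1 - \<kappa> * B t | Il \<Rightarrow> 0 | In \<Rightarrow> - l * B t)
     | Il \<Rightarrow> (case b of Iu \<Rightarrow> 0 | Il \<Rightarrow> 1 | In \<Rightarrow> 0)
     | In \<Rightarrow> (case b of Iu \<Rightarrow> \<kappa> / l - \<tau> t * (1 - \<kappa> * B t) | Il \<Rightarrow> 0 | In \<Rightarrow> 1 + l * B t * \<tau> t))"
  define Q where "Q = (\<lambda>a b. case a of Iu \<Rightarrow> (case b of Iu \<Rightarrow> 1 + l * B t * \<tau> t | Il \<Rightarrow> 0 | In \<Rightarrow> l * B t)
     | Il \<Rightarrow> (case b of Iu \<Rightarrow> 0 | Il \<Rightarrow> 1 | In \<Rightarrow> 0)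
     | In \<Rightarrow> (case b of Iu \<Rightarrow> - (\<kappa> / l - \<tau> t * (1 - \<kappa> * B t)) | Il \<Rightarrow> 0 | In \<Rightarrow> 1 - \<kappa> * B t))"
  show "left_invariant_coframe V ?e"
  proof (rule coframe_transform[OF e0, of _ P Q])
    show "?e a X = (\<Sum>b\<in>UNIV. P a b * e0 b X)" for a X
      by (cases a) (simp_all add: e_def P_def sum_frame_index)
    show "(\<Sum>b\<in>UNIV. Q a b * P b c) = (if a = c then 1 else 0)" for a c
      using nz by (cases a; cases c) (simp_all add: P_def Q_def sum_frame_index algebra_simps)
    show "(\<Sum>b\<in>UNIV. P a b * Q b c) = (if a = c then 1 else 0)" for a c
      using nz by (cases a; cases c) (simp_all add: P_def Q_def sum_frame_index algebra_simps)
  qed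
  show "S l (\<tau> t) a b = S l (\<tau> t) b a" for a b
    by (cases a; cases b) (simp_all add: S_def)
  fix X assume X: "X \<in> V"
  show "(\<Sum>b\<in>UNIV. S l (\<tau> t) Iu b * ?e b X) = (\<Sum>b\<in>UNIV. S l (\<tau> 0) Iu b * e \<kappa> l (B 0) (\<tau> 0) b X)"
    by (simp add: fu)
  show "((\<lambda>s. e \<kappa> l (B s) (\<tau> s) a X) has_real_derivative - (\<beta> t * (\<Sum>b\<in>UNIV. S l (\<tau> t) a b * ?e b X))) (at t within I)" for a
  proof (cases a)
    case Iu
    have "((\<lambda>s. (1 - \<kappa> * B s) * e0 Iu X - l * B s * e0 In X) has_real_derivative
        (0 - \<kappa> * \<beta> t) * e0 Iu X - l * \<beta> t * e0 In X) (at t within I)"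
      by (intro DERIV_diff DERIV_cmult_right DERIV_cmult DERIV_const B t)
    then show ?thesis unfolding Iu fu by (simp add: e_def algebra_simps)
  next
    case Il
    then show ?thesis by (simp add: e_def S_def sum_frame_index)
  next
    case In
    have "((\<lambda>s. (\<kappa> / l - \<tau> s * (1 - \<kappa> * B s)) * e0 Iu X + (1 + l * B s * \<tau> s) * e0 In X) has_real_derivative
      (0 - (l * \<beta> t * (1 + (\<tau> t)\<^sup>2) * (1 - \<kappa> * B t) + (0 - \<kappa> * \<beta> t) * \<tau> t)) * e0 Iu X
      + (0 + (l * \<beta> t * \<tau> t + l * \<beta> t * (1 + (\<tau> t)\<^sup>2) * (l * B t))) * e0 In X) (at t within I)"
      by (intro DERIV_add DERIV_diff DERIV_cmult_right DERIV_mult DERIV_cmult DERIV_const B \<tau> t)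
    moreover have "- (\<beta> t * (\<Sum>b\<in>UNIV. S l (\<tau> t) In b * ?e b X)) =
      (0 - (l * \<beta> t * (1 + (\<tau> t)\<^sup>2) * (1 - \<kappa> * B t) + (0 - \<kappa> * \<beta> t) * \<tau> t)) * e0 Iu X
      + (0 + (l * \<beta> t * \<tau> t + l * \<beta> t * (1 + (\<tau> t)\<^sup>2) * (l * B t))) * e0 In X"
      using nz by (simp add: e_def S_def sum_frame_index algebra_simps power2_eq_square)
    ultimately show ?thesis unfolding In by (simp add: e_def)
  qed
  fix Y assume Y: "Y \<in> V"
  define W where "W = e0 Iu X * e0 In Y - e0 Iu Y * e0 In X"
  note W_str = str[OF X Y, folded W_def]
  have W: "?e Iu X * ?e In Y - ?e Iu Y * ?e In X = W"
  proof -
    have det: "((p * x + q * z) * (r * x' + s * z') - (p * x' + q * z') * (r * x + s * z))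
        = (p * s - q * r) * (x * z' - x' * z)" for p q r s x z x' z' :: real
      by (simp add: algebra_simps)
    have "(1 - \<kappa> * B t) * (1 + l * B t * \<tau> t) - (- l * B t) * (\<kappa> / l - \<tau> t * (1 - \<kappa> * B t)) = 1"
      using nz by (simp add: algebra_simps)
    then show ?thesis
      using det[of "1 - \<kappa> * B t" "e0 Iu X" "- l * B t" "e0 In X" "\<kappa> / l - \<tau> t * (1 - \<kappa> * B t)"
          "e0 Iu Y" "1 + l * B t * \<tau> t" "e0 In Y"]
      by (simp add: e_def W_def)
  qed
  show "?e a (bracket X Y) = (\<Sum>b\<in>UNIV. S l (\<tau> t) a b * (?e Iu X * ?e b Y - ?e Iu Y * ?e b X))" for a
  proof (cases a)
    case Iu
    have sum: "(\<Sum>b\<in>UNIV. S l (\<tau> t) a b * (?e Iu X * ?e b Y - ?e Iu Y * ?e b X)) = l * W"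
      by (simp only: sum_frame_index W) (simp add: Iu S_def)
    show ?thesis
      unfolding sum by (simp add: Iu e_def W_str algebra_simps)
  next
    case Il
    then show ?thesis by (simp add: e_def S_def sum_frame_index str X Y)
  next
    case In
    have sum: "(\<Sum>b\<in>UNIV. S l (\<tau> t) a b * (?e Iu X * ?e b Y - ?e Iu Y * ?e b X)) = - l * \<tau> t * W"
      by (simp only: sum_frame_index W) (simp add: In S_def)
    show ?thesis
      using nz unfolding sum by (simp add: In e_def W_str algebra_simps)
  qed
  show "(\<Sum>b\<in>UNIV. S l (\<tau> t) Iu b * ?e b (bracket X Y)) = 0"
    by (simp add: fu str X Y)
qed

end

section \<open>Orthogonal diagonalization and the power factors\<close>

lemma orthogonal_matrix_2_iff:
  fixes Q :: "real^2^2"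
  shows "orthogonal_matrix Q \<longleftrightarrow>
    Q$1$1 * Q$1$1 + Q$2$1 * Q$2$1 = 1 \<and> Q$1$2 * Q$1$2 + Q$2$2 * Q$2$2 = 1 \<and>
    Q$1$1 * Q$1$2 + Q$2$1 * Q$2$2 = 0 \<and>
    Q$1$1 * Q$1$1 + Q$1$2 * Q$1$2 = 1 \<and> Q$2$1 * Q$2$1 + Q$2$2 * Q$2$2 = 1 \<and>
    Q$1$1 * Q$2$1 + Q$1$2 * Q$2$2 = 0"
  by (auto simp: orthogonal_matrix_def vec_eq_iff forall_2 matrix_matrix_mult_def sum_2 mat_def
      transpose_def mult.commute)

definition eig_plus :: "real^2^2 \<Rightarrow> real" where
  "eig_plus \<theta> = (trace \<theta> + sqrt ((trace \<theta>)^2 - 4 * det \<theta>)) / 2"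

definition eig_minus :: "real^2^2 \<Rightarrow> real" where
  "eig_minus \<theta> = (trace \<theta> - sqrt ((trace \<theta>)^2 - 4 * det \<theta>)) / 2"

lemma rho_eig: "rho_plus \<theta> x = eig_plus \<theta> / x" "rho_minus \<theta> x = eig_minus \<theta> / x"
  by (simp_all add: rho_plus_def rho_minus_def eig_plus_def eig_minus_def)

text \<open>The relation \<open>diagonalizes\<close> cleared of its denominator. It shows that one matrix \<open>Q\<close> serves for all
  values of \<open>\<Theta>\<^sub>u\<^sub>u\<close>, as the limit \<open>\<Theta>\<^sub>u\<^sub>u \<rightarrow> 0\<close> requires.\<close>

definition eigenbasis :: "real^2^2 \<Rightarrow> real^2^2 \<Rightarrow> bool" where
  "eigenbasis Q \<theta> \<longleftrightarrow> orthogonal_matrix Q \<and>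
     (\<forall>i j. \<theta>$i$j = eig_plus \<theta> * Q$i$1 * Q$j$1 + eig_minus \<theta> * Q$i$2 * Q$j$2)"

lemma conjugate_diag2:
  "(Q ** diag2 a b ** transpose Q)$i$j = a * Q$i$1 * Q$j$1 + b * Q$i$2 * Q$j$2"
  by (simp add: matrix_matrix_mult_def sum_2 diag2_def transpose_def)

lemma diagonalizes_iff:
  assumes "x \<noteq> 0"
  shows "diagonalizes Q \<theta> x \<longleftrightarrow> eigenbasis Q \<theta>"
proof -
  have "((1 / x) *\<^sub>R \<theta>)$i$j = eig_plus \<theta> / x * Q$i$1 * Q$j$1 + eig_minus \<theta> / x * Q$i$2 * Q$j$2
    \<longleftrightarrow> \<theta>$i$j = eig_plus \<theta> * Q$i$1 * Q$j$1 + eig_minus \<theta> * Q$i$2 * Q$j$2" for i j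
    using assms by (simp add: field_simps)
  then show ?thesis
    by (simp add: diagonalizes_def eigenbasis_def rho_eig vec_eq_iff[of "_ *\<^sub>R _"] conjugate_diag2)
qed

text \<open>The traceless part of \<open>\<theta>\<close> is \<open>s / 2\<close> times a reflection, and \<open>Q\<close> is the rotation by half the angle
  of that reflection. Any angle will do if \<open>s = 0\<close>.\<close>

lemma eigenbasis_exists:
  fixes \<theta> :: "real^2^2"
  assumes sym: "\<theta>$2$1 = \<theta>$1$2"
  obtains Q where "eigenbasis Q \<theta>"
proof -
  define a b d where "a = \<theta>$1$1" and "b = \<theta>$1$2" and "d = \<theta>$2$2"
  define s where "s = sqrt ((trace \<theta>)^2 - 4 * det \<theta>)"
  have disc: "(trace \<theta>)^2 - 4 * det \<theta> = (a - d)\<^sup>2 + (2 * b)\<^sup>2"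
    by (simp add: trace_def sum_2 det_2 sym a_def b_def d_def power2_eq_square algebra_simps)
  have s2: "s\<^sup>2 = (a - d)\<^sup>2 + (2 * b)\<^sup>2" unfolding s_def disc by simp
  have "\<exists>\<psi>. a - d = s * cos \<psi> \<and> 2 * b = s * sin \<psi>"
  proof (cases "s = 0")
    case True
    then have "(a - d)\<^sup>2 + (2 * b)\<^sup>2 = 0" using s2 by simp
    then have "a - d = 0 \<and> 2 * b = 0" by (simp only: sum_power2_eq_zero_iff)
    then show ?thesis using True by simp
  next
    case False
    have "((a - d) / s)\<^sup>2 + (2 * b / s)\<^sup>2 = 1"
      unfolding power_divide add_divide_distrib[symmetric] s2[symmetric] using False by simp
    then obtain \<psi> where "(a - d) / s = cos \<psi>" "2 * b / s = sin \<psi>"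
      using sincos_total_2pi by metis
    then show ?thesis using False by (metis nonzero_mult_div_cancel_left times_divide_eq_right)
  qed
  then obtain \<psi> where \<psi>: "a - d = s * cos \<psi>" "2 * b = s * sin \<psi>" by blast
  define c z where "c = cos (\<psi> / 2)" and "z = sin (\<psi> / 2)"
  have cz: "c * c + z * z = 1" using sin_cos_squared_add2[of "\<psi> / 2"] by (simp add: c_def z_def power2_eq_square)
  have dbl: "cos \<psi> = c * c - z * z" "sin \<psi> = 2 * z * c"
    using cos_double[of "\<psi> / 2"] sin_double[of "\<psi> / 2"] by (simp_all add: c_def z_def power2_eq_square)
  have tr: "trace \<theta> = a + d" by (simp add: trace_def sum_2 a_def d_def)
  have eig: "eig_plus \<theta> = (a + d + s) / 2" "eig_minus \<theta> = (a + d - s) / 2"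
    by (simp_all add: eig_plus_def eig_minus_def s_def tr)
  have "2 * a = (a + d) * (c * c + z * z) + s * (c * c - z * z)"
    "2 * b = s * (2 * z * c)"
    "2 * d = (a + d) * (c * c + z * z) - s * (c * c - z * z)"
    using \<psi> unfolding cz dbl by simp_all
  then have comps: "a = eig_plus \<theta> * c * c + eig_minus \<theta> * z * z"
    "b = eig_plus \<theta> * c * z - eig_minus \<theta> * z * c"
    "d = eig_plus \<theta> * z * z + eig_minus \<theta> * c * c"
    by (simp_all add: eig field_simps)
  define Q :: "real^2^2" where "Q = vector [vector [c, - z], vector [z, c]]"
  have Q: "Q$1$1 = c" "Q$1$2 = - z" "Q$2$1 = z" "Q$2$2 = c" by (simp_all add: Q_def)
  have "orthogonal_matrix Q"
    unfolding orthogonal_matrix_2_iff Q using cz by (simp add: algebra_simps)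
  then have "eigenbasis Q \<theta>"
    using comps sym by (simp add: eigenbasis_def forall_2 Q a_def b_def d_def algebra_simps)
  then show thesis by (rule that)
qed

text \<open>The solution of \<open>g' = - m g / (1 - \<kappa> s)\<close> with \<open>g 0 = 1\<close>. The exponential is its limit for \<open>\<kappa> \<rightarrow> 0\<close>.\<close>

definition flow_factor :: "real \<Rightarrow> real \<Rightarrow> real \<Rightarrow> real" where
  "flow_factor \<kappa> m s = (if \<kappa> = 0 then exp (- m * s) else (1 - \<kappa> * s) powr (m / \<kappa>))"

lemma flow_factor_self: "0 < 1 - \<kappa> * s \<Longrightarrow> flow_factor \<kappa> \<kappa> s = 1 - \<kappa> * s"
  by (simp add: flow_factor_def)

lemma flow_factor_zero: "flow_factor \<kappa> m 0 = 1"
  by (simp add: flow_factor_def)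

lemma flow_factor_pos: "0 < 1 - \<kappa> * s \<Longrightarrow> 0 < flow_factor \<kappa> m s"
  by (simp add: flow_factor_def)

lemma flow_factor_deriv:
  assumes B: "(B has_real_derivative \<beta>) (at t within I)" and pos: "0 < 1 - \<kappa> * B t"
  shows "((\<lambda>t. flow_factor \<kappa> m (B t)) has_real_derivative
    - (\<beta> * (m / (1 - \<kappa> * B t))) * flow_factor \<kappa> m (B t)) (at t within I)"
proof (cases "\<kappa> = 0")
  case True
  have "((\<lambda>t. exp (- m * B t)) has_real_derivative exp (- m * B t) * (- m * \<beta>)) (at t within I)"
    by (intro DERIV_chain2[OF DERIV_exp] DERIV_cmult B)
  then show ?thesis using True by (simp add: flow_factor_def mult_ac)
next
  case False
  have "((\<lambda>s. (1 - \<kappa> * s) powr (m / \<kappa>)) has_real_derivative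
      m / \<kappa> * (1 - \<kappa> * B t) powr (m / \<kappa> - 1) * (0 - \<kappa> * 1)) (at (B t))"
  proof -
    have "((\<lambda>s. 1 - \<kappa> * s) has_real_derivative 0 - \<kappa> * 1) (at (B t))"
      by (intro DERIV_diff DERIV_cmult DERIV_const DERIV_ident)
    from DERIV_fun_powr[OF this pos, of "m / \<kappa>"] show ?thesis by simp
  qed
  from DERIV_chain2[OF this B] have
    "((\<lambda>t. (1 - \<kappa> * B t) powr (m / \<kappa>)) has_real_derivative
      m / \<kappa> * (1 - \<kappa> * B t) powr (m / \<kappa> - 1) * (0 - \<kappa> * 1) * \<beta>) (at t within I)" .
  moreover have "m / \<kappa> * (1 - \<kappa> * B t) powr (m / \<kappa> - 1) * (0 - \<kappa> * 1) * \<beta>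
    = - (\<beta> * (m / (1 - \<kappa> * B t))) * (1 - \<kappa> * B t) powr (m / \<kappa>)"
    using False pos by (simp add: powr_diff)
  ultimately show ?thesis using False by (simp add: flow_factor_def)
qed

text \<open>The logarithm of the base divided by \<open>x\<close> is a difference quotient of \<open>ln (1 - x s)\<close> at \<open>0\<close>.\<close>

lemma flow_factor_tendsto:
  "((\<lambda>x. (1 - x * s) powr (2 * (m / x))) \<longlongrightarrow> (flow_factor 0 m s)\<^sup>2) (at 0)"
proof -
  have "((\<lambda>x. ln (1 - x * s)) has_real_derivative - s) (at 0)"
    by (auto intro!: derivative_eq_intros)
  then have "((\<lambda>x. ln (1 - x * s) / x) \<longlongrightarrow> - s) (at 0)"
    by (simp add: has_field_derivative_iff)
  then have "((\<lambda>x. exp (2 * m * (ln (1 - x * s) / x))) \<longlongrightarrow> exp (2 * m * - s)) (at 0)"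
    by (intro tendsto_intros)
  moreover have "exp (2 * m * - s) = (flow_factor 0 m s)\<^sup>2"
    by (simp add: flow_factor_def power2_eq_square flip: exp_add)
  moreover have "eventually (\<lambda>x. 0 < 1 - x * s) (at 0)"
  proof -
    have "((\<lambda>x. 1 - x * s) \<longlongrightarrow> 1 - 0 * s) (at 0)" by (intro tendsto_intros)
    then show ?thesis by (intro order_tendstoD(1)[of _ "1 - 0 * s"]) simp_all
  qed
  then have "eventually (\<lambda>x. exp (2 * m * (ln (1 - x * s) / x)) = (1 - x * s) powr (2 * (m / x))) (at 0)"
    by eventually_elim (auto simp: powr_def)
  ultimately show ?thesis using tendsto_cong by fastforce
qed

text \<open>The new legs are the columns of \<open>Q\<close>: \<open>(e\<^sub>l, e\<^sub>n) Q\<close>.\<close>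

definition frame_rotation_of :: "real^2^2 \<Rightarrow> frame_index \<Rightarrow> frame_index \<Rightarrow> real" where
  "frame_rotation_of Q = (\<lambda>a b. case a of
      Iu \<Rightarrow> (case b of Iu \<Rightarrow> 1 | Il \<Rightarrow> 0 | In \<Rightarrow> 0)
    | Il \<Rightarrow> (case b of Iu \<Rightarrow> 0 | Il \<Rightarrow> Q$1$1 | In \<Rightarrow> Q$2$1)
    | In \<Rightarrow> (case b of Iu \<Rightarrow> 0 | Il \<Rightarrow> Q$1$2 | In \<Rightarrow> Q$2$2))"

lemma frame_rotation_of_orthogonal:
  assumes "orthogonal_matrix Q"
  shows "frame_rotation (frame_rotation_of Q)"
  unfolding frame_rotation_def
proof (intro conjI allI)
  note Q = assms[unfolded orthogonal_matrix_2_iff]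
  fix a c
  show "frame_rotation_of Q Iu a = (if a = Iu then 1 else 0)"
    "frame_rotation_of Q a Iu = (if a = Iu then 1 else 0)"
    by (cases a; simp add: frame_rotation_of_def)+
  show "(\<Sum>b\<in>UNIV. frame_rotation_of Q a b * frame_rotation_of Q c b) = (if a = c then 1 else 0)"
    using Q by (cases a; cases c) (simp_all add: frame_rotation_of_def sum_frame_index mult.commute)
  show "(\<Sum>b\<in>UNIV. frame_rotation_of Q b a * frame_rotation_of Q b c) = (if a = c then 1 else 0)"
    using Q by (cases a; cases c) (simp_all add: frame_rotation_of_def sum_frame_index mult.commute)
qed

lemma rotate_frame_of:
  "rotate_frame (frame_rotation_of Q) e Iu X = e Iu X"
  "rotate_frame (frame_rotation_of Q) e Il X = Q$1$1 * e Il X + Q$2$1 * e In X"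
  "rotate_frame (frame_rotation_of Q) e In X = Q$1$2 * e Il X + Q$2$2 * e In X"
  by (simp_all add: rotate_frame_def frame_rotation_of_def sum_frame_index)

lemma rotate_shape_of:
  "rotate_shape (frame_rotation_of Q) S Iu Iu = S Iu Iu"
  "rotate_shape (frame_rotation_of Q) S Iu Il = S Iu Il * Q$1$1 + S Iu In * Q$2$1"
  "rotate_shape (frame_rotation_of Q) S Iu In = S Iu Il * Q$1$2 + S Iu In * Q$2$2"
  "rotate_shape (frame_rotation_of Q) S Il Il = Q$1$1 * (S Il Il * Q$1$1 + S Il In * Q$2$1)
     + Q$2$1 * (S In Il * Q$1$1 + S In In * Q$2$1)"
  "rotate_shape (frame_rotation_of Q) S Il In = Q$1$1 * (S Il Il * Q$1$2 + S Il In * Q$2$2)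
     + Q$2$1 * (S In Il * Q$1$2 + S In In * Q$2$2)"
  "rotate_shape (frame_rotation_of Q) S In In = Q$1$2 * (S Il Il * Q$1$2 + S Il In * Q$2$2)
     + Q$2$2 * (S In Il * Q$1$2 + S In In * Q$2$2)"
  by (simp_all add: rotate_shape_def frame_rotation_of_def sum_frame_index algebra_simps)

definition shape_block :: "(frame_index \<Rightarrow> frame_index \<Rightarrow> real) \<Rightarrow> real^2^2" where
  "shape_block S = vector [vector [S Il Il, S Il In], vector [S Il In, S In In]]"

lemma shape_block_entries:
  "shape_block S $ 1 $ 1 = S Il Il" "shape_block S $ 1 $ 2 = S Il In"
  "shape_block S $ 2 $ 1 = S Il In" "shape_block S $ 2 $ 2 = S In In"
  by (simp_all add: shape_block_def)

text \<open>The diagonal of the matrix of an untilted flow in an eigenbasis of \<open>\<theta>\<close>.\<close>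

definition principal_value :: "(frame_index \<Rightarrow> frame_index \<Rightarrow> real) \<Rightarrow> frame_index \<Rightarrow> real" where
  "principal_value S a = (case a of Iu \<Rightarrow> S Iu Iu | Il \<Rightarrow> eig_plus (shape_block S) | In \<Rightarrow> eig_minus (shape_block S))"

lemma rotate_shape_eigenbasis:
  assumes Q: "eigenbasis Q (shape_block S)" and S: "S Iu Il = 0" "S Iu In = 0" "S In Il = S Il In"
  shows "rotate_shape (frame_rotation_of Q) S Iu Il = 0" "rotate_shape (frame_rotation_of Q) S Iu In = 0"
    "rotate_shape (frame_rotation_of Q) S Il In = 0"
    "rotate_shape (frame_rotation_of Q) S a a = principal_value S a"
proof -
  let ?m = "eig_plus (shape_block S)" and ?k = "eig_minus (shape_block S)"
  have orth: "Q$1$1 * Q$1$1 + Q$2$1 * Q$2$1 = 1" "Q$1$2 * Q$1$2 + Q$2$2 * Q$2$2 = 1"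
    "Q$1$1 * Q$1$2 + Q$2$1 * Q$2$2 = 0"
    using Q by (auto simp: eigenbasis_def orthogonal_matrix_2_iff)
  have comps: "S Il Il = ?m * Q$1$1 * Q$1$1 + ?k * Q$1$2 * Q$1$2"
    "S Il In = ?m * Q$1$1 * Q$2$1 + ?k * Q$1$2 * Q$2$2"
    "S In In = ?m * Q$2$1 * Q$2$1 + ?k * Q$2$2 * Q$2$2"
    using Q unfolding eigenbasis_def by (metis shape_block_entries)+
  have form: "(p * (S Il Il * r + S Il In * s) + q * (S In Il * r + S In In * s))
    = ?m * (p * Q$1$1 + q * Q$2$1) * (Q$1$1 * r + Q$2$1 * s) + ?k * (p * Q$1$2 + q * Q$2$2) * (Q$1$2 * r + Q$2$2 * s)"
    for p q r s
    unfolding S(3) comps by (simp add: algebra_simps)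
  show "rotate_shape (frame_rotation_of Q) S Iu Il = 0" "rotate_shape (frame_rotation_of Q) S Iu In = 0"
    by (simp_all add: rotate_shape_of S)
  have orth': "Q$1$2 * Q$1$1 + Q$2$2 * Q$2$1 = 0" using orth(3) by (simp add: mult.commute)
  show "rotate_shape (frame_rotation_of Q) S Il In = 0"
    unfolding rotate_shape_of form orth orth' by simp
  show "rotate_shape (frame_rotation_of Q) S a a = principal_value S a"
    by (cases a; simp only: rotate_shape_of form orth orth' principal_value_def frame_index.case; simp)
qed

lemma eig_sum_prod:
  shows "eig_plus \<theta> + eig_minus \<theta> = trace \<theta>"
    "0 \<le> (trace \<theta>)^2 - 4 * det \<theta> \<Longrightarrow> eig_plus \<theta> * eig_minus \<theta> = det \<theta>"
proof -
  show "eig_plus \<theta> + eig_minus \<theta> = trace \<theta>" by (simp add: eig_plus_def eig_minus_def field_simps)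
  assume nonneg: "0 \<le> (trace \<theta>)^2 - 4 * det \<theta>"
  have "(t + s) / 2 * ((t - s) / 2) = (t\<^sup>2 - s\<^sup>2) / 4" for t s :: real
    by (simp add: power2_eq_square field_simps)
  then show "eig_plus \<theta> * eig_minus \<theta> = det \<theta>"
    using nonneg by (simp add: eig_plus_def eig_minus_def)
qed

section \<open>Reduction to normal form and the evolving metrics\<close>

context spinor_flow_on
begin

lemma rotated: "frame_rotation R \<Longrightarrow>
    spinor_flow_on V I \<beta> B (\<lambda>t. rotate_frame R (e t)) (\<lambda>t. rotate_shape R (S t))"
  using shape_flow_rotate[OF flow] interval B_deriv B_zero
  by (auto simp: spinor_flow_on_def spinor_flow_on_axioms_def vfield_lie_algebra_axioms)

lemma untilted_flow_explicit:
  assumes S0: "S 0 Iu Il = 0" "S 0 Iu In = 0" and Q: "eigenbasis Q (shape_block (S 0))"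
    and t: "t \<in> I" and X: "X \<in> V"
  shows "rotate_frame (frame_rotation_of Q) (e t) a X =
    flow_factor (S 0 Iu Iu) (principal_value (S 0) a) (B t) * rotate_frame (frame_rotation_of Q) (e 0) a X"
proof -
  let ?R = "frame_rotation_of Q" and ?u = "\<lambda>t. 1 - S 0 Iu Iu * B t"
  have R: "frame_rotation ?R" using Q by (simp add: eigenbasis_def frame_rotation_of_orthogonal)
  interpret rot: spinor_flow_on V I \<beta> B "\<lambda>t. rotate_frame ?R (e t)" "\<lambda>t. rotate_shape ?R (S t)"
    by (rule rotated[OF R])
  note rs = rotate_shape_eigenbasis[OF Q S0 shape_flowD(2)[OF flow interval(2)]]
  have pos: "0 < ?u s" if "s \<in> I" for s by (rule eu_factor_pos[OF S0 that])
  show ?thesis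
  proof (cases "a = Iu")
    case True
    then show ?thesis
      using eu_explicit[OF t X] S0
      by (simp add: rotate_frame_of principal_value_def flow_factor_self[OF pos[OF t]] sum_frame_index
          algebra_simps)
  next
    case False
    show ?thesis
      by (rule rot.diagonal_flow_explicit[where g = "\<lambda>a t. flow_factor (S 0 Iu Iu) (principal_value (S 0) a) (B t)"])
        (use rs t X False flow_factor_deriv[OF B_deriv pos] B_zero flow_factor_zero
          flow_factor_pos[OF pos, THEN less_imp_neq] in \<open>auto simp: rotate_shape_of(1)\<close>)
  qed
qed

lemma untilted_metric:
  assumes S0: "S 0 Iu Il = 0" "S 0 Iu In = 0" and Q: "eigenbasis Q (shape_block (S 0))"
    and t: "t \<in> I" and X: "X \<in> V" and Y: "Y \<in> V"
  shows "frame_metric (e t) X Y = (1 - S 0 Iu Iu * B t)\<^sup>2 * (e 0 Iu X * e 0 Iu Y)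
    + (flow_factor (S 0 Iu Iu) (eig_plus (shape_block (S 0))) (B t))\<^sup>2 *
      ((Q$1$1 * e 0 Il X + Q$2$1 * e 0 In X) * (Q$1$1 * e 0 Il Y + Q$2$1 * e 0 In Y))
    + (flow_factor (S 0 Iu Iu) (eig_minus (shape_block (S 0))) (B t))\<^sup>2 *
      ((Q$1$2 * e 0 Il X + Q$2$2 * e 0 In X) * (Q$1$2 * e 0 Il Y + Q$2$2 * e 0 In Y))"
proof -
  let ?R = "frame_rotation_of Q"
  have R: "frame_rotation ?R" using Q by (simp add: eigenbasis_def frame_rotation_of_orthogonal)
  have "frame_metric (e t) X Y = frame_metric (rotate_frame ?R (e t)) X Y"
    by (simp add: frame_metric_rotate[OF R])
  also have "\<dots> = (\<Sum>a\<in>UNIV. (flow_factor (S 0 Iu Iu) (principal_value (S 0) a) (B t))\<^sup>2 *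
      (rotate_frame ?R (e 0) a X * rotate_frame ?R (e 0) a Y))"
    unfolding frame_metric_def tensor_def
    by (rule sum.cong) (simp_all add: untilted_flow_explicit[OF S0 Q t X]
        untilted_flow_explicit[OF S0 Q t Y] power2_eq_square)
  finally show ?thesis
    by (simp add: sum_frame_index principal_value_def rotate_frame_of flow_factor_self[OF eu_factor_pos[OF S0 t]])
qed

text \<open>The rotation turns the vector \<open>(\<Theta>\<^sub>u\<^sub>l, \<Theta>\<^sub>u\<^sub>n)\<close> to \<open>(0, \<lambda>)\<close>. In the rotated frame the trace of \<open>\<theta>\<close> is
  \<open>-\<Theta>\<^sub>u\<^sub>u\<close>, and traces are invariant.\<close>

lemma tilt_rotation:
  fixes l :: real and Q :: "real^2^2"
  defines "l \<equiv> sqrt ((S 0 Iu Il)\<^sup>2 + (S 0 Iu In)\<^sup>2)"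
  defines "Q \<equiv> vector [vector [S 0 Iu In / l, S 0 Iu Il / l], vector [- S 0 Iu Il / l, S 0 Iu In / l]]"
  assumes l: "l \<noteq> 0"
  shows "frame_rotation (frame_rotation_of Q)"
    "rotate_shape (frame_rotation_of Q) (S 0) Iu Iu = S 0 Iu Iu"
    "rotate_shape (frame_rotation_of Q) (S 0) Iu Il = 0"
    "rotate_shape (frame_rotation_of Q) (S 0) Iu In = l"
    "S 0 Il Il + S 0 In In = - S 0 Iu Iu"
    "rotate_frame (frame_rotation_of Q) f Il X = (S 0 Iu In * f Il X - S 0 Iu Il * f In X) / l"
    "rotate_frame (frame_rotation_of Q) f In X = (S 0 Iu Il * f Il X + S 0 Iu In * f In X) / l"
proof -
  have Q: "Q$1$1 = S 0 Iu In / l" "Q$1$2 = S 0 Iu Il / l" "Q$2$1 = - S 0 Iu Il / l" "Q$2$2 = S 0 Iu In / l"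
    by (simp_all add: Q_def)
  have l2: "S 0 Iu Il * S 0 Iu Il + S 0 Iu In * S 0 Iu In = l * l"
    by (simp add: l_def flip: power2_eq_square)
  then have unit: "S 0 Iu Il / l * (S 0 Iu Il / l) + S 0 Iu In / l * (S 0 Iu In / l) = 1"
    using l by (simp flip: add_divide_distrib)
  have orth: "orthogonal_matrix Q"
    unfolding orthogonal_matrix_2_iff Q using unit by (simp add: algebra_simps)
  then show R: "frame_rotation (frame_rotation_of Q)" by (rule frame_rotation_of_orthogonal)
  show "rotate_shape (frame_rotation_of Q) (S 0) Iu Iu = S 0 Iu Iu" by (simp add: rotate_shape_of)
  show ul: "rotate_shape (frame_rotation_of Q) (S 0) Iu Il = 0" by (simp add: rotate_shape_of Q)
  show un: "rotate_shape (frame_rotation_of Q) (S 0) Iu In = l"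
    using l l2 by (simp add: rotate_shape_of Q flip: add_divide_distrib)
  interpret rot: spinor_flow_on V I \<beta> B "\<lambda>t. rotate_frame (frame_rotation_of Q) (e t)"
    "\<lambda>t. rotate_shape (frame_rotation_of Q) (S t)"
    by (rule rotated[OF R])
  have "rotate_shape (frame_rotation_of Q) (S 0) Il Il + rotate_shape (frame_rotation_of Q) (S 0) In In
    = S 0 Il Il * (Q$1$1 * Q$1$1 + Q$1$2 * Q$1$2) + S 0 Il In * (Q$1$1 * Q$2$1 + Q$1$2 * Q$2$2)
      + S 0 In Il * (Q$1$1 * Q$2$1 + Q$1$2 * Q$2$2) + S 0 In In * (Q$2$1 * Q$2$1 + Q$2$2 * Q$2$2)"
    by (simp add: rotate_shape_of algebra_simps)
  also have "\<dots> = S 0 Il Il + S 0 In In"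
    using orth[unfolded orthogonal_matrix_2_iff] by simp
  finally show "S 0 Il Il + S 0 In In = - S 0 Iu Iu"
    using rot.tilted_shape_initial[OF ul] un l by (simp add: rotate_shape_of(1))
  show "rotate_frame (frame_rotation_of Q) f Il X = (S 0 Iu In * f Il X - S 0 Iu Il * f In X) / l"
    "rotate_frame (frame_rotation_of Q) f In X = (S 0 Iu Il * f Il X + S 0 Iu In * f In X) / l"
    by (simp_all add: rotate_frame_of Q add_divide_distrib diff_divide_distrib)
qed

text \<open>The solution in the rotated frame, expressed in the original one: \<open>w / l\<close> and \<open>v / l\<close> are the rotated
  forms \<open>e\<^sub>n\<close> and \<open>e\<^sub>l\<close> at time \<open>0\<close>.\<close>

lemma tilted_metric:
  fixes t :: real
  defines "\<kappa> \<equiv> S 0 Iu Iu" and "l \<equiv> sqrt ((S 0 Iu Il)\<^sup>2 + (S 0 Iu In)\<^sup>2)"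
  defines "y \<equiv> l * B t + arctan (\<kappa> / l)"
  defines "w \<equiv> \<lambda>X. S 0 Iu Il * e 0 Il X + S 0 Iu In * e 0 In X"
    and "v \<equiv> \<lambda>X. S 0 Iu In * e 0 Il X - S 0 Iu Il * e 0 In X"
  assumes l: "l \<noteq> 0" and t: "t \<in> I"
  shows "\<bar>y\<bar> < pi / 2"
    and "X \<in> V \<Longrightarrow> Y \<in> V \<Longrightarrow> frame_metric (e t) X Y =
      ((1 - \<kappa> * B t)\<^sup>2 * (sec y)\<^sup>2 + \<kappa>\<^sup>2 / l\<^sup>2 - 2 * \<kappa> / l * (1 - \<kappa> * B t) * tan y) * (e 0 Iu X * e 0 Iu Y)
      + (\<kappa> / l - l * B t * (sec y)\<^sup>2 * (1 - \<kappa> * B t) - tan y * (1 - 2 * \<kappa> * B t)) / l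
          * (e 0 Iu X * w Y + w X * e 0 Iu Y)
      + v X * v Y / l\<^sup>2
      + (1 + l\<^sup>2 * (B t)\<^sup>2 * (sec y)\<^sup>2 + 2 * l * B t * tan y) * (w X * w Y) / l\<^sup>2"
proof -
  define Q :: "real^2^2" where
    "Q = vector [vector [S 0 Iu In / l, S 0 Iu Il / l], vector [- S 0 Iu Il / l, S 0 Iu In / l]]"
  let ?R = "frame_rotation_of Q"
  note tilt = tilt_rotation[folded l_def, folded Q_def, OF l, folded \<kappa>_def]
  interpret rot: spinor_flow_on V I \<beta> B "\<lambda>t. rotate_frame ?R (e t)" "\<lambda>t. rotate_shape ?R (S t)"
    by (rule rotated[OF tilt(1)])
  note expl = rot.tilted_flow_explicit[OF tilt(3), unfolded tilt(2,4), OF l t, folded y_def]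
  show y: "\<bar>y\<bar> < pi / 2" by (rule expl(1))
  then have "- (pi / 2) < y" "y < pi / 2" by linarith+
  then have "cos y \<noteq> 0" using cos_gt_zero_pi[of y] by simp
  then have sec: "(sec y)\<^sup>2 = 1 + (tan y)\<^sup>2"
    using tan_sec[of y] by (simp add: sec_def inverse_eq_divide)
  assume XY: "X \<in> V" "Y \<in> V"
  define r where "r = \<kappa> / l - tan y * (1 - \<kappa> * B t)"
  define s where "s = 1 + l * B t * tan y"
  have "frame_metric (e t) X Y = frame_metric (rotate_frame ?R (e t)) X Y"
    by (simp add: frame_metric_rotate[OF tilt(1)])
  also have "\<dots> = ((1 - \<kappa> * B t) * e 0 Iu X - l * B t * (w X / l)) * ((1 - \<kappa> * B t) * e 0 Iu Y - l * B t * (w Y / l))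
     + v X / l * (v Y / l) + (r * e 0 Iu X + s * (w X / l)) * (r * e 0 Iu Y + s * (w Y / l))"
  proof -
    have "rotate_frame ?R (e t) Iu Z = (1 - \<kappa> * B t) * e 0 Iu Z - l * B t * (w Z / l)"
      "rotate_frame ?R (e t) Il Z = v Z / l"
      "rotate_frame ?R (e t) In Z = r * e 0 Iu Z + s * (w Z / l)" if "Z \<in> V" for Z
      using expl(2-4)[OF that] unfolding rotate_frame_of(1) tilt(6,7) w_def v_def r_def s_def .
    then show ?thesis using XY by (simp add: frame_metric_def tensor_def sum_frame_index)
  qed
  also have "\<dots> = ((1 - \<kappa> * B t)\<^sup>2 + r\<^sup>2) * (e 0 Iu X * e 0 Iu Y)
     + (r * s - (1 - \<kappa> * B t) * (l * B t)) / l * (e 0 Iu X * w Y + w X * e 0 Iu Y)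
     + v X * v Y / l\<^sup>2 + ((l * B t)\<^sup>2 + s\<^sup>2) * (w X * w Y) / l\<^sup>2"
  proof -
    have "(a * x - b * (p / l)) * (a * x' - b * (p' / l)) + q / l * (q' / l) + (r * x + s * (p / l)) * (r * x' + s * (p' / l))
      = (a\<^sup>2 + r\<^sup>2) * (x * x') + (r * s - a * b) / l * (x * p' + p * x') + q * q' / l\<^sup>2 + (b\<^sup>2 + s\<^sup>2) * (p * p') / l\<^sup>2"
      for a b x x' p p' q q' :: real
      using l by (simp add: field_simps power2_eq_square)
    then show ?thesis .
  qed
  also have "(1 - \<kappa> * B t)\<^sup>2 + r\<^sup>2 = (1 - \<kappa> * B t)\<^sup>2 * (sec y)\<^sup>2 + \<kappa>\<^sup>2 / l\<^sup>2 - 2 * \<kappa> / l * (1 - \<kappa> * B t) * tan y"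
    unfolding r_def sec
    by (simp add: power2_eq_square algebra_simps add_divide_distrib diff_divide_distrib)
  also have "r * s - (1 - \<kappa> * B t) * (l * B t)
      = \<kappa> / l - l * B t * (sec y)\<^sup>2 * (1 - \<kappa> * B t) - tan y * (1 - 2 * \<kappa> * B t)"
    using l unfolding r_def s_def sec by (simp add: power2_eq_square algebra_simps)
  also have "(l * B t)\<^sup>2 + s\<^sup>2 = 1 + l\<^sup>2 * (B t)\<^sup>2 * (sec y)\<^sup>2 + 2 * l * B t * tan y"
    unfolding s_def sec by (simp add: power2_eq_square algebra_simps)
  finally show "frame_metric (e t) X Y =
      ((1 - \<kappa> * B t)\<^sup>2 * (sec y)\<^sup>2 + \<kappa>\<^sup>2 / l\<^sup>2 - 2 * \<kappa> / l * (1 - \<kappa> * B t) * tan y) * (e 0 Iu X * e 0 Iu Y)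
      + (\<kappa> / l - l * B t * (sec y)\<^sup>2 * (1 - \<kappa> * B t) - tan y * (1 - 2 * \<kappa> * B t)) / l
          * (e 0 Iu X * w Y + w X * e 0 Iu Y)
      + v X * v Y / l\<^sup>2
      + (1 + l\<^sup>2 * (B t)\<^sup>2 * (sec y)\<^sup>2 + 2 * l * B t * tan y) * (w X * w Y) / l\<^sup>2" .
qed

end

lemma metric1_eq:
  "metric1 e \<theta> Q x s X Y = (1 - x * s)\<^sup>2 * (e Iu X * e Iu Y)
    + (1 - x * s) powr (2 * rho_plus \<theta> x) *
      ((Q$1$1 * e Il X + Q$2$1 * e In X) * (Q$1$1 * e Il Y + Q$2$1 * e In Y))
    + (1 - x * s) powr (2 * rho_minus \<theta> x) *
      ((Q$1$2 * e Il X + Q$2$2 * e In X) * (Q$1$2 * e Il Y + Q$2$2 * e In Y))"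
proof -
  have "(vector [p, q] :: real^2) \<bullet> ((Q ** diag2 a b ** transpose Q) *v vector [r, z]) =
    a * ((Q$1$1 * p + Q$2$1 * q) * (Q$1$1 * r + Q$2$1 * z))
    + b * ((Q$1$2 * p + Q$2$2 * q) * (Q$1$2 * r + Q$2$2 * z))" for a b p q r z
    by (simp add: inner_vec_def matrix_vector_mult_def sum_2 conjugate_diag2 algebra_simps)
  then show ?thesis by (simp add: metric1_def tensor_def)
qed

context spinor_flow_on
begin

lemma untilted_metric1:
  assumes S0: "S 0 Iu Il = 0" "S 0 Iu In = 0" and \<kappa>: "S 0 Iu Iu \<noteq> 0"
    and Q: "diagonalizes Q (shape_block (S 0)) (S 0 Iu Iu)" and t: "t \<in> I" and XY: "X \<in> V" "Y \<in> V"
  shows "frame_metric (e t) X Y = metric1 (e 0) (shape_block (S 0)) Q (S 0 Iu Iu) (B t) X Y"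
proof -
  have pos: "0 < 1 - S 0 Iu Iu * B t" by (rule eu_factor_pos[OF S0 t])
  have "(flow_factor (S 0 Iu Iu) m (B t))\<^sup>2 = (1 - S 0 Iu Iu * B t) powr (2 * (m / S 0 Iu Iu))" for m
    using \<kappa> pos by (simp add: flow_factor_def power2_eq_square flip: powr_add)
  then show ?thesis
    using untilted_metric[OF S0 _ t XY, of Q] Q unfolding diagonalizes_iff[OF \<kappa>]
    by (simp add: metric1_eq rho_eig)
qed

lemma untilted_metric1_limit:
  assumes S0: "S 0 Iu Il = 0" "S 0 Iu In = 0" and \<kappa>: "S 0 Iu Iu = 0"
    and Q: "eigenbasis Q (shape_block (S 0))" and t: "t \<in> I" and XY: "X \<in> V" "Y \<in> V"
  shows "((\<lambda>x. metric1 (e 0) (shape_block (S 0)) Q x (B t) X Y) \<longlongrightarrow> frame_metric (e t) X Y) (at 0)"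
proof -
  have "((\<lambda>x. (1 - x * B t)\<^sup>2) \<longlongrightarrow> (1 - 0 * B t)\<^sup>2) (at 0)"
    by (intro tendsto_intros)
  then show ?thesis
    unfolding metric1_eq rho_eig untilted_metric[OF S0 Q t XY] \<kappa>
    by (intro tendsto_add tendsto_mult_right flow_factor_tendsto) simp
qed

lemma tilted_metric2:
  fixes t :: real
  defines "\<kappa> \<equiv> S 0 Iu Iu" and "l \<equiv> sqrt ((S 0 Iu Il)\<^sup>2 + (S 0 Iu In)\<^sup>2)"
  defines "y \<equiv> l * B t + arctan (\<kappa> / l)"
  assumes t: "t \<in> I" and XY: "X \<in> V" "Y \<in> V"
  shows "S 0 Iu Il = 0 \<Longrightarrow> S 0 Iu In \<noteq> 0 \<Longrightarrow>
      frame_metric (e t) X Y = metric2 (e 0) Il In \<kappa> (S 0 Iu In) l (B t) y X Y"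
    "S 0 Iu Il \<noteq> 0 \<Longrightarrow> S 0 Iu In = 0 \<Longrightarrow>
      frame_metric (e t) X Y = metric2 (e 0) In Il \<kappa> (S 0 Iu Il) l (B t) y X Y"
proof -
  define c where "c = \<kappa> / l - l * B t * (sec y)\<^sup>2 * (1 - \<kappa> * B t) - tan y * (1 - 2 * \<kappa> * B t)"
  note metric = tilted_metric(2)[OF _ t XY, folded l_def, folded \<kappa>_def, folded y_def, folded c_def]
  \<comment> \<open>the tilt points along the leg \<open>j\<close>; \<open>\<sigma>\<close> may be negative while \<open>l = \<bar>\<sigma>\<bar>\<close>\<close>
  have aligned: "frame_metric (e t) X Y = metric2 (e 0) i j \<kappa> \<sigma> l (B t) y X Y"
    if l2: "l\<^sup>2 = \<sigma>\<^sup>2" and \<sigma>: "\<sigma> \<noteq> 0"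
      and w: "\<And>X. S 0 Iu Il * e 0 Il X + S 0 Iu In * e 0 In X = \<sigma> * e 0 j X"
      and v: "(S 0 Iu In * e 0 Il X - S 0 Iu Il * e 0 In X) * (S 0 Iu In * e 0 Il Y - S 0 Iu Il * e 0 In Y)
        = \<sigma>\<^sup>2 * (e 0 i X * e 0 i Y)" for i j \<sigma>
  proof -
    have nz: "l \<noteq> 0" using l2 \<sigma> by auto
    have "l = \<sigma> \<or> l = - \<sigma>" using l2 by (simp add: power2_eq_iff)
    then have c: "c / l * \<sigma> = \<kappa> / \<sigma> - \<sigma> * B t * (sec y)\<^sup>2 * (1 - \<kappa> * B t) - l / \<sigma> * tan y * (1 - 2 * \<kappa> * B t)"
      using \<sigma> unfolding c_def by (elim disjE) (simp_all add: field_simps)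
    have mixed: "c / l * (x * (\<sigma> * z) + \<sigma> * x' * z') = c / l * \<sigma> * (x * z + x' * z')" for x z x' z'
      by (simp only: distrib_left mult_ac)
    have square: "p * (\<sigma> * x * (\<sigma> * z)) / l\<^sup>2 = p * (x * z)" "\<sigma>\<^sup>2 * x / l\<^sup>2 = x" for p x z
      using \<sigma> unfolding l2 by (simp_all add: power2_eq_square)
    show ?thesis
      unfolding metric[OF nz] metric2_def odot_def tensor_def w v mixed square c by simp
  qed
  show "frame_metric (e t) X Y = metric2 (e 0) Il In \<kappa> (S 0 Iu In) l (B t) y X Y"
    if "S 0 Iu Il = 0" "S 0 Iu In \<noteq> 0"
    by (rule aligned) (use that in \<open>simp_all add: l_def power2_eq_square\<close>)
  show "frame_metric (e t) X Y = metric2 (e 0) In Il \<kappa> (S 0 Iu Il) l (B t) y X Y"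
    if "S 0 Iu Il \<noteq> 0" "S 0 Iu In = 0"
    by (rule aligned) (use that in \<open>simp_all add: l_def power2_eq_square\<close>)
qed

text \<open>Since \<open>v \<otimes> v + w \<otimes> w = l\<^sup>2 (e\<^sub>l \<otimes> e\<^sub>l + e\<^sub>n \<otimes> e\<^sub>n)\<close>, only the part of the coefficient of \<open>w \<otimes> w\<close> beyond the
  Euclidean one survives as a multiple \<open>K\<close> of \<open>w \<otimes> w\<close>.\<close>

lemma tilted_metric3:
  fixes t :: real
  defines "T \<equiv> S 0 Il Il + S 0 In In" and "l \<equiv> sqrt ((S 0 Iu Il)\<^sup>2 + (S 0 Iu In)\<^sup>2)"
  defines "y \<equiv> l * B t + arctan (S 0 Iu Iu / l)"
  assumes l: "l \<noteq> 0" and t: "t \<in> I" and XY: "X \<in> V" "Y \<in> V"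
  shows "frame_metric (e t) X Y = metric3 (e 0) T (S 0 Iu Il) (S 0 Iu In) l (B t) y X Y"
proof -
  define wl wn where "wl = S 0 Iu Il" and "wn = S 0 Iu In"
  define w v where "w = (\<lambda>X. wl * e 0 Il X + wn * e 0 In X)" and "v = (\<lambda>X. wn * e 0 Il X - wl * e 0 In X)"
  have T: "S 0 Iu Iu = - T" using tilt_rotation(5)[folded l_def, OF l] by (simp add: T_def)
  have l2: "wl * wl + wn * wn = l\<^sup>2" by (simp add: l_def wl_def wn_def flip: power2_eq_square)
  have "\<bar>y\<bar> < pi / 2" unfolding y_def l_def by (rule tilted_metric(1)) (use l t l_def in auto)
  then have "- (pi / 2) < y" "y < pi / 2" by linarith+
  then have cos: "cos y \<noteq> 0" using cos_gt_zero_pi[of y] by simp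
  then have sec: "(sec y)\<^sup>2 = 1 + (tan y)\<^sup>2"
    using tan_sec[of y] by (simp add: sec_def inverse_eq_divide)
  have sin2: "(sec y)\<^sup>2 * sin (2 * y) = 2 * tan y"
    using cos by (simp add: sec_def sin_double tan_def power2_eq_square)
  define s \<tau> K where "s = B t" and "\<tau> = tan y" and "K = s * (s * (sec y)\<^sup>2 + 2 * \<tau> / l)"
  have mixed: "s * (sec y)\<^sup>2 * (s + sin (2 * y) / l) = K"
  proof -
    have "s * (sec y)\<^sup>2 * (s + sin (2 * y) / l) = s * (s * (sec y)\<^sup>2 + (sec y)\<^sup>2 * sin (2 * y) / l)"
      by (simp add: algebra_simps)
    then show ?thesis by (simp add: sin2 K_def \<tau>_def)
  qed
  have K: "1 + l\<^sup>2 * s\<^sup>2 * (sec y)\<^sup>2 + 2 * l * s * \<tau> = 1 + K * l\<^sup>2"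
    using l by (simp add: K_def field_simps power2_eq_square)
  have perp: "v X * v Y / l\<^sup>2 + (1 + K * l\<^sup>2) * (w X * w Y) / l\<^sup>2
    = e 0 Il X * e 0 Il Y + e 0 In X * e 0 In Y + K * (w X * w Y)"
  proof -
    have "v X * v Y + w X * w Y = l\<^sup>2 * (e 0 Il X * e 0 Il Y + e 0 In X * e 0 In Y)"
      unfolding l2[symmetric] by (simp add: v_def w_def algebra_simps)
    moreover have "v X * v Y / l\<^sup>2 + (1 + K * l\<^sup>2) * (w X * w Y) / l\<^sup>2
      = (v X * v Y + w X * w Y) / l\<^sup>2 + K * (w X * w Y)"
      using l by (simp add: field_simps)
    ultimately show ?thesis using l by simp
  qed
  have uu: "(1 - - T * s)\<^sup>2 * (sec y)\<^sup>2 + (- T)\<^sup>2 / l\<^sup>2 - 2 * - T / l * (1 - - T * s) * \<tau>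
    = (1 + T * s)\<^sup>2 + (\<tau> * (1 + T * s) + T / l)\<^sup>2"
    unfolding sec \<tau>_def[symmetric] by (simp add: power2_eq_square algebra_simps add_divide_distrib)
  define N where "N = T / l\<^sup>2 + \<tau> / l * (1 + 2 * T * s) + s * (1 + T * s) * (sec y)\<^sup>2"
  have un: "(- T / l - l * s * (sec y)\<^sup>2 * (1 - - T * s) - \<tau> * (1 - 2 * - T * s)) / l
    = - N"
    unfolding N_def using l by (simp add: field_simps power2_eq_square)
  have "frame_metric (e t) X Y =
      ((1 + T * s)\<^sup>2 + (\<tau> * (1 + T * s) + T / l)\<^sup>2) * (e 0 Iu X * e 0 Iu Y)
      - N * (e 0 Iu X * w Y + w X * e 0 Iu Y)
      + (e 0 Il X * e 0 Il Y + e 0 In X * e 0 In Y + K * (w X * w Y))"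
    using tilted_metric(2)[folded l_def, OF l t XY, folded y_def, folded wl_def wn_def, folded s_def \<tau>_def,
        unfolded T, folded w_def v_def, unfolded uu un K] perp
    by (simp add: w_def v_def)
  also have "\<dots> = metric3 (e 0) T wl wn l (B t) y X Y"
  proof -
    have ll: "p\<^sup>2 * s * (s * (sec y)\<^sup>2 + 2 * \<tau> / l) = p\<^sup>2 * K" for p
      by (simp only: K_def mult.assoc)
    have ln: "wl * wn * s * (sec y)\<^sup>2 * (s + sin (2 * y) / l) = wl * wn * K"
      unfolding mixed[symmetric] by (simp only: mult.assoc)
    have "U * (e 0 Iu X * e 0 Iu Y) - N * (e 0 Iu X * w Y + w X * e 0 Iu Y)
        + (e 0 Il X * e 0 Il Y + e 0 In X * e 0 In Y + K * (w X * w Y))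
      = U * (e 0 Iu X * e 0 Iu Y)
        - N * (wl * (e 0 Iu X * e 0 Il Y + e 0 Il X * e 0 Iu Y) + wn * (e 0 Iu X * e 0 In Y + e 0 In X * e 0 Iu Y))
        + (1 + wl\<^sup>2 * K) * (e 0 Il X * e 0 Il Y) + wl * wn * K * (e 0 Il X * e 0 In Y + e 0 In X * e 0 Il Y)
        + (1 + wn\<^sup>2 * K) * (e 0 In X * e 0 In Y)" for U N
      by (simp add: w_def power2_eq_square algebra_simps)
    then show ?thesis
      unfolding metric3_def odot_def tensor_def s_def[symmetric] \<tau>_def[symmetric] ll ln N_def[symmetric] .
  qed
  finally show ?thesis by (simp add: wl_def wn_def)
qed

end

section \<open>Brackets of dual bases and the underlying groups\<close>

lemma (in vfield_lie_algebra) coframe_combination_bij: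
  assumes e: "left_invariant_coframe V e" and E: "\<And>a. E a \<in> V"
    "\<And>a b. e b (E a) = (if a = b then 1 else 0)"
  shows "bij_betw (\<lambda>(a, b, c). combination3 a b c (E Iu) (E Il) (E In)) UNIV V"
proof -
  let ?f = "\<lambda>(a, b, c). combination3 a b c (E Iu) (E Il) (E In)"
  have comb: "e d (combination3 a b c (E Iu) (E Il) (E In)) = (case d of Iu \<Rightarrow> a | Il \<Rightarrow> b | In \<Rightarrow> c)"
    for a b c d
    using coframe_linear[OF e, of d] E
    by (cases d) (simp_all add: linear_form_add linear_form_scale add_closed scale_closed)
  have closed: "combination3 a b c (E Iu) (E Il) (E In) \<in> V" for a b c
    using E(1) by (simp add: add_closed scale_closed)
  show ?thesis
  proof (rule bij_betw_byWitness[where f' = "\<lambda>X. (e Iu X, e Il X, e In X)"])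
    show "\<forall>x\<in>UNIV. (e Iu (?f x), e Il (?f x), e In (?f x)) = x"
      by (auto simp: comb)
    show "\<forall>X\<in>V. ?f (e Iu X, e Il X, e In X) = X"
    proof
      fix X assume X: "X \<in> V"
      have "combination3 (e Iu X) (e Il X) (e In X) (E Iu) (E Il) (E In) = X"
      proof (rule coframe_eqI[OF e closed X])
        show "e a (combination3 (e Iu X) (e Il X) (e In X) (E Iu) (E Il) (E In)) = e a X" for a
          unfolding comb by (cases a) simp_all
      qed
      then show "?f (e Iu X, e Il X, e In X) = X" by simp
    qed
    show "?f ` UNIV \<subseteq> V" using closed by auto
  qed simp
qed

text \<open>The values of the coframe on the bracket of two dual basis vectors are the coordinates of that
  bracket in the dual basis.\<close>

lemma basis_of_diagonal_coframe:
  assumes "vfield_lie_algebra (lie_algebra G A)"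
    and e: "left_invariant_coframe (lie_algebra G A) e"
    and str: "\<And>X Y. X \<in> lie_algebra G A \<Longrightarrow> Y \<in> lie_algebra G A \<Longrightarrow> e Iu (bracket X Y) = 0"
      "\<And>X Y. X \<in> lie_algebra G A \<Longrightarrow> Y \<in> lie_algebra G A \<Longrightarrow>
        e Il (bracket X Y) = p * (e Iu X * e Il Y - e Iu Y * e Il X)"
      "\<And>X Y. X \<in> lie_algebra G A \<Longrightarrow> Y \<in> lie_algebra G A \<Longrightarrow>
        e In (bracket X Y) = q * (e Iu X * e In Y - e Iu Y * e In X)"
  shows "\<exists>X1 X2 X3. lie_algebra_basis G A X1 X2 X3 \<and> bracket X1 X2 = scale_field p X2 \<and>
    bracket X1 X3 = scale_field q X3 \<and> bracket X2 X3 = zero_field"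
proof -
  interpret vfield_lie_algebra "lie_algebra G A" by fact
  obtain E where E: "\<And>a. E a \<in> lie_algebra G A" "\<And>a b. e b (E a) = (if a = b then 1 else 0)"
    by (rule coframe_dual_basis[OF e]) blast
  have eqI: "bracket (E a) (E b) = X"
    if "X \<in> lie_algebra G A" "\<And>c. e c (bracket (E a) (E b)) = e c X" for a b X
    by (rule coframe_eqI[OF e bracket_closed[OF E(1) E(1)] that(1)]) (rule that(2))
  have e_scale: "e c (scale_field r (E a)) = r * (if a = c then 1 else 0)" for c r a
    using linear_form_scale[OF coframe_linear[OF e] E(1)] by (simp add: E(2))
  have e_zero: "e c zero_field = 0" for c
    using linear_form_zero[OF coframe_linear[OF e] E(1)] .
  have "bracket (E Iu) (E Il) = scale_field p (E Il)"
  proof (rule eqI)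
    show "e c (bracket (E Iu) (E Il)) = e c (scale_field p (E Il))" for c
      by (cases c) (simp_all add: str E e_scale)
  qed (simp add: scale_closed E)
  moreover have "bracket (E Iu) (E In) = scale_field q (E In)"
  proof (rule eqI)
    show "e c (bracket (E Iu) (E In)) = e c (scale_field q (E In))" for c
      by (cases c) (simp_all add: str E e_scale)
  qed (simp add: scale_closed E)
  moreover have "bracket (E Il) (E In) = zero_field"
  proof (rule eqI)
    show "e c (bracket (E Il) (E In)) = e c zero_field" for c
      by (cases c) (simp_all add: str E e_zero)
  qed (rule zero_closed[OF E(1)])
  moreover have "lie_algebra_basis G A (E Iu) (E Il) (E In)"
    unfolding lie_algebra_basis_def using coframe_combination_bij[of e E, OF e E(1) E(2)] .
  ultimately show ?thesis by blast
qed

text \<open>Dividing \<open>E\<^sub>u\<close> by \<open>c\<close> and choosing the order of the two eigenlegs normalizes the brackets.\<close>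

lemma basis_of_rescaled_diagonal_coframe:
  assumes V: "vfield_lie_algebra (lie_algebra G A)"
    and e: "left_invariant_coframe (lie_algebra G A) e"
    and str: "\<And>X Y. X \<in> lie_algebra G A \<Longrightarrow> Y \<in> lie_algebra G A \<Longrightarrow> e Iu (bracket X Y) = 0"
      "\<And>a X Y. a \<noteq> Iu \<Longrightarrow> X \<in> lie_algebra G A \<Longrightarrow> Y \<in> lie_algebra G A \<Longrightarrow>
        e a (bracket X Y) = m a * (e Iu X * e a Y - e Iu Y * e a X)"
    and c: "c \<noteq> 0" and ab: "a \<noteq> Iu" "b \<noteq> Iu" "a \<noteq> b"
  shows "\<exists>X1 X2 X3. lie_algebra_basis G A X1 X2 X3 \<and> bracket X1 X2 = scale_field (m a / c) X2 \<and>
    bracket X1 X3 = scale_field (m b / c) X3 \<and> bracket X2 X3 = zero_field"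
proof -
  interpret vfield_lie_algebra "lie_algebra G A" by fact
  define f where "f = (\<lambda>i. case i of Iu \<Rightarrow> (\<lambda>X. c * e Iu X) | Il \<Rightarrow> e a | In \<Rightarrow> e b)"
  define P where "P = (\<lambda>i j. case i of Iu \<Rightarrow> (if j = Iu then c else 0)
    | Il \<Rightarrow> (if j = a then 1 else 0) | In \<Rightarrow> (if j = b then 1 else 0))"
  define Q where "Q = (\<lambda>i j. if i = Iu then (if j = Iu then 1 / c else 0)
    else if i = a then (if j = Il then 1 else 0) else (if j = In then 1 else 0))"
  have ab': "a = Il \<and> b = In \<or> a = In \<and> b = Il"
    using ab by (cases a; cases b) simp_all
  have f: "left_invariant_coframe (lie_algebra G A) f"
  proof (rule coframe_transform[OF e, of _ P Q])
    show "f i X = (\<Sum>j\<in>UNIV. P i j * e j X)" for i X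
      using ab' by (elim disjE conjE; cases i) (simp_all add: f_def P_def sum_frame_index)
    show "(\<Sum>j\<in>UNIV. Q i j * P j k) = (if i = k then 1 else 0)" for i k
      using ab' c by (elim disjE conjE; cases i; cases k) (simp_all add: P_def Q_def sum_frame_index)
    show "(\<Sum>j\<in>UNIV. P i j * Q j k) = (if i = k then 1 else 0)" for i k
      using ab' c by (elim disjE conjE; cases i; cases k) (simp_all add: P_def Q_def sum_frame_index)
  qed
  show ?thesis
    by (rule basis_of_diagonal_coframe[OF V f])
      (use c in \<open>simp_all add: f_def str ab field_simps\<close>)
qed

text \<open>With the number \<open>l = \<Theta>\<^sub>u\<^sub>n\<close>, the basis is \<open>- E\<^sub>n / l\<close>, \<open>l E\<^sub>u - \<kappa> E\<^sub>n\<close>, \<open>E\<^sub>l\<close>: the second vector spans the derived algebra and the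
  third one is central. The coframe \<open>f\<close> is dual to this basis.\<close>

lemma basis_of_tilted_coframe:
  assumes V: "vfield_lie_algebra (lie_algebra G A)"
    and e: "left_invariant_coframe (lie_algebra G A) e" and nz: "l \<noteq> 0"
    and str: "\<And>X Y. X \<in> lie_algebra G A \<Longrightarrow> Y \<in> lie_algebra G A \<Longrightarrow>
        e Iu (bracket X Y) = l * (e Iu X * e In Y - e Iu Y * e In X)"
      "\<And>X Y. X \<in> lie_algebra G A \<Longrightarrow> Y \<in> lie_algebra G A \<Longrightarrow> e Il (bracket X Y) = 0"
      "\<And>X Y. X \<in> lie_algebra G A \<Longrightarrow> Y \<in> lie_algebra G A \<Longrightarrow>
        e In (bracket X Y) = - \<kappa> * (e Iu X * e In Y - e Iu Y * e In X)"
  shows "\<exists>X1 X2 X3. lie_algebra_basis G A X1 X2 X3 \<and> bracket X1 X2 = X2 \<and>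
    bracket X1 X3 = zero_field \<and> bracket X2 X3 = zero_field"
proof -
  interpret vfield_lie_algebra "lie_algebra G A" by fact
  define f where "f = (\<lambda>i X. case i of Iu \<Rightarrow> - \<kappa> * e Iu X - l * e In X | Il \<Rightarrow> e Iu X / l | In \<Rightarrow> e Il X)"
  define P where "P = (\<lambda>i j. case i of Iu \<Rightarrow> (case j of Iu \<Rightarrow> - \<kappa> | Il \<Rightarrow> 0 | In \<Rightarrow> - l)
    | Il \<Rightarrow> (case j of Iu \<Rightarrow> 1 / l | Il \<Rightarrow> 0 | In \<Rightarrow> 0) | In \<Rightarrow> (case j of Iu \<Rightarrow> 0 | Il \<Rightarrow> 1 | In \<Rightarrow> 0))"
  define Q where "Q = (\<lambda>i j. case i of Iu \<Rightarrow> (case j of Iu \<Rightarrow> 0 | Il \<Rightarrow> l | In \<Rightarrow> 0)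
    | Il \<Rightarrow> (case j of Iu \<Rightarrow> 0 | Il \<Rightarrow> 0 | In \<Rightarrow> 1) | In \<Rightarrow> (case j of Iu \<Rightarrow> - 1 / l | Il \<Rightarrow> - \<kappa> | In \<Rightarrow> 0))"
  have f: "left_invariant_coframe (lie_algebra G A) f"
  proof (rule coframe_transform[OF e, of _ P Q])
    show "f i X = (\<Sum>j\<in>UNIV. P i j * e j X)" for i X
      by (cases i) (simp_all add: f_def P_def sum_frame_index)
    show "(\<Sum>j\<in>UNIV. Q i j * P j k) = (if i = k then 1 else 0)" for i k
      using nz by (cases i; cases k) (simp_all add: P_def Q_def sum_frame_index)
    show "(\<Sum>j\<in>UNIV. P i j * Q j k) = (if i = k then 1 else 0)" for i k
      using nz by (cases i; cases k) (simp_all add: P_def Q_def sum_frame_index)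
  qed
  have "\<exists>X1 X2 X3. lie_algebra_basis G A X1 X2 X3 \<and> bracket X1 X2 = scale_field 1 X2 \<and>
    bracket X1 X3 = scale_field 0 X3 \<and> bracket X2 X3 = zero_field"
  proof (rule basis_of_diagonal_coframe[OF V f])
    fix X Y assume XY: "X \<in> lie_algebra G A" "Y \<in> lie_algebra G A"
    show "f Iu (bracket X Y) = 0" by (simp add: f_def str[OF XY])
    show "f Il (bracket X Y) = 1 * (f Iu X * f Il Y - f Iu Y * f Il X)"
      using nz by (simp add: f_def str[OF XY] field_simps)
    show "f In (bracket X Y) = 0 * (f Iu X * f In Y - f Iu Y * f In X)"
      by (simp add: f_def str[OF XY])
  qed
  then show ?thesis by (simp add: scale_field_def[of 0] zero_field_def)
qed

context spinor_flow_on
begin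

lemma diagonal_structure:
  assumes S0: "S 0 Iu Il = 0" "S 0 Iu In = 0" and Q: "eigenbasis Q (shape_block (S 0))"
    and XY: "X \<in> V" "Y \<in> V"
  defines "f \<equiv> rotate_frame (frame_rotation_of Q) (e 0)"
  shows "f a (bracket X Y) = principal_value (S 0) a * (f Iu X * f a Y - f Iu Y * f a X)"
proof -
  let ?S = "rotate_shape (frame_rotation_of Q) (S 0)"
  have R: "frame_rotation (frame_rotation_of Q)" using Q by (simp add: eigenbasis_def frame_rotation_of_orthogonal)
  note D = shape_flowD[OF shape_flow_rotate[OF flow R] interval(2)]
  note rs = rotate_shape_eigenbasis[OF Q S0 shape_flowD(2)[OF flow interval(2)]]
  have "?S a b = (if a = b then principal_value (S 0) a else 0)" for b
    using rs(1-3) D(2)[of Il Iu] D(2)[of In Iu] D(2)[of In Il]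
    by (cases a; cases b) (simp_all add: rs(4))
  then show ?thesis
    using D(4)[OF XY, of a] by (cases a) (simp_all add: f_def sum_frame_index)
qed

lemma rotated_coframe:
  assumes "frame_rotation R" "t \<in> I"
  shows "left_invariant_coframe V (rotate_frame R (e t))"
  by (rule shape_flowD(1)[OF shape_flow_rotate[OF flow assms(1)] assms(2)])

lemma tilted_structure:
  fixes l :: real and Q :: "real^2^2"
  defines "l \<equiv> sqrt ((S 0 Iu Il)\<^sup>2 + (S 0 Iu In)\<^sup>2)"
  defines "Q \<equiv> vector [vector [S 0 Iu In / l, S 0 Iu Il / l], vector [- S 0 Iu Il / l, S 0 Iu In / l]]"
  defines "f \<equiv> rotate_frame (frame_rotation_of Q) (e 0)"
  assumes l: "l \<noteq> 0" and XY: "X \<in> V" "Y \<in> V"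
  shows "f Iu (bracket X Y) = l * (f Iu X * f In Y - f Iu Y * f In X)"
    "f Il (bracket X Y) = 0"
    "f In (bracket X Y) = - S 0 Iu Iu * (f Iu X * f In Y - f Iu Y * f In X)"
proof -
  let ?S = "rotate_shape (frame_rotation_of Q) (S 0)"
  note tilt = tilt_rotation[folded l_def, folded Q_def, OF l]
  interpret rot: spinor_flow_on V I \<beta> B "\<lambda>t. rotate_frame (frame_rotation_of Q) (e t)"
    "\<lambda>t. rotate_shape (frame_rotation_of Q) (S t)"
    by (rule rotated[OF tilt(1)])
  note D = shape_flowD[OF rot.flow interval(2)]
  have "?S Iu In \<noteq> 0" using tilt(4) l by simp
  note init = rot.tilted_shape_initial[OF tilt(3) this]
  have "?S In Iu = l" using D(2)[of In Iu] tilt(4) by simp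
  then show "f Iu (bracket X Y) = l * (f Iu X * f In Y - f Iu Y * f In X)"
    "f Il (bracket X Y) = 0"
    "f In (bracket X Y) = - S 0 Iu Iu * (f Iu X * f In Y - f Iu Y * f In X)"
    using D(4)[OF XY] init tilt(2-4) by (simp_all add: f_def sum_frame_index)
qed

end

text \<open>With the eigenvalues \<open>m\<close> and \<open>k\<close> of \<open>\<theta>\<close> one has \<open>[E\<^sub>u, E\<^sub>l] = m E\<^sub>l\<close> and \<open>[E\<^sub>u, E\<^sub>n] = k E\<^sub>n\<close>. Dividing \<open>E\<^sub>u\<close> by
  the eigenvalue of larger modulus puts the ratio of the eigenvalues in \<open>[-1, 1]\<close>.\<close>

lemma untilted_group:
  fixes G :: "'g::{t2_space, second_countable_topology} monoid" and A :: "('g, 'e::euclidean_space) chart set"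
  assumes G: "simply_connected_lie_group G A"
    and flow: "spinor_flow_on (lie_algebra G A) I \<beta> B e S"
    and S0: "S 0 Iu Il = 0" "S 0 Iu In = 0"
  defines "\<theta> \<equiv> shape_block (S 0)"
  shows "\<theta> = 0 \<Longrightarrow> is_R3 G A"
    "trace \<theta> = 0 \<Longrightarrow> \<theta> \<noteq> 0 \<Longrightarrow> is_E11 G A"
    "trace \<theta> \<noteq> 0 \<Longrightarrow> det \<theta> = 0 \<Longrightarrow> is_tau2_R G A"
    "trace \<theta> \<noteq> 0 \<Longrightarrow> det \<theta> \<noteq> 0 \<Longrightarrow> \<exists>\<mu>. is_tau3 \<mu> G A"
proof -
  interpret spinor_flow_on "lie_algebra G A" I \<beta> B e S by (rule flow)
  note V = vfield_lie_algebra_axioms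
  have sym: "\<theta>$2$1 = \<theta>$1$2" by (simp add: \<theta>_def shape_block_entries)
  obtain Q where Q: "eigenbasis Q \<theta>" using eigenbasis_exists[OF sym] by blast
  define f where "f = rotate_frame (frame_rotation_of Q) (e 0)"
  have cof: "left_invariant_coframe (lie_algebra G A) f"
    unfolding f_def using Q by (intro rotated_coframe interval(2) frame_rotation_of_orthogonal) (simp add: eigenbasis_def)
  note str = diagonal_structure[OF S0 Q[unfolded \<theta>_def], folded f_def]
  have str_u: "f Iu (bracket X Y) = 0" if "X \<in> lie_algebra G A" "Y \<in> lie_algebra G A" for X Y
    using str[OF that, of Iu] by simp
  have str': "f a (bracket X Y) = principal_value (S 0) a * (f Iu X * f a Y - f Iu Y * f a X)"
    if "a \<noteq> Iu" "X \<in> lie_algebra G A" "Y \<in> lie_algebra G A" for a X Y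
    by (rule str[OF that(2,3)])
  note rescaled = basis_of_rescaled_diagonal_coframe[where e = f and m = "principal_value (S 0)",
      OF V cof str_u str']
  define m k where "m = eig_plus \<theta>" and "k = eig_minus \<theta>"
  have mk: "principal_value (S 0) Il = m" "principal_value (S 0) In = k"
    by (simp_all add: principal_value_def m_def k_def \<theta>_def)
  have "0 \<le> (\<theta>$1$1 - \<theta>$2$2)\<^sup>2 + 4 * (\<theta>$1$2)\<^sup>2" by simp
  also have "\<dots> = (trace \<theta>)^2 - 4 * det \<theta>"
    by (simp add: trace_def sum_2 det_2 sym power2_eq_square algebra_simps)
  finally have eig: "m + k = trace \<theta>" "m * k = det \<theta>"
    unfolding m_def k_def using eig_sum_prod by blast+
  have zero_iff: "\<theta> = 0" if "m = 0" "k = 0"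
    using Q that by (simp add: eigenbasis_def m_def k_def vec_eq_iff)
  have basis: "\<exists>X1 X2 X3. lie_algebra_basis G A X1 X2 X3 \<and> bracket X1 X2 = scale_field (m / c) X2 \<and>
      bracket X1 X3 = scale_field (k / c) X3 \<and> bracket X2 X3 = zero_field" if "c \<noteq> 0" for c
    using rescaled[where c = c and a = Il and b = In] that by (simp add: mk)
  have basis': "\<exists>X1 X2 X3. lie_algebra_basis G A X1 X2 X3 \<and> bracket X1 X2 = scale_field (k / c) X2 \<and>
      bracket X1 X3 = scale_field (m / c) X3 \<and> bracket X2 X3 = zero_field" if "c \<noteq> 0" for c
    using rescaled[where c = c and a = In and b = Il] that by (simp add: mk)
  have scale_zero: "scale_field 0 X = zero_field" for X :: "'g vfield"
    by (simp add: scale_field_def zero_field_def)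
  show "is_R3 G A" if "\<theta> = 0"
  proof -
    have "m = 0" "k = 0" using that by (simp_all add: m_def k_def eig_plus_def eig_minus_def trace_def det_2)
    then show ?thesis using basis[of 1] G by (simp add: is_R3_def scale_zero)
  qed
  show "is_E11 G A" if "trace \<theta> = 0" "\<theta> \<noteq> 0"
  proof -
    have "k = - m" using eig(1) that(1) by simp
    moreover from this have "m \<noteq> 0" using zero_iff that(2) by auto
    ultimately show ?thesis using basis[of m] G by (simp add: is_E11_def)
  qed
  show "is_tau2_R G A" if "trace \<theta> \<noteq> 0" "det \<theta> = 0"
  proof (cases "m = 0")
    case True
    then have "k \<noteq> 0" using eig(1) that(1) by simp
    then show ?thesis using basis'[of k] G True by (simp add: is_tau2_R_def scale_zero)
  next
    case False
    then have "k = 0" using eig(2) that(2) by simp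
    then show ?thesis using basis[of m] G False by (simp add: is_tau2_R_def scale_zero)
  qed
  show "\<exists>\<mu>. is_tau3 \<mu> G A" if "trace \<theta> \<noteq> 0" "det \<theta> \<noteq> 0"
  proof (cases "\<bar>k\<bar> \<le> \<bar>m\<bar>")
    case True
    have "m \<noteq> 0" "k \<noteq> 0" using eig(2) that(2) by auto
    then have "is_tau3 (k / m) G A" using basis[of m] G True by (simp add: is_tau3_def)
    then show ?thesis ..
  next
    case False
    have "m \<noteq> 0" "k \<noteq> 0" using eig(2) that(2) by auto
    then have "is_tau3 (m / k) G A" using basis'[of k] G False by (simp add: is_tau3_def)
    then show ?thesis ..
  qed
qed

lemma tilted_group:
  fixes G :: "'g::{t2_space, second_countable_topology} monoid" and A :: "('g, 'e::euclidean_space) chart set"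
  assumes G: "simply_connected_lie_group G A"
    and flow: "spinor_flow_on (lie_algebra G A) I \<beta> B e S"
    and nz: "sqrt ((S 0 Iu Il)\<^sup>2 + (S 0 Iu In)\<^sup>2) \<noteq> 0"
  shows "is_tau2_R G A"
proof -
  interpret spinor_flow_on "lie_algebra G A" I \<beta> B e S by (rule flow)
  note cof = rotated_coframe[OF tilt_rotation(1)[OF nz] interval(2)]
  note str = tilted_structure[OF nz]
  show ?thesis
    unfolding is_tau2_R_def
    using G basis_of_tilted_coframe[OF vfield_lie_algebra_axioms cof nz str] by blast
qed

section \<open>Smoothness and integrals on the time axis\<close>

text \<open>Smoothness on the line, stratified by order. The functions of interest solve differential
  equations with smooth right-hand sides, and induction on the order (\<open>times_differentiable_ode\<close>) shows
  that they are smooth without differentiating explicit formulas repeatedly.\<close>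

primrec times_differentiable :: "nat \<Rightarrow> (real \<Rightarrow> real) \<Rightarrow> bool" where
  "times_differentiable 0 f = True"
| "times_differentiable (Suc n) f =
     (\<exists>f'. (\<forall>t. (f has_real_derivative f' t) (at t)) \<and> times_differentiable n f')"

lemma times_differentiable_SucD: "times_differentiable (Suc n) f \<Longrightarrow> times_differentiable n f"
proof (induction n arbitrary: f)
  case (Suc n)
  then show ?case by (metis times_differentiable.simps(2))
qed simp

lemma times_differentiable_Suc_deriv:
  assumes "times_differentiable (Suc n) f"
  shows "(f has_real_derivative deriv f t) (at t)" "times_differentiable n (deriv f)"
proof -
  obtain f' where f': "\<And>t. (f has_real_derivative f' t) (at t)" "times_differentiable n f'"
    using assms by auto
  have "f' = deriv f" using DERIV_imp_deriv[OF f'(1)] by auto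
  then show "(f has_real_derivative deriv f t) (at t)" "times_differentiable n (deriv f)"
    using f' by auto
qed

lemma smooth_on_UNIV_iff: "smooth_on_interval UNIV f \<longleftrightarrow> (\<forall>n. times_differentiable n f)"
proof
  assume "smooth_on_interval UNIV f"
  then obtain D where D: "D 0 = f" "\<And>k t. (D k has_real_derivative D (Suc k) t) (at t)"
    unfolding smooth_on_interval_def by auto
  have "times_differentiable n (D k)" for n k
    by (induction n arbitrary: k) (use D(2) in auto)
  then show "\<forall>n. times_differentiable n f" using D(1) by metis
next
  assume f: "\<forall>n. times_differentiable n f"
  have "\<forall>n. times_differentiable n ((deriv ^^ k) f)" for k
  proof (induction k)
    case (Suc k)
    then show ?case by (auto dest: times_differentiable_Suc_deriv(2)[of _ "(deriv ^^ k) f"])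
  qed (use f in simp)
  then have "((deriv ^^ k) f has_real_derivative (deriv ^^ Suc k) f t) (at t)" for k t
    using times_differentiable_Suc_deriv(1)[of 0 "(deriv ^^ k) f" t] by (metis funpow.simps(2) o_apply)
  then show "smooth_on_interval UNIV f"
    unfolding smooth_on_interval_def by (intro exI[of _ "\<lambda>k. (deriv ^^ k) f"]) simp
qed

lemma times_differentiable_const: "times_differentiable n (\<lambda>t. c)"
proof (induction n arbitrary: c)
  case (Suc n)
  then show ?case by (auto intro!: exI[of _ "\<lambda>t. 0"])
qed simp

lemma times_differentiable_add:
  "times_differentiable n f \<Longrightarrow> times_differentiable n g \<Longrightarrow> times_differentiable n (\<lambda>t. f t + g t)"
proof (induction n arbitrary: f g)
  case (Suc n)
  then obtain f' g' where "\<And>t. (f has_real_derivative f' t) (at t)" "times_differentiable n f'"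
    "\<And>t. (g has_real_derivative g' t) (at t)" "times_differentiable n g'" by auto
  then show ?case
    using Suc.IH by (auto intro!: exI[of _ "\<lambda>t. f' t + g' t"] DERIV_add)
qed simp

lemma times_differentiable_mult:
  "times_differentiable n f \<Longrightarrow> times_differentiable n g \<Longrightarrow> times_differentiable n (\<lambda>t. f t * g t)"
proof (induction n arbitrary: f g)
  case (Suc n)
  then obtain f' g' where d: "\<And>t. (f has_real_derivative f' t) (at t)" "times_differentiable n f'"
    "\<And>t. (g has_real_derivative g' t) (at t)" "times_differentiable n g'" by auto
  have "times_differentiable n (\<lambda>t. f' t * g t + g' t * f t)"
    using Suc.IH d Suc.prems[THEN times_differentiable_SucD] times_differentiable_add by blast
  then show ?case
    using d(1,3) by (auto intro!: exI[of _ "\<lambda>t. f' t * g t + g' t * f t"] DERIV_mult)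
qed simp

lemma times_differentiable_diff:
  assumes "times_differentiable n f" "times_differentiable n g"
  shows "times_differentiable n (\<lambda>t. f t - g t)"
  using times_differentiable_add[OF assms(1)
      times_differentiable_mult[OF times_differentiable_const[of n "-1"] assms(2)]] by simp

lemmas times_differentiable_intros =
  times_differentiable_const times_differentiable_add times_differentiable_mult times_differentiable_diff

lemma times_differentiable_ode:
  assumes "\<And>t. (f has_real_derivative F t) (at t)"
    and "\<And>n. times_differentiable n f \<Longrightarrow> times_differentiable n F"
  shows "times_differentiable n f"
proof (induction n)
  case (Suc n)
  then show ?case using assms by auto
qed simp

lemma lapse_integral_zero: "lapse_integral \<beta> 0 = 0"
  by (simp add: lapse_integral_def zero_ereal_def)

text \<open>The fundamental theorem of calculus applies on compact intervals. Near \<open>t\<close> the interval \<open>I\<close> agrees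
  with a compact subinterval that contains \<open>0\<close> and \<open>t\<close>; the sets \<open>U\<close> and \<open>W\<close> are the neighbourhoods that cut
  \<open>I\<close> down to it on the left and on the right.\<close>

lemma lapse_integral_deriv:
  assumes I: "is_interval I" "0 \<in> I" and cont: "continuous_on I \<beta>" and t: "t \<in> I"
  shows "(lapse_integral \<beta> has_real_derivative \<beta> t) (at t within I)"
proof -
  obtain a U where a: "a \<in> I" "a \<le> min 0 t" "open U" "t \<in> U" "\<And>x. x \<in> I \<Longrightarrow> x \<in> U \<Longrightarrow> a \<le> x"
  proof (cases "\<exists>a\<in>I. a < min 0 t")
    case True
    then obtain a where "a \<in> I" "a < min 0 t" by blast
    then show thesis by (intro that[of a "{a<..}"]) simp_all
  next
    case False
    have "min 0 t \<in> I" using I t by (auto simp: min_def)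
    moreover have "min 0 t \<le> x" if "x \<in> I" for x using False that linorder_not_le by blast
    ultimately show thesis by (intro that[of "min 0 t" UNIV]) simp_all
  qed
  obtain b W where b: "b \<in> I" "max 0 t \<le> b" "open W" "t \<in> W" "\<And>x. x \<in> I \<Longrightarrow> x \<in> W \<Longrightarrow> x \<le> b"
  proof (cases "\<exists>b\<in>I. max 0 t < b")
    case True
    then obtain b where "b \<in> I" "max 0 t < b" by blast
    then show thesis by (intro that[of b "{..<b}"]) simp_all
  next
    case False
    have "max 0 t \<in> I" using I t by (auto simp: max_def)
    moreover have "x \<le> max 0 t" if "x \<in> I" for x using False that linorder_not_le by blast
    ultimately show thesis by (intro that[of "max 0 t" UNIV]) simp_all
  qed
  have sub: "{a..b} \<subseteq> I"
    using I(1) a(1) b(1) by (meson atLeastAtMost_iff is_interval_1 subsetI)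
  have eq: "at t within I = at t within {a..b}"
    by (rule at_within_nhd[of t "U \<inter> W"]) (use a b sub in auto)
  have "((\<lambda>u. LBINT y=0..u. \<beta> y) has_vector_derivative \<beta> t) (at t within {a..b})"
    unfolding zero_ereal_def
    by (rule interval_integral_FTC2) (use a b continuous_on_subset[OF cont sub] in auto)
  then show ?thesis
    unfolding eq by (simp add: lapse_integral_def[abs_def] has_real_derivative_iff_has_vector_derivative)
qed

text \<open>The integral is the supremum of the strictly increasing values \<open>F n\<close>, so a bound on it is a strict
  bound on every \<open>F t\<close>.\<close>

lemma nn_integral_half_line_le_iff:
  fixes f F :: "real \<Rightarrow> real"
  assumes F: "\<And>x. (F has_real_derivative f x) (at x)" and pos: "\<And>x. 0 < f x"
    and cont: "continuous_on UNIV f" and F0: "F 0 = 0" and C: "0 < C"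
  shows "(\<integral>\<^sup>+x\<in>{0..}. ennreal (f x) \<partial>lborel) \<le> ennreal C \<longleftrightarrow> (\<forall>t\<ge>0. F t < C)"
proof -
  have meas: "f \<in> borel_measurable borel" by (rule borel_measurable_continuous_onI[OF cont])
  have mono: "F s < F t" if "s < t" for s t
    by (rule DERIV_pos_imp_increasing[OF that]) (use F pos in blast)
  show ?thesis
  proof
    assume le: "(\<integral>\<^sup>+x\<in>{0..}. ennreal (f x) \<partial>lborel) \<le> ennreal C"
    show "\<forall>t\<ge>0. F t < C"
    proof (intro allI impI)
      fix t :: real assume t: "0 \<le> t"
      \<comment> \<open>the step from \<open>t\<close> to \<open>t + 1\<close> makes the inequality strict\<close>
      have "ennreal (F (t + 1) - F 0) = (\<integral>\<^sup>+x. ennreal (f x) * indicator {0..t+1} x \<partial>lborel)"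
        by (rule nn_integral_FTC_Icc[symmetric])
          (use F pos t meas in \<open>auto intro: less_imp_le has_field_derivative_at_within\<close>)
      also have "\<dots> \<le> (\<integral>\<^sup>+x\<in>{0..}. ennreal (f x) \<partial>lborel)"
        by (intro nn_integral_mono) (auto split: split_indicator)
      also note le
      finally have "F (t + 1) \<le> C" using C F0 by (simp add: ennreal_le_iff)
      then show "F t < C" using mono[of t "t + 1"] by simp
    qed
  next
    assume less: "\<forall>t\<ge>0. F t < C"
    have "(\<integral>\<^sup>+x\<in>{0..}. ennreal (f x) \<partial>lborel) = (SUP n::nat. \<integral>\<^sup>+x. ennreal (f x) * indicator {0..real n} x \<partial>lborel)"
    proof -
      have "(\<integral>\<^sup>+x\<in>{0..}. ennreal (f x) \<partial>lborel)
        = (\<integral>\<^sup>+x. (SUP n::nat. ennreal (f x) * indicator {0..real n} x) \<partial>lborel)"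
      proof (rule nn_integral_cong)
        fix x :: real
        show "ennreal (f x) * indicator {0..} x = (SUP n::nat. ennreal (f x) * indicator {0..real n} x)"
        proof (cases "0 \<le> x")
          case True
          obtain n where "x \<le> real n" using real_arch_simple by blast
          then have "(SUP n::nat. ennreal (f x) * indicator {0..real n} x) = ennreal (f x)"
            using True by (intro antisym SUP_least SUP_upper2[of n]) (auto split: split_indicator)
          then show ?thesis using True by simp
        qed simp
      qed
      also have "\<dots> = (SUP n::nat. \<integral>\<^sup>+x. ennreal (f x) * indicator {0..real n} x \<partial>lborel)"
        by (rule nn_integral_monotone_convergence_SUP)
          (use meas in \<open>auto simp: incseq_def le_fun_def split: split_indicator\<close>)
      finally show ?thesis .
    qed
    also have "\<dots> \<le> ennreal C"
    proof (rule SUP_least)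
      fix n :: nat
      have "(\<integral>\<^sup>+x. ennreal (f x) * indicator {0..real n} x \<partial>lborel) = ennreal (F (real n) - F 0)"
        by (rule nn_integral_FTC_Icc)
          (use F pos meas in \<open>auto intro: less_imp_le has_field_derivative_at_within\<close>)
      also have "\<dots> \<le> ennreal C" using less F0 by (intro ennreal_leI) (simp add: less_imp_le)
      finally show "(\<integral>\<^sup>+x. ennreal (f x) * indicator {0..real n} x \<partial>lborel) \<le> ennreal C" .
    qed
    finally show "(\<integral>\<^sup>+x\<in>{0..}. ennreal (f x) \<partial>lborel) \<le> ennreal C" .
  qed
qed

text \<open>Only one time direction matters: in the other one \<open>\<kappa> B\<close> is not positive. Negative \<open>\<kappa>\<close> is
  reduced to positive \<open>\<kappa>\<close> by reversing time.\<close>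

lemma lapse_criterion:
  fixes b B :: "real \<Rightarrow> real"
  assumes B: "\<And>x. (B has_real_derivative b x) (at x)" and pos: "\<And>x. 0 < b x"
    and cont: "continuous_on UNIV b" and B0: "B 0 = 0"
  shows "(\<integral>\<^sup>+x\<in>{x. 0 \<le> \<kappa> * x}. ennreal (b x) \<partial>lborel) \<le> 1 / ennreal \<bar>\<kappa>\<bar> \<longleftrightarrow> (\<forall>t. \<kappa> * B t < 1)"
proof -
  have mono: "B s < B t" if "s < t" for s t
    by (rule DERIV_pos_imp_increasing[OF that]) (use B pos in blast)
  consider "\<kappa> = 0" | "0 < \<kappa>" | "\<kappa> < 0" by linarith
  then show ?thesis
  proof cases
    case 1
    then show ?thesis by (simp add: divide_ennreal_def)
  next
    case 2
    have inv: "1 / ennreal \<bar>\<kappa>\<bar> = ennreal (1 / \<kappa>)"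
      using 2 by (simp add: divide_ennreal flip: ennreal_1)
    have set: "{x. 0 \<le> \<kappa> * x} = {0..}" using 2 by (auto simp: zero_le_mult_iff)
    have "B t < 1 / \<kappa> \<longleftrightarrow> \<kappa> * B t < 1" for t using 2 by (simp add: field_simps)
    moreover have "\<kappa> * B t < 1" if "t < 0" for t
      using mono[OF that] B0 2 mult_pos_neg[of \<kappa> "B t"] by simp
    ultimately have "(\<forall>t\<ge>0. B t < 1 / \<kappa>) \<longleftrightarrow> (\<forall>t. \<kappa> * B t < 1)"
      using linorder_not_le by blast
    then show ?thesis
      unfolding inv set using nn_integral_half_line_le_iff[OF B pos cont B0, of "1 / \<kappa>"] 2 by simp
  next
    case 3
    have inv: "1 / ennreal \<bar>\<kappa>\<bar> = ennreal (1 / - \<kappa>)"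
      using 3 by (simp add: divide_ennreal flip: ennreal_1)
    have "{x. 0 \<le> \<kappa> * x} = {..0}" using 3 by (auto simp: zero_le_mult_iff)
    then have "(\<integral>\<^sup>+x\<in>{x. 0 \<le> \<kappa> * x}. ennreal (b x) \<partial>lborel) = (\<integral>\<^sup>+x. ennreal (b x) * indicator {..0} x \<partial>lborel)"
      by simp
    also have "\<dots> = (\<integral>\<^sup>+x. ennreal (b (- x)) * indicator {..0} (- x) \<partial>lborel)"
    proof -
      have [measurable]: "b \<in> borel_measurable borel" by (rule borel_measurable_continuous_onI[OF cont])
      show ?thesis
        using nn_integral_real_affine[of "\<lambda>x. ennreal (b x) * indicator {..0} x" "-1" 0] by simp
    qed
    also have "\<dots> = (\<integral>\<^sup>+x\<in>{0..}. ennreal (b (- x)) \<partial>lborel)"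
      by (intro nn_integral_cong) (simp split: split_indicator)
    finally have int: "(\<integral>\<^sup>+x\<in>{x. 0 \<le> \<kappa> * x}. ennreal (b x) \<partial>lborel) = \<dots>" .
    have B': "((\<lambda>x. - B (- x)) has_real_derivative b (- x)) (at x)" for x
      using DERIV_minus[OF DERIV_chain2[OF B[of "- x"] DERIV_minus[OF DERIV_ident]]] by simp
    have "- B (- t) < 1 / - \<kappa> \<longleftrightarrow> \<kappa> * B (- t) < 1" for t using 3 by (simp add: field_simps)
    moreover have "\<kappa> * B t < 1" if "t > 0" for t
      using mono[OF that] B0 3 mult_neg_pos[of \<kappa> "B t"] by simp
    ultimately have "(\<forall>t\<ge>0. - B (- t) < 1 / - \<kappa>) \<longleftrightarrow> (\<forall>t. \<kappa> * B t < 1)"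
      by (metis linorder_not_le minus_minus neg_0_le_iff_le)
    moreover have "continuous_on UNIV (\<lambda>x. b (- x))"
      by (rule continuous_on_compose2[OF cont]) (auto intro!: continuous_intros)
    ultimately show ?thesis
      unfolding int inv using nn_integral_half_line_le_iff[of "\<lambda>x. - B (- x)" "\<lambda>x. b (- x)" "1 / - \<kappa>"]
        B' pos B0 3 by simp
  qed
qed

section \<open>Global existence\<close>

text \<open>The derivative at \<open>0\<close> of the frame determines \<open>S\<^sub>0\<close>, and \<open>0\<close> is a limit point of the smaller interval.\<close>

lemma initial_shape_unique:
  assumes I: "is_interval I" "0 \<in> I" "I \<noteq> {0}" and \<beta>: "\<beta> 0 \<noteq> 0" "b 0 = \<beta> 0"
    and V: "vfield_lie_algebra V"
    and flow: "shape_flow V I \<beta> e S" and flow': "shape_flow V UNIV b e' S'"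
    and eq: "\<And>t a X. t \<in> I \<Longrightarrow> X \<in> V \<Longrightarrow> e' t a X = e t a X"
  shows "S' 0 = S 0"
proof (intro ext)
  fix a c
  interpret vfield_lie_algebra V by (rule V)
  obtain E where E: "\<And>a. E a \<in> V" "\<And>a b. e 0 b (E a) = (if a = b then 1 else 0)"
    by (rule coframe_dual_basis[OF shape_flowD(1)[OF flow I(2)]]) blast
  have E': "e' 0 b (E a) = (if a = b then 1 else 0)" for a b using eq[OF I(2) E(1)] E(2) by simp
  have "((\<lambda>s. e' s a (E c)) has_real_derivative - (b 0 * (\<Sum>d\<in>UNIV. S' 0 a d * e' 0 d (E c)))) (at 0 within I)"
    by (rule DERIV_subset[OF shape_flowD(3)[OF flow' UNIV_I E(1)]]) simp
  then have "((\<lambda>s. e s a (E c)) has_real_derivative - (b 0 * (\<Sum>d\<in>UNIV. S' 0 a d * e' 0 d (E c)))) (at 0 within I)"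
    by (rule has_field_derivative_transform_within[where d = 1]) (use I eq E(1) in auto)
  moreover have "((\<lambda>s. e s a (E c)) has_real_derivative - (\<beta> 0 * (\<Sum>d\<in>UNIV. S 0 a d * e 0 d (E c)))) (at 0 within I)"
    by (rule shape_flowD(3)[OF flow I(2) E(1)])
  ultimately have "- (b 0 * (\<Sum>d\<in>UNIV. S' 0 a d * e' 0 d (E c))) = - (\<beta> 0 * (\<Sum>d\<in>UNIV. S 0 a d * e 0 d (E c)))"
    unfolding has_real_derivative_iff_has_vector_derivative
    by (rule vector_derivative_unique_within[OF interval_within_nontrivial[OF I I(2)]])
  then show "S' 0 a c = S 0 a c"
    using \<beta> by (cases c) (simp_all add: sum_frame_index E(2) E')
qed

text \<open>A flow on the line in the rotated frame that extends the rotated flow is rotated back.\<close>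

lemma globally_definedI:
  assumes V: "vfield_lie_algebra (lie_algebra G A)"
    and b: "smooth_on_interval UNIV b" "\<And>t. 0 < b t"
    and flow: "shape_flow (lie_algebra G A) UNIV b f S" and R: "frame_rotation R"
    and smooth: "\<And>a X n. times_differentiable n (\<lambda>t. f t a X)"
    and eq: "\<And>t a X. t \<in> I \<Longrightarrow> X \<in> lie_algebra G A \<Longrightarrow> rotate_frame R (e t) a X = f t a X"
  shows "globally_defined G A I e b"
  unfolding globally_defined_def
proof (intro exI conjI ballI allI)
  interpret vfield_lie_algebra "lie_algebra G A" by (rule V)
  let ?R = "\<lambda>a b. R b a"
  let ?e = "\<lambda>t. rotate_frame ?R (f t)"
  show "parallel_spinor_flow G A UNIV b ?e"
  proof (rule parallel_spinor_flow_of_shape_flow[OF V _ _ _ b(1) b(2)])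
    show "UNIV \<noteq> {0 :: real}" using infinite_UNIV_char_0 by (metis finite.intros)
    show "shape_flow (lie_algebra G A) UNIV b ?e (\<lambda>t. rotate_shape ?R (S t))"
      by (rule shape_flow_rotate[OF flow frame_rotation_transpose[OF R]])
    show "smooth_on_interval UNIV (\<lambda>t. ?e t a X)" for a X
      unfolding smooth_on_UNIV_iff rotate_frame_def sum_frame_index
      by (intro allI times_differentiable_intros smooth)
  qed simp_all
  fix t a X assume tX: "t \<in> I" "X \<in> lie_algebra G A"
  have "rotate_frame ?R (f t) a X = rotate_frame ?R (rotate_frame R (e t)) a X"
    by (simp add: rotate_frame_def[of ?R] eq[OF tX])
  then show "rotate_frame ?R (f t) a X = e t a X" by (simp add: rotate_frame_inverse[OF R])
qed

locale extended_lapse =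
  fixes G :: "'g::{t2_space, second_countable_topology} monoid" and A :: "('g, 'e::euclidean_space) chart set"
    and I :: "real set" and \<beta> b :: "real \<Rightarrow> real" and e :: "real \<Rightarrow> 'g vfield frame"
    and S :: "real \<Rightarrow> frame_index \<Rightarrow> frame_index \<Rightarrow> real"
  assumes V: "vfield_lie_algebra (lie_algebra G A)"
    and I: "is_interval I" "0 \<in> I" "I \<noteq> {0}"
    and flow: "shape_flow (lie_algebra G A) I \<beta> e S"
    and b: "smooth_on_interval UNIV b" "\<And>t. 0 < b t" "\<And>t. t \<in> I \<Longrightarrow> b t = \<beta> t"
begin

lemma b_continuous: "continuous_on UNIV b"
  by (rule smooth_on_interval_continuous[OF b(1)])

lemma lapse_deriv: "(lapse_integral b has_real_derivative b t) (at t)"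
  using lapse_integral_deriv[OF _ _ b_continuous, of t] by simp

lemma lapse_deriv_on: "t \<in> I \<Longrightarrow> (lapse_integral b has_real_derivative \<beta> t) (at t within I)"
  using lapse_deriv[of t] b(3)[of t] by (metis has_field_derivative_at_within)

sublocale spinor_flow_on "lie_algebra G A" I \<beta> "lapse_integral b" e S
  using V I(1,2) flow lapse_deriv_on lapse_integral_zero
  by (simp add: spinor_flow_on_def spinor_flow_on_axioms_def)

lemma b_times_differentiable: "times_differentiable n b"
  using b(1) by (simp add: smooth_on_UNIV_iff)

lemma lapse_times_differentiable: "times_differentiable n (lapse_integral b)"
  by (rule times_differentiable_ode[OF lapse_deriv b_times_differentiable])

lemma globally_definedE:
  assumes "globally_defined G A I e b"
  obtains e' S' where "spinor_flow_on (lie_algebra G A) UNIV b (lapse_integral b) e' S'" "S' 0 = S 0"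
proof -
  obtain e' where e': "parallel_spinor_flow G A UNIV b e'"
    "\<And>t a X. t \<in> I \<Longrightarrow> X \<in> lie_algebra G A \<Longrightarrow> e' t a X = e t a X"
    using assms by (auto simp: globally_defined_def)
  obtain S' where S': "shape_flow (lie_algebra G A) UNIV b e' S'"
    by (rule shape_flow_of_parallel_spinor_flow[OF V e'(1)])
  have "spinor_flow_on (lie_algebra G A) UNIV b (lapse_integral b) e' S'"
    using V S' lapse_deriv lapse_integral_zero by (simp add: spinor_flow_on_def spinor_flow_on_axioms_def)
  moreover have "S' 0 = S 0"
    by (rule initial_shape_unique[OF I _ _ V flow S' e'(2)]) (use b(2)[of 0] b(3)[OF I(2)] in auto)
  ultimately show thesis by (rule that)
qed

text \<open>Necessity is the positivity of the factor of \<open>e\<^sub>u\<close> along an extension. If the bound holds, the explicit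
  solution is defined and smooth on the whole line.\<close>

lemma untilted_global_iff:
  assumes S0: "S 0 Iu Il = 0" "S 0 Iu In = 0"
  shows "globally_defined G A I e b \<longleftrightarrow> (\<forall>t. S 0 Iu Iu * lapse_integral b t < 1)"
proof
  assume "globally_defined G A I e b"
  then obtain e' S' where ext: "spinor_flow_on (lie_algebra G A) UNIV b (lapse_integral b) e' S'"
    and S': "S' 0 = S 0" by (rule globally_definedE)
  then show "\<forall>t. S 0 Iu Iu * lapse_integral b t < 1"
    using spinor_flow_on.eu_factor_pos[OF ext] S0 by simp
next
  assume less: "\<forall>t. S 0 Iu Iu * lapse_integral b t < 1"
  let ?B = "lapse_integral b" and ?\<kappa> = "S 0 Iu Iu"
  have pos: "0 < 1 - ?\<kappa> * ?B t" for t using less by (simp add: less_diff_eq)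
  obtain Q where Q: "eigenbasis Q (shape_block (S 0))"
    using eigenbasis_exists[of "shape_block (S 0)"] by (auto simp: shape_block_entries)
  have R: "frame_rotation (frame_rotation_of Q)" using Q by (simp add: eigenbasis_def frame_rotation_of_orthogonal)
  define f0 where "f0 = rotate_frame (frame_rotation_of Q) (e 0)"
  define g where "g = (\<lambda>a t. flow_factor ?\<kappa> (principal_value (S 0) a) (?B t))"
  have gu: "g Iu t = 1 - ?\<kappa> * ?B t" for t
    by (simp add: g_def principal_value_def flow_factor_self[OF pos])
  have g: "(g a has_real_derivative - (b t * (principal_value (S 0) a / g Iu t)) * g a t) (at t)" for a t
    unfolding gu unfolding g_def by (rule flow_factor_deriv[OF lapse_deriv pos])
  \<comment> \<open>\<open>u = 1 / (1 - \<kappa> B)\<close> solves \<open>u' = \<kappa> b u\<^sup>2\<close>\<close>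
  have inv: "times_differentiable n (\<lambda>t. 1 / g Iu t)" for n
  proof (rule times_differentiable_ode)
    show "((\<lambda>t. 1 / g Iu t) has_real_derivative principal_value (S 0) Iu * b t * (1 / g Iu t) * (1 / g Iu t)) (at t)" for t
      using DERIV_inverse_fun[OF g[of Iu t]] pos[of t]
      by (simp add: gu inverse_eq_divide power2_eq_square mult.commute)
  qed (intro times_differentiable_intros b_times_differentiable)
  have g_smooth: "times_differentiable n (g a)" for n a
  proof (rule times_differentiable_ode)
    show "(g a has_real_derivative (-1) * (b t * (principal_value (S 0) a * (1 / g Iu t))) * g a t) (at t)" for t
      using g[of a t] by simp
  qed (intro times_differentiable_intros b_times_differentiable inv)
  have "shape_flow (lie_algebra G A) UNIV b (\<lambda>t a X. g a t * f0 a X)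
      (\<lambda>t a c. if a = c then principal_value (S 0) a / g Iu t else 0)"
  proof (rule diagonal_shape_flow)
    show "left_invariant_coframe (lie_algebra G A) f0"
      unfolding f0_def by (rule rotated_coframe[OF R I(2)])
    show "f0 a (bracket X Y) = principal_value (S 0) a * (f0 Iu X * f0 a Y - f0 Iu Y * f0 a X)"
      if "X \<in> lie_algebra G A" "Y \<in> lie_algebra G A" for a X Y
      unfolding f0_def by (rule diagonal_structure[OF S0 Q that])
    show "g a t \<noteq> 0" for a t
      using flow_factor_pos[OF pos[of t], of "principal_value (S 0) a"] by (simp add: g_def)
    show "g Iu 0 = 1" by (simp add: gu lapse_integral_zero)
  qed (rule g)
  then show "globally_defined G A I e b"
  proof (rule globally_definedI[OF V b(1,2) _ R])
    show "times_differentiable n (\<lambda>t. g a t * f0 a X)" for n a X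
      by (intro times_differentiable_intros g_smooth)
    show "rotate_frame (frame_rotation_of Q) (e t) a X = g a t * f0 a X"
      if "t \<in> I" "X \<in> lie_algebra G A" for t a X
      unfolding g_def f0_def by (rule untilted_flow_explicit[OF S0 Q that])
  qed
qed

text \<open>Along an extension \<open>y\<close> is an arctangent. Conversely, \<open>tan y\<close> and with it the explicit solution is smooth as
  long as \<open>\<bar>y\<bar> < \<pi>/2\<close>.\<close>

lemma tilted_global_iff:
  fixes l :: real
  defines "l \<equiv> sqrt ((S 0 Iu Il)\<^sup>2 + (S 0 Iu In)\<^sup>2)"
  assumes l: "l \<noteq> 0"
  shows "globally_defined G A I e b \<longleftrightarrow> (\<forall>t. \<bar>y_angle l (S 0 Iu Iu) b t\<bar> < pi / 2)"
proof
  assume "globally_defined G A I e b"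
  then obtain e' S' where ext: "spinor_flow_on (lie_algebra G A) UNIV b (lapse_integral b) e' S'"
    and S': "S' 0 = S 0" by (rule globally_definedE)
  show "\<forall>t. \<bar>y_angle l (S 0 Iu Iu) b t\<bar> < pi / 2"
    using spinor_flow_on.tilted_metric(1)[OF ext] l unfolding S' l_def y_angle_def by simp
next
  assume y: "\<forall>t. \<bar>y_angle l (S 0 Iu Iu) b t\<bar> < pi / 2"
  let ?B = "lapse_integral b" and ?\<kappa> = "S 0 Iu Iu"
  define Q :: "real^2^2" where
    "Q = vector [vector [S 0 Iu In / l, S 0 Iu Il / l], vector [- S 0 Iu Il / l, S 0 Iu In / l]]"
  let ?R = "frame_rotation_of Q"
  note tilt = tilt_rotation[folded l_def, folded Q_def, OF l]
  note str = tilted_structure[folded l_def, folded Q_def, OF l]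
  interpret rot: spinor_flow_on "lie_algebra G A" I \<beta> ?B "\<lambda>t. rotate_frame ?R (e t)" "\<lambda>t. rotate_shape ?R (S t)"
    by (rule rotated[OF tilt(1)])
  define \<tau> where "\<tau> = (\<lambda>t. tan (l * ?B t + arctan (?\<kappa> / l)))"
  have \<tau>: "(\<tau> has_real_derivative l * b t * (1 + (\<tau> t)\<^sup>2)) (at t)" for t
  proof -
    have "- (pi / 2) < l * ?B t + arctan (?\<kappa> / l)" "l * ?B t + arctan (?\<kappa> / l) < pi / 2"
      using y[rule_format, of t] unfolding y_angle_def by linarith+
    then have c: "cos (l * ?B t + arctan (?\<kappa> / l)) \<noteq> 0"
      using cos_gt_zero_pi[of "l * ?B t + arctan (?\<kappa> / l)"] by simp
    have "((\<lambda>t. l * ?B t + arctan (?\<kappa> / l)) has_real_derivative l * b t + 0) (at t)"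
      by (intro DERIV_add DERIV_cmult DERIV_const lapse_deriv)
    from DERIV_chain2[OF DERIV_tan[OF c] this] show ?thesis
      using tan_sec[OF c] by (simp add: \<tau>_def power_inverse mult.commute)
  qed
  have \<tau>_smooth: "times_differentiable n \<tau>" for n
    by (rule times_differentiable_ode[OF \<tau>])
      (unfold power2_eq_square, intro times_differentiable_intros b_times_differentiable)
  define f where "f = (\<lambda>t a X. case a of
        Iu \<Rightarrow> (1 - ?\<kappa> * ?B t) * rotate_frame ?R (e 0) Iu X - l * ?B t * rotate_frame ?R (e 0) In X
      | Il \<Rightarrow> rotate_frame ?R (e 0) Il X
      | In \<Rightarrow> (?\<kappa> / l - \<tau> t * (1 - ?\<kappa> * ?B t)) * rotate_frame ?R (e 0) Iu X
          + (1 + l * ?B t * \<tau> t) * rotate_frame ?R (e 0) In X)"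
  have "\<exists>S'. shape_flow (lie_algebra G A) UNIV b f S'"
    unfolding f_def
  proof (rule exI, rule tilted_shape_flow[OF rotated_coframe[OF tilt(1) I(2)] l])
    show "\<tau> 0 = ?\<kappa> / l" by (simp add: \<tau>_def lapse_integral_zero tan_arctan)
  qed (use str lapse_deriv lapse_integral_zero \<tau> in simp_all)
  then obtain S' where ext: "shape_flow (lie_algebra G A) UNIV b f S'" ..
  show "globally_defined G A I e b"
  proof (rule globally_definedI[OF V b(1,2) ext tilt(1)])
    show "times_differentiable n (\<lambda>t. f t a X)" for n a X
      unfolding f_def by (cases a; simp only: frame_index.case)
        (intro times_differentiable_intros lapse_times_differentiable \<tau>_smooth)+
    show "rotate_frame ?R (e t) a X = f t a X"
      if "t \<in> I" "X \<in> lie_algebra G A" for t a X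
      using rot.tilted_flow_explicit(2-4)[OF tilt(3) _ that(1) that(2), unfolded tilt(2,4), OF l]
      by (cases a) (simp_all add: f_def \<tau>_def)
  qed
qed

end

section \<open>The classification of left-invariant parallel spinor flows\<close>

theorem theorem1p4:
  fixes G :: "'g::{t2_space, second_countable_topology} monoid"
    and A :: "('g, real^3) chart set"
    and I :: "real set"
    and \<beta> :: "real \<Rightarrow> real"
    and e :: "real \<Rightarrow> 'g vfield frame"
    and V :: "'g vfield set"
    and \<Theta> :: "frame_index \<Rightarrow> frame_index \<Rightarrow> real"
    and lam T \<Delta> :: real
    and \<theta> :: "real^2^2"
  assumes G: "simply_connected_lie_group G A"
    and flow: "parallel_spinor_flow G A I \<beta> e"
    and V: "V = lie_algebra G A"
    and \<Theta>: "\<forall>X\<in>V. \<forall>Y\<in>V.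
      Theta I \<beta> e 0 X Y = (\<Sum>a\<in>UNIV. \<Sum>b\<in>UNIV. \<Theta> a b * tensor (e 0 a) (e 0 b) X Y)"
    and lam: "lam = sqrt ((\<Theta> Iu Il)^2 + (\<Theta> Iu In)^2)"
    and \<theta>: "\<theta> = vector [vector [\<Theta> Il Il, \<Theta> Il In], vector [\<Theta> Il In, \<Theta> In In]]"
    and T: "T = trace \<theta>"
    and \<Delta>: "\<Delta> = det \<theta>"
  shows
    "((\<Theta> Iu Il)^2 + (\<Theta> Iu In)^2 = 0 \<longrightarrow>
       (\<Theta> Iu Iu \<noteq> 0 \<longrightarrow>
          (\<exists>Q. diagonalizes Q \<theta> (\<Theta> Iu Iu)) \<and>
          (\<forall>Q. diagonalizes Q \<theta> (\<Theta> Iu Iu) \<longrightarrow>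
             (\<forall>t\<in>I. \<forall>X\<in>V. \<forall>Y\<in>V.
                frame_metric (e t) X Y = metric1 (e 0) \<theta> Q (\<Theta> Iu Iu) (lapse_integral \<beta> t) X Y))) \<and>
       (\<Theta> Iu Iu = 0 \<longrightarrow>
          (\<exists>Q. \<forall>x. x \<noteq> 0 \<longrightarrow> diagonalizes Q \<theta> x) \<and>
          (\<forall>Q. (\<forall>x. x \<noteq> 0 \<longrightarrow> diagonalizes Q \<theta> x) \<longrightarrow>
             (\<forall>t\<in>I. \<forall>X\<in>V. \<forall>Y\<in>V.
                ((\<lambda>x. metric1 (e 0) \<theta> Q x (lapse_integral \<beta> t) X Y)
                   \<longlongrightarrow> frame_metric (e t) X Y) (at 0)))) \<and>
       (\<theta> = 0 \<longrightarrow> is_R3 G A) \<and>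
       (T = 0 \<and> \<theta> \<noteq> 0 \<longrightarrow> is_E11 G A) \<and>
       (T \<noteq> 0 \<and> \<Delta> = 0 \<longrightarrow> is_tau2_R G A) \<and>
       (T \<noteq> 0 \<and> \<Delta> \<noteq> 0 \<longrightarrow> (\<exists>\<mu>. is_tau3 \<mu> G A))) \<and>
    (\<Theta> Iu Il = 0 \<and> \<Theta> Iu In \<noteq> 0 \<longrightarrow>
       (\<forall>t\<in>I. \<forall>X\<in>V. \<forall>Y\<in>V.
          frame_metric (e t) X Y =
            metric2 (e 0) Il In (\<Theta> Iu Iu) (\<Theta> Iu In) lam
              (lapse_integral \<beta> t) (y_angle lam (\<Theta> Iu Iu) \<beta> t) X Y) \<and>
       is_tau2_R G A) \<and>
    (\<Theta> Iu Il \<noteq> 0 \<and> \<Theta> Iu In = 0 \<longrightarrow>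
       (\<forall>t\<in>I. \<forall>X\<in>V. \<forall>Y\<in>V.
          frame_metric (e t) X Y =
            metric2 (e 0) In Il (\<Theta> Iu Iu) (\<Theta> Iu Il) lam
              (lapse_integral \<beta> t) (y_angle lam (\<Theta> Iu Iu) \<beta> t) X Y) \<and>
       is_tau2_R G A) \<and>
    (\<Theta> Iu Il * \<Theta> Iu In \<noteq> 0 \<longrightarrow>
       (\<forall>t\<in>I. \<forall>X\<in>V. \<forall>Y\<in>V.
          frame_metric (e t) X Y =
            metric3 (e 0) T (\<Theta> Iu Il) (\<Theta> Iu In) lam
              (lapse_integral \<beta> t) (y_angle lam (\<Theta> Iu Iu) \<beta> t) X Y) \<and>
       is_tau2_R G A) \<and>
    (\<forall>b. smooth_on_interval UNIV b \<and> (\<forall>t. 0 < b t) \<and> (\<forall>t\<in>I. b t = \<beta> t) \<longrightarrow>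
       (lam = 0 \<longrightarrow>
          (globally_defined G A I e b \<longleftrightarrow>
             (\<integral>\<^sup>+\<tau>\<in>{\<tau>. 0 \<le> \<Theta> Iu Iu * \<tau>}. ennreal (b \<tau>) \<partial>lborel) \<le> 1 / ennreal \<bar>\<Theta> Iu Iu\<bar>) \<and>
          (0 < \<Theta> Iu Iu \<and>
           (\<integral>\<^sup>+\<tau>\<in>{0..}. ennreal (b \<tau>) \<partial>lborel) \<noteq> ennreal \<bar>inverse (\<Theta> Iu Iu)\<bar> \<longrightarrow>
             (globally_defined G A I e b \<longleftrightarrow>
                (\<integral>\<^sup>+\<tau>\<in>{0..}. ennreal (b \<tau>) \<partial>lborel) < ennreal \<bar>inverse (\<Theta> Iu Iu)\<bar>))) \<and>
       (lam \<noteq> 0 \<longrightarrow>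
          (globally_defined G A I e b \<longleftrightarrow>
             (\<forall>t. \<bar>y_angle lam (\<Theta> Iu Iu) b t\<bar> < pi / 2))))"
proof -
  have V': "vfield_lie_algebra (lie_algebra G A)"
    using G lie_group_vfield_lie_algebra by (auto simp: simply_connected_lie_group_def)
  interpret alg: vfield_lie_algebra V unfolding V by (rule V')
  have I: "is_interval I" "0 \<in> I" "I \<noteq> {0}" and \<beta>: "smooth_on_interval I \<beta>" "\<And>t. t \<in> I \<Longrightarrow> 0 < \<beta> t"
    using flow unfolding parallel_spinor_flow_def Let_def by blast+
  obtain S where S: "shape_flow V I \<beta> e S"
    unfolding V by (rule shape_flow_of_parallel_spinor_flow[OF V' flow])
  have cont: "continuous_on I \<beta>"
    by (rule smooth_on_interval_continuous[OF \<beta>(1)])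
  interpret spinor_flow_on V I \<beta> "lapse_integral \<beta>" e S
    using alg.vfield_lie_algebra_axioms I(1,2) S lapse_integral_deriv[OF I(1,2) cont] lapse_integral_zero
    by (simp add: spinor_flow_on_def spinor_flow_on_axioms_def)
  have flow_on: "spinor_flow_on (lie_algebra G A) I \<beta> (lapse_integral \<beta>) e S"
    using spinor_flow_on_axioms V by simp
  have \<Theta>_S: "\<Theta> = S 0"
  proof (intro ext)
    fix a b
    obtain E where E: "\<And>a. E a \<in> V" "\<And>a b. e 0 b (E a) = (if a = b then 1 else 0)"
      by (rule alg.coframe_dual_basis[OF shape_flowD(1)[OF S I(2)]]) blast
    have "(\<Sum>c\<in>UNIV. \<Sum>d\<in>UNIV. \<Theta> c d * tensor (e 0 c) (e 0 d) (E a) (E b))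
      = (\<Sum>c\<in>UNIV. \<Sum>d\<in>UNIV. S 0 c d * tensor (e 0 c) (e 0 d) (E a) (E b))"
      using \<Theta>[rule_format, OF E(1)[of a] E(1)[of b]]
        alg.Theta_of_shape_flow[OF I \<beta>(2) S I(2) E(1)[of a] E(1)[of b]] by simp
    then show "\<Theta> a b = S 0 a b"
      by (cases a; cases b) (simp_all add: sum_frame_index tensor_def E(2))
  qed
  have \<theta>_S: "\<theta> = shape_block (S 0)" by (simp add: \<theta> \<Theta>_S shape_block_def)
  have T_S: "T = S 0 Il Il + S 0 In In" by (simp add: T \<theta>_S trace_def sum_2 shape_block_entries)
  have lam_S: "lam = sqrt ((S 0 Iu Il)\<^sup>2 + (S 0 Iu In)\<^sup>2)" by (simp add: lam \<Theta>_S)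
  have lam_zero: "lam = 0 \<longleftrightarrow> S 0 Iu Il = 0 \<and> S 0 Iu In = 0"
    by (simp add: lam_S sum_power2_eq_zero_iff)
  obtain Q0 where Q0: "eigenbasis Q0 \<theta>"
    using eigenbasis_exists[of \<theta>] by (auto simp: \<theta>_S shape_block_entries)
  note sqz = sum_power2_eq_zero_iff
  have y: "y_angle lam (S 0 Iu Iu) \<beta> t = lam * lapse_integral \<beta> t + arctan (S 0 Iu Iu / lam)" for t
    by (simp add: y_angle_def)
  have tau2: "is_tau2_R G A" if "lam \<noteq> 0"
    using tilted_group[OF G flow_on] that by (simp add: lam_S)
  show ?thesis
    unfolding \<Theta>_S
  proof (intro conjI impI)
    assume "(S 0 Iu Il)\<^sup>2 + (S 0 Iu In)\<^sup>2 = 0"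
    then have S0: "S 0 Iu Il = 0" "S 0 Iu In = 0" by (simp_all only: sqz)
    note groups = untilted_group[OF G flow_on S0, folded \<theta>_S]
    show "is_R3 G A" if "\<theta> = 0" using groups(1) that .
    show "is_E11 G A" if "T = 0 \<and> \<theta> \<noteq> 0" using groups(2) that T by simp
    show "is_tau2_R G A" if "T \<noteq> 0 \<and> \<Delta> = 0" using groups(3) that T \<Delta> by simp
    show "\<exists>\<mu>. is_tau3 \<mu> G A" if "T \<noteq> 0 \<and> \<Delta> \<noteq> 0" using groups(4) that T \<Delta> by simp
    show "\<exists>Q. diagonalizes Q \<theta> (S 0 Iu Iu)" if "S 0 Iu Iu \<noteq> 0"
      using Q0 diagonalizes_iff[OF that] by blast
    show "\<forall>Q. diagonalizes Q \<theta> (S 0 Iu Iu) \<longrightarrow> (\<forall>t\<in>I. \<forall>X\<in>V. \<forall>Y\<in>V.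
        frame_metric (e t) X Y = metric1 (e 0) \<theta> Q (S 0 Iu Iu) (lapse_integral \<beta> t) X Y)"
      if "S 0 Iu Iu \<noteq> 0"
      using untilted_metric1[OF S0 that] unfolding \<theta>_S by blast
    show "\<exists>Q. \<forall>x. x \<noteq> 0 \<longrightarrow> diagonalizes Q \<theta> x"
      using Q0 diagonalizes_iff by blast
    show "\<forall>Q. (\<forall>x. x \<noteq> 0 \<longrightarrow> diagonalizes Q \<theta> x) \<longrightarrow> (\<forall>t\<in>I. \<forall>X\<in>V. \<forall>Y\<in>V.
        ((\<lambda>x. metric1 (e 0) \<theta> Q x (lapse_integral \<beta> t) X Y) \<longlongrightarrow> frame_metric (e t) X Y) (at 0))"
      if "S 0 Iu Iu = 0"
    proof (intro allI impI ballI)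
      fix Q t X Y
      assume "\<forall>x. x \<noteq> 0 \<longrightarrow> diagonalizes Q \<theta> x" and *: "t \<in> I" "X \<in> V" "Y \<in> V"
      then have "eigenbasis Q (shape_block (S 0))" using diagonalizes_iff[of 1 Q \<theta>] by (simp add: \<theta>_S)
      from untilted_metric1_limit[OF S0 that this *]
      show "((\<lambda>x. metric1 (e 0) \<theta> Q x (lapse_integral \<beta> t) X Y) \<longlongrightarrow> frame_metric (e t) X Y) (at 0)"
        unfolding \<theta>_S .
    qed
  next
    assume *: "S 0 Iu Il = 0 \<and> S 0 Iu In \<noteq> 0"
    then show "is_tau2_R G A" using tau2 lam_zero by blast
    show "\<forall>t\<in>I. \<forall>X\<in>V. \<forall>Y\<in>V. frame_metric (e t) X Y =
        metric2 (e 0) Il In (S 0 Iu Iu) (S 0 Iu In) lam (lapse_integral \<beta> t) (y_angle lam (S 0 Iu Iu) \<beta> t) X Y"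
    proof (intro ballI)
      fix t X Y assume tXY: "t \<in> I" "X \<in> V" "Y \<in> V"
      show "frame_metric (e t) X Y = metric2 (e 0) Il In (S 0 Iu Iu) (S 0 Iu In) lam (lapse_integral \<beta> t)
          (y_angle lam (S 0 Iu Iu) \<beta> t) X Y"
        using tilted_metric2(1)[OF tXY conjunct1[OF *] conjunct2[OF *]] unfolding y unfolding lam_S .
    qed
  next
    assume *: "S 0 Iu Il \<noteq> 0 \<and> S 0 Iu In = 0"
    then show "is_tau2_R G A" using tau2 lam_zero by blast
    show "\<forall>t\<in>I. \<forall>X\<in>V. \<forall>Y\<in>V. frame_metric (e t) X Y =
        metric2 (e 0) In Il (S 0 Iu Iu) (S 0 Iu Il) lam (lapse_integral \<beta> t) (y_angle lam (S 0 Iu Iu) \<beta> t) X Y"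
    proof (intro ballI)
      fix t X Y assume tXY: "t \<in> I" "X \<in> V" "Y \<in> V"
      show "frame_metric (e t) X Y = metric2 (e 0) In Il (S 0 Iu Iu) (S 0 Iu Il) lam (lapse_integral \<beta> t)
          (y_angle lam (S 0 Iu Iu) \<beta> t) X Y"
        using tilted_metric2(2)[OF tXY conjunct1[OF *] conjunct2[OF *]] unfolding y unfolding lam_S .
    qed
  next
    assume "S 0 Iu Il * S 0 Iu In \<noteq> 0"
    then have nz: "lam \<noteq> 0" using lam_zero by auto
    then show "is_tau2_R G A" by (rule tau2)
    show "\<forall>t\<in>I. \<forall>X\<in>V. \<forall>Y\<in>V. frame_metric (e t) X Y =
        metric3 (e 0) T (S 0 Iu Il) (S 0 Iu In) lam (lapse_integral \<beta> t) (y_angle lam (S 0 Iu Iu) \<beta> t) X Y"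
    proof (intro ballI)
      fix t X Y assume tXY: "t \<in> I" "X \<in> V" "Y \<in> V"
      show "frame_metric (e t) X Y = metric3 (e 0) T (S 0 Iu Il) (S 0 Iu In) lam (lapse_integral \<beta> t)
          (y_angle lam (S 0 Iu Iu) \<beta> t) X Y"
        using tilted_metric3[OF nz[unfolded lam_S] tXY] unfolding y unfolding T_S lam_S .
    qed
  next
    show "\<forall>b. smooth_on_interval UNIV b \<and> (\<forall>t. 0 < b t) \<and> (\<forall>t\<in>I. b t = \<beta> t) \<longrightarrow>
       (lam = 0 \<longrightarrow>
          (globally_defined G A I e b \<longleftrightarrow>
             (\<integral>\<^sup>+\<tau>\<in>{\<tau>. 0 \<le> S 0 Iu Iu * \<tau>}. ennreal (b \<tau>) \<partial>lborel) \<le> 1 / ennreal \<bar>S 0 Iu Iu\<bar>) \<and>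
          (0 < S 0 Iu Iu \<and>
           (\<integral>\<^sup>+\<tau>\<in>{0..}. ennreal (b \<tau>) \<partial>lborel) \<noteq> ennreal \<bar>inverse (S 0 Iu Iu)\<bar> \<longrightarrow>
             (globally_defined G A I e b \<longleftrightarrow>
                (\<integral>\<^sup>+\<tau>\<in>{0..}. ennreal (b \<tau>) \<partial>lborel) < ennreal \<bar>inverse (S 0 Iu Iu)\<bar>))) \<and>
       (lam \<noteq> 0 \<longrightarrow>
          (globally_defined G A I e b \<longleftrightarrow>
             (\<forall>t. \<bar>y_angle lam (S 0 Iu Iu) b t\<bar> < pi / 2)))"
    proof (intro allI impI)
      fix b assume b: "smooth_on_interval UNIV b \<and> (\<forall>t. 0 < b t) \<and> (\<forall>t\<in>I. b t = \<beta> t)"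
      interpret ext: extended_lapse G A I \<beta> b e S
        using V' I S b unfolding V by (simp add: extended_lapse_def)
      have glob: "globally_defined G A I e b \<longleftrightarrow>
          (\<integral>\<^sup>+\<tau>\<in>{\<tau>. 0 \<le> S 0 Iu Iu * \<tau>}. ennreal (b \<tau>) \<partial>lborel) \<le> 1 / ennreal \<bar>S 0 Iu Iu\<bar>" if "lam = 0"
        using ext.untilted_global_iff lapse_criterion[OF ext.lapse_deriv ext.b(2) ext.b_continuous lapse_integral_zero] that
        unfolding lam_zero by blast
      \<comment> \<open>for positive \<open>\<Theta>\<^sub>u\<^sub>u\<close> the weak bound is the strict one as soon as equality is excluded\<close>
  have half: "{\<tau>. 0 \<le> S 0 Iu Iu * \<tau>} = {0..}" "1 / ennreal \<bar>S 0 Iu Iu\<bar> = ennreal \<bar>inverse (S 0 Iu Iu)\<bar>"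
        if "0 < S 0 Iu Iu"
        using that by (auto simp: zero_le_mult_iff divide_ennreal inverse_eq_divide simp flip: ennreal_1)
      show "(lam = 0 \<longrightarrow>
          (globally_defined G A I e b \<longleftrightarrow>
             (\<integral>\<^sup>+\<tau>\<in>{\<tau>. 0 \<le> S 0 Iu Iu * \<tau>}. ennreal (b \<tau>) \<partial>lborel) \<le> 1 / ennreal \<bar>S 0 Iu Iu\<bar>) \<and>
          (0 < S 0 Iu Iu \<and>
           (\<integral>\<^sup>+\<tau>\<in>{0..}. ennreal (b \<tau>) \<partial>lborel) \<noteq> ennreal \<bar>inverse (S 0 Iu Iu)\<bar> \<longrightarrow>
             (globally_defined G A I e b \<longleftrightarrow>
                (\<integral>\<^sup>+\<tau>\<in>{0..}. ennreal (b \<tau>) \<partial>lborel) < ennreal \<bar>inverse (S 0 Iu Iu)\<bar>))) \<and>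
       (lam \<noteq> 0 \<longrightarrow>
          (globally_defined G A I e b \<longleftrightarrow>
             (\<forall>t. \<bar>y_angle lam (S 0 Iu Iu) b t\<bar> < pi / 2)))"
        using glob half ext.tilted_global_iff[folded lam_S] by (auto simp: less_le)
    qed
  qed
qed

end
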